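(* Let $u$ be the solution map of the affine parametric elliptic problem described in the context. Let $T=(t_k)_{k\ge0}\subset[-1,1]$ be a sequence of pairwise distinct points such that, for some $\theta\ge1$, either $\mathbb{L}_k\le(1+k)^\theta$ for all $k\ge0$, or $\mathbb{D}_k\le(1+k)^\theta$ for all $k\ge0$. Assume that $\rho=(\rho_j)_{j\ge1}$ is a sequence of positive numbers such that, for some $\widetilde r>0$, $$\sum_{j\ge1}\rho_j|\psi_j(x)|\le\overline a(x)-\widetilde r,\qquad x\in D,$$ with $(\rho_j^{-1})_{j\ge1}\in\ell^q(\mathbb{N})$ for some $0<q<2$ and $\rho_j>1$ for all $j$. Let $b:=(\rho_j^{-1})_{j\ge1}$. Then there is a constant $C$ independent of $n$ such that for all $n\ge1$ $$\|u-I_{\Lambda_n}u\|_{L^\infty(U,V)}\le Cn^{-s},\qquad s:=\frac1q-\frac12,$$ where $\Lambda_n$ is any downward closed set corresponding to the $n$ largest $\widehat\kappa_\nu$, where $\kappa_\nu$ is either $\pi(\nu)b^\nu$ or $\pi(\nu)\beta(\nu)^2b^\nu$.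
   Context: Setting: $D\subset\mathbb{R}^k$ is a bounded Lipschitz domain ($k=1,2$ or $3$), $f\in L^2(D)$, $\overline a,\psi_j\in L^\infty(D)$ for $j\ge1$, $V:=H^1_0(D)$, $U:=[-1,1]^{\mathbb{N}}$. For $y=(y_j)_{j\ge1}\in U$, let $a(y):=\overline a+\sum_{j\ge1}y_j\psi_j$ and let $u(y)\in V$ be the weak solution of $-\mathrm{div}(a(y)\nabla u(y))=f$ in $D$ with $u(y)=0$ on $\partial D$, i.e. $\int_D a(y)\nabla u(y)\cdot\nabla v=\int_D fv$ for all $v\in V$ (the displayed inequality in the claim, with $\rho_j>1$, implies $\sum_j|\psi_j|\le\overline a-\widetilde r$, so this is well-posed for all $y\in U$). Inequalities between functions on $D$ are understood almost everywhere. $\|v\|_{L^\infty(U,V)}:=\sup_{y\in U}\|v(y)\|_V$. $\mathcal{F}$ is the set of finitely supported sequences $\nu=(\nu_j)_{j\ge1}$ of nonnegative integers, with $\widetilde\nu\le\nu$ iff $\widetilde\nu_j\le\nu_j$ for all $j$. A set $\Lambda\subset\mathcal{F}$ is downward closed if $\nu\in\Lambda$, $\widetilde\nu\le\nu$ imply $\widetilde\nu\in\Lambda$. Notation: $b^\nu:=\prod_{j\ge1}b_j^{\nu_j}$, $\beta(\nu):=\prod_{j\ge1}(1+2\nu_j)^{1/2}$, $\pi(\nu):=\prod_{j\ge1}(1+\nu_j)^{\theta+1}$; the monotone majorant of $(\kappa_\nu)_{\nu\in\mathcal{F}}$ is $\widehat\kappa_\nu:=\max_{\widetilde\nu\ge\nu}|\kappa_{\widetilde\nu}|$.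 A set corresponding to the $n$ largest $\widehat\kappa_\nu$ is a set $\Lambda\subset\mathcal{F}$ with $\#(\Lambda)=n$ such that $\widehat\kappa_\nu\ge\widehat\kappa_\mu$ for all $\nu\in\Lambda$, $\mu\notin\Lambda$. Interpolation: $I_k$ is the univariate polynomial interpolation operator of degree $k$ at the points $t_0,\dots,t_k$ (so $I_kv$ is the polynomial of degree at most $k$ with $I_kv(t_i)=v(t_i)$ for $i=0,\dots,k$), $I_{-1}:=0$, and $\Delta_k:=I_k-I_{k-1}$ for $k\ge0$. $\mathbb{L}_k:=\sup\|I_kv\|_{L^\infty([-1,1])}/\|v\|_{L^\infty([-1,1])}$ and $\mathbb{D}_k:=\sup\|\Delta_kv\|_{L^\infty([-1,1])}/\|v\|_{L^\infty([-1,1])}$, with suprema over nonzero bounded real-valued functions $v$ defined everywhere on $[-1,1]$ (sup norms). For $\nu\in\mathcal{F}$, $\Delta_\nu:=\bigotimes_{j\ge1}\Delta_{\nu_j}$ (each $\Delta_{\nu_j}$ acting in the variable $y_j$; $\Delta_0=I_0$ is evaluation at $t_0$). For a finite downward closed set $\Lambda$, $I_\Lambda:=\sum_{\nu\in\Lambda}\Delta_\nu$; it is the interpolation operator onto $V\otimes\mathrm{span}\{y^\nu:\nu\in\Lambda\}$ associated with the points $y_\nu:=(t_{\nu_j})_{j\ge1}$, $\nu\in\Lambda$. *)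

theory Defs
  imports "HOL-Analysis.Analysis" "HOL-Computational_Algebra.Polynomial"
begin

text \<open>
  Functions on \<open>D\<close> are represented by everywhere defined functions on \<open>real ^ 'k\<close>; only their
  values on \<open>D\<close>, up to null sets, matter, and elements of the Lebesgue and Sobolev spaces below are
  such representatives. Sequences indexed by \<open>j \<ge> 1\<close> are indexed here by \<open>j :: nat\<close>.
\<close>

section \<open>Domains and function spaces\<close>

text \<open>Near each boundary point, \<open>D\<close> is the strict epigraph, in the direction of a unit vector \<open>e\<close>,
  of a Lipschitz function on the hyperplane orthogonal to \<open>e\<close>.\<close>

definition lipschitz_domain :: "(real ^ 'k) set \<Rightarrow> bool" where
  "lipschitz_domain D \<longleftrightarrow> open D \<and> connected D \<and> D \<noteq> {} \<and>
     (\<forall>p\<in>frontier D. \<exists>r>0. \<exists>e L \<gamma>. norm e = 1 \<and> L-lipschitz_on {z. z \<bullet> e = 0} \<gamma> \<and>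
        D \<inter> ball p r = {x \<in> ball p r. x \<bullet> e > \<gamma> (x - (x \<bullet> e) *\<^sub>R e)})"

definition L2 :: "(real ^ 'k) set \<Rightarrow> (real ^ 'k \<Rightarrow> real) set" where
  "L2 D = {f \<in> borel_measurable (lebesgue_on D). integrable (lebesgue_on D) (\<lambda>x. (f x)\<^sup>2)}"

definition Linf :: "(real ^ 'k) set \<Rightarrow> (real ^ 'k \<Rightarrow> real) set" where
  "Linf D = {f \<in> borel_measurable (lebesgue_on D). \<exists>M. AE x in lebesgue_on D. \<bar>f x\<bar> \<le> M}"

definition partial :: "'k \<Rightarrow> (real ^ 'k \<Rightarrow> real) \<Rightarrow> real ^ 'k \<Rightarrow> real" where
  "partial i f x = frechet_derivative f (at x) (axis i 1)"

primrec cont_diff :: "nat \<Rightarrow> (real ^ 'k \<Rightarrow> real) \<Rightarrow> bool" where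
  "cont_diff 0 f \<longleftrightarrow> continuous_on UNIV f"
| "cont_diff (Suc m) f \<longleftrightarrow> (\<forall>x. f differentiable (at x)) \<and> (\<forall>i. cont_diff m (partial i f))"

definition test_functions :: "(real ^ 'k) set \<Rightarrow> (real ^ 'k \<Rightarrow> real) set" where
  "test_functions D = {\<phi>. (\<forall>m. cont_diff m \<phi>) \<and>
     compact (closure {x. \<phi> x \<noteq> 0}) \<and> closure {x. \<phi> x \<noteq> 0} \<subseteq> D}"

definition has_weak_gradient ::
  "(real ^ 'k) set \<Rightarrow> (real ^ 'k \<Rightarrow> real) \<Rightarrow> (real ^ 'k \<Rightarrow> real ^ 'k) \<Rightarrow> bool" where
  "has_weak_gradient D v g \<longleftrightarrow>
     (\<forall>\<phi>\<in>test_functions D. \<forall>i.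
        (LINT x|lebesgue_on D. v x * partial i \<phi> x) = - (LINT x|lebesgue_on D. g x $ i * \<phi> x))"

definition H1 :: "(real ^ 'k) set \<Rightarrow> (real ^ 'k \<Rightarrow> real) set" where
  "H1 D = {v \<in> L2 D. \<exists>g. (\<forall>i. (\<lambda>x. g x $ i) \<in> L2 D) \<and> has_weak_gradient D v g}"

text \<open>The weak gradient is unique up to null subsets of \<open>D\<close>.\<close>

definition grad :: "(real ^ 'k) set \<Rightarrow> (real ^ 'k \<Rightarrow> real) \<Rightarrow> real ^ 'k \<Rightarrow> real ^ 'k" where
  "grad D v = (SOME g. (\<forall>i. (\<lambda>x. g x $ i) \<in> L2 D) \<and> has_weak_gradient D v g)"

definition H1_norm :: "(real ^ 'k) set \<Rightarrow> (real ^ 'k \<Rightarrow> real) \<Rightarrow> real" where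
  "H1_norm D v = sqrt ((LINT x|lebesgue_on D. (v x)\<^sup>2) + (LINT x|lebesgue_on D. (norm (grad D v x))\<^sup>2))"

text \<open>The closure of the test functions in the Sobolev space.\<close>

definition H10 :: "(real ^ 'k) set \<Rightarrow> (real ^ 'k \<Rightarrow> real) set" where
  "H10 D = {v \<in> H1 D. \<exists>\<phi>. (\<forall>n::nat. \<phi> n \<in> test_functions D) \<and>
     (\<lambda>n. H1_norm D (\<lambda>x. v x - \<phi> n x)) \<longlonglongrightarrow> 0}"

text \<open>The norm of \<open>V = H10 D\<close>, for bounded \<open>D\<close>: the \<open>L2\<close> norm of the gradient.\<close>

definition V_norm :: "(real ^ 'k) set \<Rightarrow> (real ^ 'k \<Rightarrow> real) \<Rightarrow> real" where
  "V_norm D v = sqrt (LINT x|lebesgue_on D. (norm (grad D v x))\<^sup>2)"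

section \<open>The parametric problem\<close>

definition U :: "(nat \<Rightarrow> real) set" where
  "U = {y. \<forall>j. y j \<in> {-1..1}}"

definition affine_coeff ::
  "(real ^ 'k \<Rightarrow> real) \<Rightarrow> (nat \<Rightarrow> real ^ 'k \<Rightarrow> real) \<Rightarrow> (nat \<Rightarrow> real) \<Rightarrow> real ^ 'k \<Rightarrow> real" where
  "affine_coeff abar \<psi> y x = abar x + (\<Sum>j. y j * \<psi> j x)"

definition weak_solution ::
  "(real ^ 'k) set \<Rightarrow> (real ^ 'k \<Rightarrow> real) \<Rightarrow> (real ^ 'k \<Rightarrow> real) \<Rightarrow> (real ^ 'k \<Rightarrow> real) \<Rightarrow> bool" where
  "weak_solution D a f w \<longleftrightarrow> w \<in> H10 D \<and>
     (\<forall>v\<in>H10 D. (LINT x|lebesgue_on D. a x * (grad D w x \<bullet> grad D v x))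
               = (LINT x|lebesgue_on D. f x * v x))"

text \<open>For a map from \<open>U\<close> to \<open>V\<close>. The supremum is taken in the extended reals, so that a bound on it
  is a bound on every \<open>V_norm D (w y)\<close>.\<close>

definition Linf_U_V_norm :: "(real ^ 'k) set \<Rightarrow> ((nat \<Rightarrow> real) \<Rightarrow> real ^ 'k \<Rightarrow> real) \<Rightarrow> ereal" where
  "Linf_U_V_norm D w = (SUP y\<in>U. ereal (V_norm D (w y)))"

section \<open>Multi-indices\<close>

text \<open>The order on multi-indices is the pointwise order on functions.\<close>

definition multi_indices :: "(nat \<Rightarrow> nat) set" where
  "multi_indices = {\<nu>. finite {j. \<nu> j \<noteq> 0}}"

definition downward_closed :: "(nat \<Rightarrow> nat) set \<Rightarrow> bool" where
  "downward_closed \<Lambda> \<longleftrightarrow> \<Lambda> \<subseteq> multi_indices \<and> (\<forall>\<nu>\<in>\<Lambda>. \<forall>\<mu>. \<mu> \<le> \<nu> \<longrightarrow> \<mu> \<in> \<Lambda>)"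

definition mpow :: "(nat \<Rightarrow> real) \<Rightarrow> (nat \<Rightarrow> nat) \<Rightarrow> real" where
  "mpow b \<nu> = (\<Prod>j | \<nu> j \<noteq> 0. b j ^ \<nu> j)"

definition beta_weight :: "(nat \<Rightarrow> nat) \<Rightarrow> real" where
  "beta_weight \<nu> = (\<Prod>j | \<nu> j \<noteq> 0. sqrt (1 + 2 * real (\<nu> j)))"

definition pi_weight :: "real \<Rightarrow> (nat \<Rightarrow> nat) \<Rightarrow> real" where
  "pi_weight \<theta> \<nu> = (\<Prod>j | \<nu> j \<noteq> 0. (1 + real (\<nu> j)) powr (\<theta> + 1))"

text \<open>The supremum is a maximum whenever \<open>\<kappa>\<close> tends to zero, i.e. has only finitely many values of
  modulus greater than any given positive number.\<close>

definition monotone_majorant :: "((nat \<Rightarrow> nat) \<Rightarrow> real) \<Rightarrow> (nat \<Rightarrow> nat) \<Rightarrow> real" where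
  "monotone_majorant \<kappa> \<nu> = (SUP \<mu>\<in>{\<mu> \<in> multi_indices. \<nu> \<le> \<mu>}. \<bar>\<kappa> \<mu>\<bar>)"

definition n_largest :: "((nat \<Rightarrow> nat) \<Rightarrow> real) \<Rightarrow> nat \<Rightarrow> (nat \<Rightarrow> nat) set \<Rightarrow> bool" where
  "n_largest \<kappa> n \<Lambda> \<longleftrightarrow> \<Lambda> \<subseteq> multi_indices \<and> finite \<Lambda> \<and> card \<Lambda> = n \<and>
     (\<forall>\<nu>\<in>\<Lambda>. \<forall>\<mu>\<in>multi_indices - \<Lambda>. \<kappa> \<nu> \<ge> \<kappa> \<mu>)"

section \<open>Interpolation\<close>

definition interp :: "(nat \<Rightarrow> real) \<Rightarrow> nat \<Rightarrow> (real \<Rightarrow> real) \<Rightarrow> real poly" where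
  "interp t k v = (THE p. degree p \<le> k \<and> (\<forall>i\<le>k. poly p (t i) = v (t i)))"

fun interp_diff :: "(nat \<Rightarrow> real) \<Rightarrow> nat \<Rightarrow> (real \<Rightarrow> real) \<Rightarrow> real poly" where
  "interp_diff t 0 v = interp t 0 v"
| "interp_diff t (Suc k) v = interp t (Suc k) v - interp t k v"

definition sup_norm :: "(real \<Rightarrow> real) \<Rightarrow> real" where
  "sup_norm v = (SUP s\<in>{-1..1}. \<bar>v s\<bar>)"

definition sup_op_norm :: "((real \<Rightarrow> real) \<Rightarrow> real poly) \<Rightarrow> real" where
  "sup_op_norm T = Sup {sup_norm (poly (T v)) / sup_norm v | v.
     bounded (v ` {-1..1}) \<and> (\<exists>s\<in>{-1..1}. v s \<noteq> 0)}"

definition act_in_variable ::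
  "nat \<Rightarrow> ((real \<Rightarrow> real) \<Rightarrow> real poly) \<Rightarrow> ((nat \<Rightarrow> real) \<Rightarrow> real) \<Rightarrow> (nat \<Rightarrow> real) \<Rightarrow> real" where
  "act_in_variable j T g y = poly (T (\<lambda>s. g (y(j := s)))) (y j)"

text \<open>The infinitely many factors outside the support of \<open>\<nu>\<close> are evaluations at \<open>t 0\<close>, performed
  simultaneously; the remaining finitely many factors, which commute, are then composed.\<close>

definition tensor_diff ::
  "(nat \<Rightarrow> real) \<Rightarrow> (nat \<Rightarrow> nat) \<Rightarrow> ((nat \<Rightarrow> real) \<Rightarrow> real) \<Rightarrow> (nat \<Rightarrow> real) \<Rightarrow> real" where
  "tensor_diff t \<nu> g =
     fold (\<lambda>j. act_in_variable j (interp_diff t (\<nu> j))) (sorted_list_of_set {j. \<nu> j \<noteq> 0})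
       (\<lambda>y. g (\<lambda>j. if \<nu> j = 0 then t 0 else y j))"

text \<open>For a function-valued map \<open>w\<close>, the interpolant at \<open>y\<close> is a finite linear combination of
  the functions \<open>w z\<close>, \<open>z\<close> ranging over interpolation points, with real coefficients depending only on \<open>y\<close>;
  so it may be computed separately for each \<open>x\<close>.\<close>

definition interp_op ::
  "(nat \<Rightarrow> real) \<Rightarrow> (nat \<Rightarrow> nat) set \<Rightarrow> ((nat \<Rightarrow> real) \<Rightarrow> real ^ 'k \<Rightarrow> real) \<Rightarrow>
   (nat \<Rightarrow> real) \<Rightarrow> real ^ 'k \<Rightarrow> real" where
  "interp_op t \<Lambda> w y x = (\<Sum>\<nu>\<in>\<Lambda>. tensor_diff t \<nu> (\<lambda>z. w z x) y)"

end

theory Submission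
  imports Defs "HOL-Real_Asymp.Real_Asymp"
begin

text \<open>Fix a parameter \<open>y\<close> and a downward closed set \<open>\<Lambda>\<close>. Interpolation at \<open>y\<close> is a finite linear
combination of point values, so the error involves the solution only at finitely many parameters: the
interpolation points and \<open>y\<close>. The gradients of these finitely many solutions, together with the one at
the origin, span a finite-dimensional space. Orthonormalise them in the energy product
\<open>\<integral> abar \<nabla>v \<cdot> \<nabla>w\<close> (\<open>galerkin_basis\<close>). As each of these solutions lies in the space it coincides with
its own Galerkin approximation, so its coordinates solve a system
\<open>(I + \<Sum>\<^sub>j y\<^sub>j B\<^sub>j) x(y) = F\<close> in \<open>\<real>\<^sup>N\<close>, where \<open>F\<close> is the coordinate vector of the solution at the origin.
All estimates for this system are independent of \<open>N\<close>, and so are the constants of the theorem.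

The system has an explicit power series solution \<open>x(y) = \<Sum>\<^sub>\<nu> t\<^sub>\<nu> y\<^sup>\<nu>\<close>, with \<open>t\<^sub>0 = F\<close> and
\<open>t\<^sub>\<nu> = - \<Sum>\<^sub>j B\<^sub>j t\<^bsub>\<nu> - e\<^sub>j\<^esub>\<close>. Testing the recursion with \<open>t\<^sub>\<nu>\<close> and using
\<open>\<Sum>\<^sub>j \<rho>\<^sub>j \<bar>\<psi>\<^sub>j\<bar> \<le> abar - r \<le> \<sigma> abar\<close> with \<open>\<sigma> < 1\<close> gives the weighted estimate
\<open>\<Sum>\<^sub>\<nu> (\<rho>\<^sup>\<nu> \<bar>t\<^sub>\<nu>\<bar>)\<^sup>2 \<le> \<bar>F\<bar>\<^sup>2 / (1 - \<sigma>)\<close> (\<open>scaled_square_sum\<close>). The square summability, rather than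
summability, is what produces the gain of \<open>1/2\<close> in the rate.

Interpolation reproduces \<open>y\<^sup>\<nu>\<close> for \<open>\<nu> \<in> \<Lambda>\<close> and has error at most \<open>2 \<pi>(\<nu>)\<close> on the other monomials
(\<open>interp_monomial\<close>). By the Cauchy-Schwarz inequality the interpolation error is therefore at most a
constant times \<open>(\<Sum>\<^bsub>\<nu> \<notin> \<Lambda>\<^esub> (\<pi>(\<nu>) b\<^sup>\<nu>)\<^sup>2)\<^sup>1\<^sup>/\<^sup>2\<close>. The monotone majorant of \<open>\<kappa>\<close> dominates
\<open>\<pi>(\<nu>) b\<^sup>\<nu>\<close> and is \<open>q\<close>-summable (\<open>monotone_majorant_summable\<close>), and Stechkin's estimate
(\<open>n_largest_tail\<close>) bounds its \<open>\<ell>\<^sup>2\<close> tail by a multiple of \<open>n\<close> to the power \<open>1/2 - 1/q\<close>.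

Since gradients are chosen representatives, the norm of the error can be compared with that of the
linear combination of gradients only because weak gradients are unique up to null sets; this is
\<open>weak_gradient_unique\<close>, derived from the fundamental lemma of the calculus of variations.\<close>

section \<open>Multi-indices and products over the variables\<close>

abbreviation supp :: "(nat \<Rightarrow> nat) \<Rightarrow> nat set" where
  "supp \<nu> \<equiv> {j. \<nu> j \<noteq> 0}"

lemma supp_mono: "\<nu> \<le> \<mu> \<Longrightarrow> supp \<nu> \<subseteq> supp \<mu>"
  by (auto simp: le_fun_def intro: less_le_trans)

lemma prod_supp_extend:
  fixes c :: "nat \<Rightarrow> nat \<Rightarrow> 'a::comm_monoid_mult"
  assumes "finite A" "supp \<nu> \<subseteq> A" "\<And>j. c j 0 = 1"
  shows "(\<Prod>j\<in>supp \<nu>. c j (\<nu> j)) = (\<Prod>j\<in>A. c j (\<nu> j))"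
  by (rule prod.mono_neutral_left) (use assms in auto)

text \<open>The multi-indices below \<open>\<nu>\<close> form a finite product of intervals, so sums of product weights over them
factor. This reduces both the summability of the majorant and the errors on monomials to one variable.\<close>

lemma sum_below_prod:
  fixes f :: "nat \<Rightarrow> nat \<Rightarrow> real"
  assumes A: "finite A" "supp \<nu> \<subseteq> A"
  shows "(\<Sum>\<mu> | \<mu> \<le> \<nu>. \<Prod>j\<in>A. f j (\<mu> j)) = (\<Prod>j\<in>A. \<Sum>n\<le>\<nu> j. f j n)"
    and "finite {\<mu>. \<mu> \<le> \<nu>}"
proof -
  let ?h = "\<lambda>g j. if j \<in> A then g j else (0::nat)"
  let ?P = "PiE A (\<lambda>j. {..\<nu> j})"
  have out: "\<mu> j = 0" if "\<mu> \<le> \<nu>" "j \<notin> A" for \<mu> j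
  proof -
    have "\<nu> j = 0" using that A by auto
    then show ?thesis using le_funD[OF that(1), of j] by simp
  qed
  have bij: "bij_betw ?h ?P {\<mu>. \<mu> \<le> \<nu>}"
  proof (rule bij_betw_byWitness[where f' = "\<lambda>\<mu>. restrict \<mu> A"])
    show "\<forall>a\<in>?P. restrict (?h a) A = a"
      by (auto simp: fun_eq_iff PiE_iff extensional_def)
    show "\<forall>a'\<in>{\<mu>. \<mu> \<le> \<nu>}. ?h (restrict a' A) = a'"
      using out by (auto simp: fun_eq_iff)
    show "?h ` ?P \<subseteq> {\<mu>. \<mu> \<le> \<nu>}"
      by (auto simp: le_fun_def PiE_iff)
    show "(\<lambda>\<mu>. restrict \<mu> A) ` {\<mu>. \<mu> \<le> \<nu>} \<subseteq> ?P"
      by (auto simp: le_fun_def)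
  qed
  have finP: "finite ?P" using A by (intro finite_PiE) auto
  then show "finite {\<mu>. \<mu> \<le> \<nu>}" using bij bij_betw_finite by blast
  have "(\<Sum>\<mu> | \<mu> \<le> \<nu>. \<Prod>j\<in>A. f j (\<mu> j)) = (\<Sum>g\<in>?P. \<Prod>j\<in>A. f j (?h g j))"
    by (rule sum.reindex_bij_betw[OF bij, symmetric])
  also have "\<dots> = (\<Sum>g\<in>?P. \<Prod>j\<in>A. f j (g j))"
    by (intro sum.cong prod.cong) auto
  also have "\<dots> = (\<Prod>j\<in>A. \<Sum>n\<le>\<nu> j. f j n)"
    by (rule prod_sum_PiE[symmetric]) (use A in auto)
  finally show "(\<Sum>\<mu> | \<mu> \<le> \<nu>. \<Prod>j\<in>A. f j (\<mu> j)) = (\<Prod>j\<in>A. \<Sum>n\<le>\<nu> j. f j n)" .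
qed

lemma finite_below: "\<nu> \<in> multi_indices \<Longrightarrow> finite {\<mu>. \<mu> \<le> \<nu>}"
  using sum_below_prod(2)[of "supp \<nu>" \<nu>] by (auto simp: multi_indices_def)

lemma multi_indices_mono: "\<mu> \<in> multi_indices" if "\<nu> \<in> multi_indices" "\<mu> \<le> \<nu>"
proof -
  have "supp \<mu> \<subseteq> supp \<nu>" by (rule supp_mono[OF that(2)])
  then show ?thesis using that(1) finite_subset unfolding multi_indices_def by blast
qed

lemma finite_multi_indices_bound:
  assumes "finite F" "F \<subseteq> multi_indices"
  obtains m where "m \<in> multi_indices" "F \<subseteq> {\<mu>. \<mu> \<le> m}"
proof
  let ?m = "\<lambda>j. \<Sum>\<nu>\<in>F. \<nu> j"
  have "supp ?m \<subseteq> (\<Union>\<nu>\<in>F. supp \<nu>)" by (auto simp: assms(1))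
  moreover have "finite (\<Union>\<nu>\<in>F. supp \<nu>)" using assms by (auto simp: multi_indices_def)
  ultimately show "?m \<in> multi_indices" using finite_subset unfolding multi_indices_def by blast
  have "\<mu> j \<le> (\<Sum>\<nu>\<in>F. \<nu> j)" if "\<mu> \<in> F" for \<mu> j
    using member_le_sum[of \<mu> F "\<lambda>\<nu>. \<nu> j"] assms that by simp
  then show "F \<subseteq> {\<mu>. \<mu> \<le> ?m}" by (auto simp: le_fun_def)
qed

text \<open>Each variable contributes a factor at most \<open>1 + C x\<^sub>j / (1 - X) \<le> exp (C x\<^sub>j / (1 - X))\<close>, so that
summability of \<open>x\<close> bounds the product uniformly in the number of variables that \<open>F\<close> involves.\<close>

lemma sum_prod_powers_bounded:
  fixes x :: "nat \<Rightarrow> real"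
  assumes x: "\<And>j. 0 \<le> x j" "\<And>j. x j \<le> X" "X < 1" "summable x" and C: "0 \<le> C"
    and F: "finite F" "F \<subseteq> multi_indices"
  shows "(\<Sum>\<nu>\<in>F. \<Prod>j\<in>supp \<nu>. C * x j ^ \<nu> j) \<le> exp (C / (1 - X) * suminf x)"
proof -
  obtain m where m: "m \<in> multi_indices" "F \<subseteq> {\<mu>. \<mu> \<le> m}"
    by (rule finite_multi_indices_bound[OF F])
  define A where "A = supp m"
  have A: "finite A" using m by (simp add: A_def multi_indices_def)
  let ?c = "\<lambda>j n. if n = 0 then 1 else C * x j ^ n"
  have eq: "(\<Prod>j\<in>supp \<nu>. C * x j ^ \<nu> j) = (\<Prod>j\<in>A. ?c j (\<nu> j))" if "\<nu> \<le> m" for \<nu>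
  proof -
    have "supp \<nu> \<subseteq> A" using supp_mono[OF that] by (simp add: A_def)
    then have "(\<Prod>j\<in>supp \<nu>. ?c j (\<nu> j)) = (\<Prod>j\<in>A. ?c j (\<nu> j))"
      using A by (intro prod_supp_extend) auto
    moreover have "(\<Prod>j\<in>supp \<nu>. ?c j (\<nu> j)) = (\<Prod>j\<in>supp \<nu>. C * x j ^ \<nu> j)"
      by (intro prod.cong) auto
    ultimately show ?thesis by simp
  qed
  have geo: "(\<Sum>n\<le>k. ?c j n) \<le> exp (C / (1 - X) * x j)" for j k
  proof -
    have "(\<Sum>n\<le>k. ?c j n) = 1 + (\<Sum>n<k. C * x j ^ Suc n)"
      by (simp add: atMost_atLeast0 sum.atLeast_Suc_atMost sum.atLeast1_atMost_eq
          del: power_Suc)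
    also have "(\<Sum>n<k. C * x j ^ Suc n) = C * x j * (\<Sum>n<k. x j ^ n)"
      by (simp add: sum_distrib_left mult_ac)
    also have "(\<Sum>n<k. x j ^ n) \<le> 1 / (1 - X)"
    proof -
      have "(\<Sum>n<k. x j ^ n) \<le> (\<Sum>n. x j ^ n)"
        using x(1,2)[of j] x(3) by (intro sum_le_suminf) (auto intro!: summable_geometric)
      also have "\<dots> = 1 / (1 - x j)" using x(1,2)[of j] x(3) by (intro suminf_geometric) auto
      also have "\<dots> \<le> 1 / (1 - X)" using x(1,2)[of j] x(3) by (intro divide_left_mono) auto
      finally show ?thesis .
    qed
    then have "1 + C * x j * (\<Sum>n<k. x j ^ n) \<le> 1 + C * x j * (1 / (1 - X))"
      using x C by (intro add_left_mono mult_left_mono) auto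
    also have "\<dots> \<le> exp (C / (1 - X) * x j)"
      using exp_ge_add_one_self[of "C / (1 - X) * x j"] by (simp add: mult_ac)
    finally show ?thesis by simp
  qed
  have "(\<Sum>\<nu>\<in>F. \<Prod>j\<in>supp \<nu>. C * x j ^ \<nu> j) \<le> (\<Sum>\<nu> | \<nu> \<le> m. \<Prod>j\<in>supp \<nu>. C * x j ^ \<nu> j)"
    using m C x by (intro sum_mono2 finite_below) (auto intro!: prod_nonneg)
  also have "\<dots> = (\<Sum>\<nu> | \<nu> \<le> m. \<Prod>j\<in>A. ?c j (\<nu> j))"
    by (rule sum.cong[OF refl], rule eq) simp
  also have "\<dots> = (\<Prod>j\<in>A. \<Sum>n\<le>m j. ?c j n)"
    by (rule sum_below_prod(1)) (use A in \<open>auto simp: A_def\<close>)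
  also have "\<dots> \<le> (\<Prod>j\<in>A. exp (C / (1 - X) * x j))"
    using C x by (intro prod_mono conjI geo sum_nonneg) auto
  also have "\<dots> = exp (\<Sum>j\<in>A. C / (1 - X) * x j)"
    using A by (simp add: exp_sum)
  also have "\<dots> \<le> exp (C / (1 - X) * suminf x)"
  proof -
    have "(\<Sum>j\<in>A. x j) \<le> suminf x" using x A by (intro sum_le_suminf) auto
    then show ?thesis using C x
      by (subst sum_distrib_left[symmetric], subst exp_le_cancel_iff, intro mult_left_mono) auto
  qed
  finally show ?thesis .
qed

text \<open>Since \<open>C\<close> may exceed \<open>1\<close>, the product is not decreasing in the multi-index. It is so up to a
constant: a larger multi-index only adds powers of \<open>x\<^sub>j \<le> 1\<close> on the old support, and every new
variable contributes at most \<open>C x\<^sub>j \<le> exp (C x\<^sub>j)\<close>.\<close>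

lemma prod_powers_antimono:
  fixes x :: "nat \<Rightarrow> real"
  assumes x: "\<And>j. 0 \<le> x j" "\<And>j. x j \<le> 1" "summable x" and C: "0 \<le> C"
    and \<mu>: "\<mu> \<in> multi_indices" "\<nu> \<le> \<mu>"
  shows "(\<Prod>j\<in>supp \<mu>. C * x j ^ \<mu> j) \<le> exp (C * suminf x) * (\<Prod>j\<in>supp \<nu>. C * x j ^ \<nu> j)"
proof -
  have fin: "finite (supp \<mu>)" and sub: "supp \<nu> \<subseteq> supp \<mu>"
    using \<mu> supp_mono by (auto simp: multi_indices_def)
  have "(\<Prod>j\<in>supp \<mu>. C * x j ^ \<mu> j) =
      (\<Prod>j\<in>supp \<mu> - supp \<nu>. C * x j ^ \<mu> j) * (\<Prod>j\<in>supp \<nu>. C * x j ^ \<mu> j)"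
    by (rule prod.subset_diff[OF sub fin])
  also have "\<dots> \<le> exp (C * suminf x) * (\<Prod>j\<in>supp \<nu>. C * x j ^ \<nu> j)"
  proof (intro mult_mono prod_nonneg ballI)
    have "(\<Prod>j\<in>supp \<mu> - supp \<nu>. C * x j ^ \<mu> j) \<le> (\<Prod>j\<in>supp \<mu> - supp \<nu>. exp (C * x j))"
    proof (intro prod_mono conjI)
      fix j assume "j \<in> supp \<mu> - supp \<nu>"
      then have "x j ^ \<mu> j \<le> x j ^ 1" using x by (intro power_decreasing) auto
      then have "C * x j ^ \<mu> j \<le> C * x j" using C by (intro mult_left_mono) auto
      also have "\<dots> \<le> exp (C * x j)" using exp_ge_add_one_self[of "C * x j"] by linarith
      finally show "C * x j ^ \<mu> j \<le> exp (C * x j)" .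
    qed (use C x in auto)
    also have "\<dots> = exp (C * (\<Sum>j\<in>supp \<mu> - supp \<nu>. x j))"
      using fin by (simp add: exp_sum sum_distrib_left)
    also have "\<dots> \<le> exp (C * suminf x)"
      using C x fin by (subst exp_le_cancel_iff, intro mult_left_mono sum_le_suminf) auto
    finally show "(\<Prod>j\<in>supp \<mu> - supp \<nu>. C * x j ^ \<mu> j) \<le> exp (C * suminf x)" .
    show "(\<Prod>j\<in>supp \<nu>. C * x j ^ \<mu> j) \<le> (\<Prod>j\<in>supp \<nu>. C * x j ^ \<nu> j)"
      using C x \<mu>(2) by (intro prod_mono conjI mult_left_mono power_decreasing) (auto simp: le_fun_def)
  qed (use C x in auto)
  finally show ?thesis .
qed

section \<open>Summability of the monotone majorant and its tails\<close>

lemma tendsto_0_uniform_less_1: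
  fixes f :: "nat \<Rightarrow> real"
  assumes "f \<longlonglongrightarrow> 0" "\<And>j. f j < 1"
  obtains X where "0 < X" "X < 1" "\<And>j. f j \<le> X"
proof -
  obtain N where N: "\<And>j. j \<ge> N \<Longrightarrow> f j < 1/2"
    using order_tendstoD(2)[OF assms(1), of "1/2"] by (auto simp: eventually_sequentially)
  let ?X = "Max (insert (1/2) (f ` {..<N}))"
  have "f j \<le> ?X" for j
  proof (cases "j < N")
    case True then show ?thesis by (intro Max_ge) auto
  next
    case False
    then have "f j \<le> 1/2" using N[of j] by simp
    also have "\<dots> \<le> ?X" by (intro Max_ge) auto
    finally show ?thesis .
  qed
  moreover have "?X < 1" using assms by (subst Max_less_iff) auto
  moreover have "1/2 \<le> ?X" by (intro Max_ge) auto
  ultimately show ?thesis by (intro that[of ?X]) (auto intro: less_le_trans[of 0 "1/2"])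
qed

lemma polynomial_times_geometric_bounded:
  fixes y a b :: real
  assumes "0 < y" "y < 1"
  obtains C where "0 < C" "\<And>n::nat. (1 + real n) powr a * (1 + 2 * real n) powr b * y ^ n \<le> C"
proof -
  have "(\<lambda>n::nat. (1 + real n) powr a * (1 + 2 * real n) powr b * y ^ n) \<longlonglongrightarrow> 0"
    using assms by real_asymp
  then have "Bseq (\<lambda>n::nat. (1 + real n) powr a * (1 + 2 * real n) powr b * y ^ n)"
    by (intro convergent_imp_Bseq convergentI)
  then obtain K where "K > 0" "\<And>n::nat. norm ((1 + real n) powr a * (1 + 2 * real n) powr b * y ^ n) \<le> K"
    by (auto elim: BseqE)
  then show ?thesis using that[of K] abs_le_D1 by (metis real_norm_def)
qed

text \<open>The polynomial weights are absorbed by a part of the geometric decay: if \<open>X < 1\<close> bounds all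
\<open>b\<^sub>j\<^sup>q\<close>, then the \<open>q\<close>-th power of the factor of \<open>\<kappa>\<^sub>\<nu>\<close> in the variable \<open>j\<close> is at most
\<open>C x\<^sub>j\<^sup>n\<close>, \<open>n = \<nu>\<^sub>j\<close>, where \<open>x\<^sub>j = b\<^sub>j\<^sup>q / sqrt X\<close> is still summable and less than \<open>1\<close>. For such
products the majorant costs only a constant, by \<open>prod_powers_antimono\<close>.\<close>

lemma monotone_majorant_summable:
  fixes b :: "nat \<Rightarrow> real"
  assumes b: "\<And>j. 0 < b j" "\<And>j. b j < 1" "summable (\<lambda>j. b j powr q)" and q: "0 < q"
    and \<kappa>: "\<And>\<nu>. 0 \<le> \<kappa> \<nu>"
      "\<And>\<nu>. \<kappa> \<nu> \<le> (\<Prod>j\<in>supp \<nu>. (1 + real (\<nu> j)) powr a * (1 + 2 * real (\<nu> j)) * b j ^ \<nu> j)"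
  obtains S where "0 \<le> S"
    "\<And>F. finite F \<Longrightarrow> F \<subseteq> multi_indices \<Longrightarrow> (\<Sum>\<nu>\<in>F. monotone_majorant \<kappa> \<nu> powr q) \<le> S"
    "\<And>\<nu>. \<nu> \<in> multi_indices \<Longrightarrow> \<kappa> \<nu> \<le> monotone_majorant \<kappa> \<nu>"
proof -
  define w where "w j = b j powr q" for j
  have w: "0 < w j" "w j < 1" for j
    using b(1)[of j] powr_less_mono2[of q "b j" 1] b(2)[of j] q by (auto simp: w_def)
  obtain X where X: "0 < X" "X < 1" "\<And>j. w j \<le> X"
    using tendsto_0_uniform_less_1[of w] w summable_LIMSEQ_zero[OF b(3)]
    unfolding w_def[symmetric] by blast
  \<comment> \<open>half of the decay stays in \<open>x\<close>; the other half, \<open>sqrt X\<close>, pays for the polynomial weights\<close>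
  define x where "x j = w j / sqrt X" for j
  have x: "0 \<le> x j" "x j \<le> sqrt X" for j
    using w[of j] X by (auto simp: x_def divide_le_eq real_sqrt_mult_self)
  have sX: "0 < sqrt X" "sqrt X < 1" using X by auto
  have x1: "x j \<le> 1" for j using x(2)[of j] sX by linarith
  have sx: "summable x" unfolding x_def w_def by (intro summable_divide b)
  obtain C where C: "0 < C"
      "\<And>n::nat. (1 + real n) powr (a * q) * (1 + 2 * real n) powr q * sqrt X ^ n \<le> C"
    using polynomial_times_geometric_bounded[OF sX] by blast
  have factor: "((1 + real n) powr a * (1 + 2 * real n) * b j ^ n) powr q \<le> C * x j ^ n" for n j
  proof -
    have "((1 + real n) powr a * (1 + 2 * real n) * b j ^ n) powr q
        = (1 + real n) powr (a * q) * (1 + 2 * real n) powr q * w j ^ n"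
      using b(1)[of j] by (simp add: powr_mult powr_powr w_def powr_power
          flip: powr_realpow) (simp add: mult_ac)
    also have "w j ^ n = sqrt X ^ n * x j ^ n"
      using sX by (simp add: x_def flip: power_mult_distrib)
    also have "(1 + real n) powr (a * q) * (1 + 2 * real n) powr q * (sqrt X ^ n * x j ^ n)
       = ((1 + real n) powr (a * q) * (1 + 2 * real n) powr q * sqrt X ^ n) * x j ^ n"
      by simp
    also have "\<dots> \<le> C * x j ^ n"
      using x by (intro mult_right_mono C) auto
    finally show ?thesis .
  qed
  define E where "E = exp (C * suminf x)"
  define R where "R \<nu> = E * (\<Prod>j\<in>supp \<nu>. C * x j ^ \<nu> j)" for \<nu> :: "nat \<Rightarrow> nat"
  have R0: "0 \<le> R \<nu>" for \<nu> using C x by (auto simp: R_def E_def intro!: prod_nonneg mult_nonneg_nonneg)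
  have bound: "\<bar>\<kappa> \<mu>\<bar> \<le> R \<nu> powr (1/q)" if "\<mu> \<in> multi_indices" "\<nu> \<le> \<mu>" for \<mu> \<nu>
  proof -
    have "\<kappa> \<mu> powr q \<le> (\<Prod>j\<in>supp \<mu>. (1 + real (\<mu> j)) powr a * (1 + 2 * real (\<mu> j)) * b j ^ \<mu> j) powr q"
      using \<kappa> q by (intro powr_mono2) auto
    also have "\<dots> = (\<Prod>j\<in>supp \<mu>. ((1 + real (\<mu> j)) powr a * (1 + 2 * real (\<mu> j)) * b j ^ \<mu> j) powr q)"
      using b(1) by (intro prod_powr_distrib)
    also have "\<dots> \<le> (\<Prod>j\<in>supp \<mu>. C * x j ^ \<mu> j)"
      by (intro prod_mono conjI factor) auto
    also have "\<dots> \<le> R \<nu>"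
      unfolding R_def E_def using x x1 sx C that by (intro prod_powers_antimono) auto
    finally have "(\<kappa> \<mu> powr q) powr (1/q) \<le> R \<nu> powr (1/q)"
      using q by (intro powr_mono2) auto
    then show ?thesis using \<kappa>(1)[of \<mu>] q by (simp add: powr_powr)
  qed
  have bdd: "bdd_above ((\<lambda>\<mu>. \<bar>\<kappa> \<mu>\<bar>) ` {\<mu> \<in> multi_indices. \<nu> \<le> \<mu>})" for \<nu>
    using bound by (intro bdd_aboveI2[where M = "R \<nu> powr (1/q)"]) auto
  have ge: "\<kappa> \<nu> \<le> monotone_majorant \<kappa> \<nu>" if "\<nu> \<in> multi_indices" for \<nu>
  proof -
    have "\<bar>\<kappa> \<nu>\<bar> \<le> monotone_majorant \<kappa> \<nu>"
      unfolding monotone_majorant_def using that by (intro cSUP_upper bdd) auto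
    then show ?thesis by simp
  qed
  have le: "monotone_majorant \<kappa> \<nu> powr q \<le> R \<nu>" if "\<nu> \<in> multi_indices" for \<nu>
  proof -
    have "monotone_majorant \<kappa> \<nu> \<le> R \<nu> powr (1/q)"
      unfolding monotone_majorant_def using that bound by (intro cSUP_least) auto
    moreover have "0 \<le> monotone_majorant \<kappa> \<nu>" using ge[OF that] \<kappa>(1)[of \<nu>] by simp
    ultimately have "monotone_majorant \<kappa> \<nu> powr q \<le> (R \<nu> powr (1/q)) powr q"
      using q by (intro powr_mono2) auto
    then show ?thesis using q R0[of \<nu>] by (simp add: powr_powr)
  qed
  show ?thesis
  proof
    show "0 \<le> E * exp (C / (1 - sqrt X) * suminf x)" by (simp add: E_def)
    fix F :: "(nat \<Rightarrow> nat) set" assume F: "finite F" "F \<subseteq> multi_indices"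
    have "(\<Sum>\<nu>\<in>F. monotone_majorant \<kappa> \<nu> powr q) \<le> (\<Sum>\<nu>\<in>F. R \<nu>)"
      using F by (intro sum_mono le) auto
    also have "\<dots> = E * (\<Sum>\<nu>\<in>F. \<Prod>j\<in>supp \<nu>. C * x j ^ \<nu> j)"
      by (simp add: R_def sum_distrib_left)
    also have "\<dots> \<le> E * exp (C / (1 - sqrt X) * suminf x)"
      using F x sX sx C by (intro mult_left_mono sum_prod_powers_bounded) (auto simp: E_def)
    finally show "(\<Sum>\<nu>\<in>F. monotone_majorant \<kappa> \<nu> powr q) \<le> E * exp (C / (1 - sqrt X) * suminf x)" .
  qed (fact ge)
qed

text \<open>Stechkin's estimate. Outside \<open>\<Lambda>\<close> each \<open>K\<^sup>q\<close> is at most the mean over \<open>\<Lambda>\<close>, hence at most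
\<open>S / n\<close>; it remains to write \<open>K\<^sup>2 = (K\<^sup>q)\<^bsup>(2 - q) / q\<^esup> K\<^sup>q\<close> and to sum the last factor.\<close>

lemma n_largest_tail:
  assumes \<Lambda>: "n_largest K n \<Lambda>" "1 \<le> n" and K: "\<And>\<nu>. \<nu> \<in> multi_indices \<Longrightarrow> 0 \<le> K \<nu>"
    and q: "0 < q" "q < 2" and S: "0 \<le> S"
      "\<And>F. finite F \<Longrightarrow> F \<subseteq> multi_indices \<Longrightarrow> (\<Sum>\<nu>\<in>F. K \<nu> powr q) \<le> S"
    and F: "finite F" "F \<subseteq> multi_indices - \<Lambda>"
  shows "(\<Sum>\<nu>\<in>F. (K \<nu>)\<^sup>2) \<le> (S powr (1 / q) * real n powr (- (1 / q - 1 / 2)))\<^sup>2"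
proof -
  have n: "0 < real n" using \<Lambda> by simp
  have single: "K \<mu> powr q \<le> S / real n" if "\<mu> \<in> multi_indices - \<Lambda>" for \<mu>
  proof -
    have "real n * K \<mu> powr q = (\<Sum>\<nu>\<in>\<Lambda>. K \<mu> powr q)"
      using \<Lambda> by (simp add: n_largest_def)
    also have "\<dots> \<le> (\<Sum>\<nu>\<in>\<Lambda>. K \<nu> powr q)"
      using \<Lambda> that q K by (intro sum_mono powr_mono2) (auto simp: n_largest_def)
    also have "\<dots> \<le> S" using \<Lambda> by (intro S) (auto simp: n_largest_def)
    finally show ?thesis using n by (simp add: field_simps)
  qed
  have sq: "(K \<mu>)\<^sup>2 \<le> (S / real n) powr ((2 - q) / q) * K \<mu> powr q" if "\<mu> \<in> multi_indices - \<Lambda>" for \<mu>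
  proof (cases "K \<mu> = 0")
    case False
    then have pos: "0 < K \<mu>" using K[of \<mu>] that by auto
    have "(K \<mu>)\<^sup>2 = K \<mu> powr 2" using pos by (simp add: powr_numeral)
    also have "\<dots> = (K \<mu> powr q) powr ((2 - q) / q) * K \<mu> powr q"
      using q by (simp add: powr_powr flip: powr_add)
    also have "\<dots> \<le> (S / real n) powr ((2 - q) / q) * K \<mu> powr q"
      using q by (intro mult_right_mono powr_mono2 single that) auto
    finally show ?thesis .
  qed auto
  have "(\<Sum>\<nu>\<in>F. (K \<nu>)\<^sup>2) \<le> (\<Sum>\<nu>\<in>F. (S / real n) powr ((2 - q) / q) * K \<nu> powr q)"
    using F by (intro sum_mono sq) auto
  also have "\<dots> = (S / real n) powr ((2 - q) / q) * (\<Sum>\<nu>\<in>F. K \<nu> powr q)"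
    by (simp add: sum_distrib_left)
  also have "\<dots> \<le> (S / real n) powr ((2 - q) / q) * S"
    using F by (intro mult_left_mono S) auto
  also have "\<dots> = (S powr (1 / q) * real n powr (- (1 / q - 1 / 2)))\<^sup>2"
  proof (cases "S = 0")
    case False
    then have "0 < S" using S by simp
    then have "(S / real n) powr ((2 - q) / q) * S
        = S powr ((2 - q) / q + 1) * real n powr (- ((2 - q) / q))"
      using S n by (simp add: powr_divide powr_minus_divide powr_add)
    also have "\<dots> = S powr (2 / q) * real n powr (- (2 / q - 1))"
      using q by (simp add: diff_divide_distrib)
    also have "\<dots> = (S powr (1 / q) * real n powr (- (1 / q - 1 / 2)))\<^sup>2"
      by (simp add: power_mult_distrib power2_eq_square algebra_simps flip: powr_add)
    finally show ?thesis .
  qed auto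
  finally show ?thesis .
qed

section \<open>Univariate interpolation\<close>

lemma poly_eq_at_nodes:
  fixes p p' :: "real poly"
  assumes "inj t" "degree p \<le> k" "degree p' \<le> k" "\<And>i. i \<le> k \<Longrightarrow> poly p (t i) = poly p' (t i)"
  shows "p = p'"
proof (rule ccontr)
  assume "p \<noteq> p'"
  then have nz: "p - p' \<noteq> 0" by simp
  have "t ` {..k} \<subseteq> {x. poly (p - p') x = 0}" using assms(4) by auto
  then have "card (t ` {..k}) \<le> card {x. poly (p - p') x = 0}"
    using poly_roots_finite[OF nz] by (intro card_mono)
  also have "\<dots> \<le> degree (p - p')" using nz by (intro card_poly_roots_bound)
  also have "\<dots> \<le> k" using assms(2,3) by (intro degree_diff_le)
  finally show False using assms(1) by (simp add: card_image inj_on_subset)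
qed

definition lagrange_basis :: "(nat \<Rightarrow> real) \<Rightarrow> nat \<Rightarrow> nat \<Rightarrow> real poly" where
  "lagrange_basis t k i = (\<Prod>j\<in>{..k} - {i}. smult (inverse (t i - t j)) [:- t j, 1:])"

lemma degree_lagrange_basis: "i \<le> k \<Longrightarrow> degree (lagrange_basis t k i) \<le> k"
proof -
  assume "i \<le> k"
  have "degree (lagrange_basis t k i) \<le> (\<Sum>j\<in>{..k} - {i}. degree (smult (inverse (t i - t j)) [:- t j, 1:]))"
    unfolding lagrange_basis_def 
    using degree_prod_sum_le[of "{..k} - {i}" "\<lambda>j. smult (inverse (t i - t j)) [:- t j, 1:]"]
    unfolding o_def by blast
  also have "\<dots> \<le> (\<Sum>j\<in>{..k} - {i}. 1)" by (intro sum_mono) auto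
  also have "\<dots> = k" using \<open>i \<le> k\<close> by simp
  finally show ?thesis .
qed

lemma poly_lagrange_basis:
  assumes "inj t" "i \<le> k" "l \<le> k"
  shows "poly (lagrange_basis t k i) (t l) = (if i = l then 1 else 0)"
proof (cases "i = l")
  case True
  then show ?thesis using assms
    by (auto simp: lagrange_basis_def poly_prod inj_eq left_diff_distrib[symmetric]
        right_diff_distrib[symmetric] mult.commute[of _ "inverse _"] intro!: prod.neutral)
next
  case False
  then show ?thesis using assms
    by (auto simp: lagrange_basis_def poly_prod intro!: prod_zero bexI[of _ l])
qed

lemma interp_unique:
  assumes "inj t" "degree p \<le> k" "\<And>i. i \<le> k \<Longrightarrow> poly p (t i) = v (t i)"
  shows "interp t k v = p"
  unfolding interp_def
  by (rule the_equality) (use assms poly_eq_at_nodes[OF assms(1)] in auto)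

lemma interp_lagrange:
  assumes "inj t"
  shows "interp t k v = (\<Sum>i\<le>k. smult (v (t i)) (lagrange_basis t k i))"
proof (rule interp_unique[OF assms])
  show "degree (\<Sum>i\<le>k. smult (v (t i)) (lagrange_basis t k i)) \<le> k"
    by (intro degree_sum_le) (auto intro: order.trans[OF degree_smult_le] degree_lagrange_basis)
  show "poly (\<Sum>i\<le>k. smult (v (t i)) (lagrange_basis t k i)) (t l) = v (t l)" if "l \<le> k" for l
    using that assms by (simp add: poly_sum poly_lagrange_basis if_distrib cong: if_cong)
qed

lemma interp_diff_nodes:
  assumes "inj t"
  obtains \<beta> where "\<And>v. interp_diff t k v = (\<Sum>i\<le>k. smult (v (t i)) (\<beta> i))"
proof (cases k)
  case 0
  show ?thesis by (rule that[of "lagrange_basis t 0"]) (simp add: 0 interp_lagrange[OF assms])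
next
  case (Suc m)
  show ?thesis
    by (rule that[of "\<lambda>i. lagrange_basis t k i - (if i \<le> m then lagrange_basis t m i else 0)"])
      (simp add: Suc interp_lagrange[OF assms] smult_diff_right sum_subtractf)
qed

lemma sup_norm_bdd: "bounded (v ` {-1..1}) \<Longrightarrow> bdd_above ((\<lambda>s. \<bar>v s\<bar>) ` {-1..1::real})"
  for v :: "real \<Rightarrow> real"
  by (auto simp: bounded_iff bdd_above_def)

lemma abs_le_sup_norm: "bounded (v ` {-1..1}) \<Longrightarrow> s \<in> {-1..1} \<Longrightarrow> \<bar>v s\<bar> \<le> sup_norm v"
  unfolding sup_norm_def by (intro cSUP_upper sup_norm_bdd)

lemma bounded_poly: "bounded (poly p ` {-1..1::real})"
  by (intro compact_imp_bounded compact_continuous_image) (auto intro: continuous_intros)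

text \<open>A supremum of reals bounds the elements of the set only if the set is bounded above. It is, because
\<open>T v\<close> depends on \<open>v\<close> through finitely many values in the interval.\<close>

lemma abs_le_sup_op_norm:
  assumes T: "\<And>v. T v = (\<Sum>i\<le>k. smult (v (t i)) (\<beta> i))"
    and t: "\<And>i. t i \<in> {-1..1}"
    and s: "s \<in> {-1..1}" and v: "\<And>s. s \<in> {-1..1} \<Longrightarrow> \<bar>v s\<bar> \<le> 1" "v 1 = 1"
  shows "\<bar>poly (T v) s\<bar> \<le> sup_op_norm T"
proof -
  let ?S = "{sup_norm (poly (T v)) / sup_norm v | v.
     bounded (v ` {-1..1}) \<and> (\<exists>s\<in>{-1..1}. v s \<noteq> 0)}"
  have bdd: "bdd_above ?S"
  proof (rule bdd_aboveI, clarify)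
    fix v :: "real \<Rightarrow> real" and s0 assume v: "bounded (v ` {-1..1})" "s0 \<in> {-1..1}" "v s0 \<noteq> 0"
    have pos: "0 < sup_norm v" using abs_le_sup_norm[OF v(1,2)] v(3) by simp
    have "sup_norm (poly (T v)) \<le> sup_norm v * (\<Sum>i\<le>k. sup_norm (poly (\<beta> i)))"
      unfolding sup_norm_def[of "poly (T v)"]
    proof (rule cSUP_least)
      fix s :: real assume s: "s \<in> {-1..1}"
      have "\<bar>poly (T v) s\<bar> \<le> (\<Sum>i\<le>k. \<bar>v (t i) * poly (\<beta> i) s\<bar>)"
        unfolding T poly_sum poly_smult by (rule sum_abs)
      also have "\<dots> \<le> (\<Sum>i\<le>k. sup_norm v * sup_norm (poly (\<beta> i)))"
        unfolding abs_mult
        using v(1) t s pos by (intro sum_mono mult_mono abs_le_sup_norm bounded_poly) auto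
      finally show "\<bar>poly (T v) s\<bar> \<le> sup_norm v * (\<Sum>i\<le>k. sup_norm (poly (\<beta> i)))"
        by (simp add: sum_distrib_left)
    qed auto
    then show "sup_norm (poly (T v)) / sup_norm v \<le> (\<Sum>i\<le>k. sup_norm (poly (\<beta> i)))"
      using pos by (simp add: divide_le_eq mult.commute)
  qed
  have bv: "bounded (v ` {-1..1})" using v(1) unfolding bounded_iff by (auto intro!: exI[of _ 1])
  have "sup_norm v \<le> 1" unfolding sup_norm_def by (intro cSUP_least v) auto
  moreover have "1 \<le> sup_norm v" using abs_le_sup_norm[OF bv, of 1] v(2) by simp
  ultimately have 1: "sup_norm v = 1" by simp
  have "\<bar>poly (T v) s\<bar> \<le> sup_norm (poly (T v)) / sup_norm v"
    using abs_le_sup_norm[OF bounded_poly s] 1 by simp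
  also have "\<dots> \<le> sup_op_norm T"
    unfolding sup_op_norm_def using bv v(2) by (intro cSup_upper bdd) (auto intro!: exI[of _ v] bexI[of _ 1])
  finally show ?thesis .
qed

lemma interp_diff_power_zero: "inj t \<Longrightarrow> m < k \<Longrightarrow> interp_diff t k (\<lambda>s. s ^ m) = 0"
proof -
  assume a: "inj t" "m < k"
  have "interp t n (\<lambda>s. s ^ m) = monom 1 m" if "m \<le> n" for n
    using that a by (intro interp_unique) (auto simp: degree_monom_eq poly_monom)
  then show ?thesis using a(2) by (cases k) auto
qed

lemma sum_interp_diff: "(\<Sum>k\<le>n. interp_diff t k v) = interp t n v"
  by (induction n) auto

lemma sum_interp_diff_power:
  assumes "inj t" shows "(\<Sum>k\<le>m. poly (interp_diff t k (\<lambda>s. s ^ m)) s) = s ^ m"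
proof -
  have "interp t m (\<lambda>s. s ^ m) = monom 1 m"
    using assms by (intro interp_unique) (auto simp: degree_monom_eq poly_monom)
  then show ?thesis by (simp add: poly_monom flip: poly_sum sum_interp_diff)
qed

text \<open>Both hypotheses on the points enter only through the bound \<open>(1 + n)\<^bsup>\<theta> + 1\<^esup>\<close> for sums of norms of the
differences, which is \<open>\<pi>\<close> in one variable. Under the first one the norm of the \<open>k\<close>-th difference is at most
\<open>(1 + k)\<^sup>\<theta> + k\<^sup>\<theta>\<close>, and these numbers are dominated by the increments of \<open>k\<^bsup>\<theta> + 1\<^esup>\<close> because
\<open>k\<^bsup>\<theta> - 1\<^esup>\<close> does not decrease for \<open>\<theta> \<ge> 1\<close>.\<close>

lemma interp_diff_power_bound:
  assumes t: "\<And>k. t k \<in> {-1..1}" "inj t" and \<theta>: "\<theta> \<ge> 1"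
    and L: "(\<forall>k. sup_op_norm (interp t k) \<le> (1 + real k) powr \<theta>) \<or>
         (\<forall>k. sup_op_norm (interp_diff t k) \<le> (1 + real k) powr \<theta>)"
  obtains d where "\<And>k m s. s \<in> {-1..1} \<Longrightarrow> \<bar>poly (interp_diff t k (\<lambda>s. s ^ m)) s\<bar> \<le> d k"
    "\<And>n. (\<Sum>k\<le>n. d k) \<le> (1 + real n) powr (\<theta> + 1)"
  using L
proof
  assume L: "\<forall>k. sup_op_norm (interp t k) \<le> (1 + real k) powr \<theta>"
  have *: "\<bar>poly (interp t k (\<lambda>s. s ^ m)) s\<bar> \<le> (1 + real k) powr \<theta>" if "s \<in> {-1..1}" for k m s
  proof -
    have "\<bar>poly (interp t k (\<lambda>s. s ^ m)) s\<bar> \<le> sup_op_norm (interp t k)"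
      by (rule abs_le_sup_op_norm[where t = t, OF interp_lagrange[OF t(2)]])
        (use t that in \<open>auto simp: power_abs intro!: power_le_one\<close>)
    also have "\<dots> \<le> (1 + real k) powr \<theta>" using L by blast
    finally show ?thesis .
  qed
  define d where "d k = (1 + real k) powr \<theta> + (if k = 0 then 0 else real k powr \<theta>)" for k
  show ?thesis
  proof (rule that)
    fix k m s assume s: "s \<in> {-1..1::real}"
    show "\<bar>poly (interp_diff t k (\<lambda>s. s ^ m)) s\<bar> \<le> d k"
      using *[OF s, of k m] *[OF s, of "k - 1" m] by (cases k) (auto simp: d_def add_ac)
  next
    fix n show "(\<Sum>k\<le>n. d k) \<le> (1 + real n) powr (\<theta> + 1)"
    proof (induction n)
      case (Suc n)
      define a where "a = 1 + real n"
      have a: "0 < a" by (simp add: a_def)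
      have "a powr (\<theta> - 1) \<le> (1 + a) powr (\<theta> - 1)" using \<theta> a by (intro powr_mono2) auto
      then have "0 \<le> a * (1 + a) * ((1 + a) powr (\<theta> - 1) - a powr (\<theta> - 1))" using a by simp
      also have "\<dots> = a * (1 + a) powr \<theta> - (1 + a) * a powr \<theta>"
        using powr_mult_base[of a "\<theta> - 1"] powr_mult_base[of "1 + a" "\<theta> - 1"] a
        by (simp add: right_diff_distrib mult.assoc mult.left_commute[of a "1 + a"])
      finally have "a powr (\<theta> + 1) + ((1 + a) powr \<theta> + a powr \<theta>) \<le> (1 + a) powr (\<theta> + 1)"
        using powr_mult_base[of a "\<theta>"] powr_mult_base[of "1 + a" "\<theta>"] a
        by (simp add: algebra_simps)
      then show ?case using Suc by (simp add: d_def a_def add_ac)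
    qed (simp add: d_def)
  qed
next
  assume L: "\<forall>k. sup_op_norm (interp_diff t k) \<le> (1 + real k) powr \<theta>"
  show ?thesis
  proof (rule that)
    fix k m s assume s: "s \<in> {-1..1::real}"
    obtain \<beta> where "\<And>v. interp_diff t k v = (\<Sum>i\<le>k. smult (v (t i)) (\<beta> i))"
      by (rule interp_diff_nodes[OF t(2), of k]) blast
    then have "\<bar>poly (interp_diff t k (\<lambda>s. s ^ m)) s\<bar> \<le> sup_op_norm (interp_diff t k)"
      by (rule abs_le_sup_op_norm[where t = t])
        (use t s in \<open>auto simp: power_abs intro!: power_le_one\<close>)
    also have "\<dots> \<le> (1 + real k) powr \<theta>" using L by blast
    finally show "\<bar>poly (interp_diff t k (\<lambda>s. s ^ m)) s\<bar> \<le> (1 + real k) powr \<theta>" .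
  next
    fix n
    have "(\<Sum>k\<le>n. (1 + real k) powr \<theta>) \<le> (\<Sum>k\<le>n. (1 + real n) powr \<theta>)"
      using \<theta> by (intro sum_mono powr_mono2) auto
    also have "\<dots> = (1 + real n) powr (\<theta> + 1)"
      using powr_mult_base[of "1 + real n" \<theta>] by (simp add: add_ac)
    finally show "(\<Sum>k\<le>n. (1 + real k) powr \<theta>) \<le> (1 + real n) powr (\<theta> + 1)" .
  qed
qed

section \<open>Tensor interpolation of monomials\<close>

lemma fold_act_in_variable_prod:
  assumes "finite A" "distinct js" "set js \<subseteq> A"
    and T: "\<And>j c v. T j (\<lambda>s. c * v s) = smult c (T j v)"
  shows "fold (\<lambda>j. act_in_variable j (T j)) js (\<lambda>y. \<Prod>j\<in>A. \<phi> j (y j)) y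
    = (\<Prod>j\<in>A. if j \<in> set js then poly (T j (\<phi> j)) (y j) else \<phi> j (y j))"
  using assms(2,3)
proof (induction js arbitrary: \<phi>)
  case (Cons a js)
  let ?\<phi> = "\<phi>(a := poly (T a (\<phi> a)))"
  have a: "a \<in> A" using Cons by simp
  have split: "(\<Prod>j\<in>A. f j) = (\<Prod>j\<in>A - {a}. f j) * f a" for f :: "nat \<Rightarrow> real"
    using prod.remove[OF assms(1) a, of f] by (simp add: mult.commute)
  have "act_in_variable a (T a) (\<lambda>y. \<Prod>j\<in>A. \<phi> j (y j)) = (\<lambda>y. \<Prod>j\<in>A. ?\<phi> j (y j))"
  proof
    fix y
    have "(\<lambda>s. \<Prod>j\<in>A. \<phi> j ((y(a := s)) j)) = (\<lambda>s. (\<Prod>j\<in>A - {a}. \<phi> j (y j)) * \<phi> a s)"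
      unfolding split by (intro ext arg_cong2[where f = "(*)"] prod.cong) auto
    then have "act_in_variable a (T a) (\<lambda>y. \<Prod>j\<in>A. \<phi> j (y j)) y
        = (\<Prod>j\<in>A - {a}. \<phi> j (y j)) * poly (T a (\<phi> a)) (y a)"
      by (simp add: act_in_variable_def T)
    also have "\<dots> = (\<Prod>j\<in>A. ?\<phi> j (y j))"
      unfolding split by (intro arg_cong2[where f = "(*)"] prod.cong) auto
    finally show "act_in_variable a (T a) (\<lambda>y. \<Prod>j\<in>A. \<phi> j (y j)) y
        = (\<Prod>j\<in>A. ?\<phi> j (y j))" .
  qed
  then have "fold (\<lambda>j. act_in_variable j (T j)) (a # js) (\<lambda>y. \<Prod>j\<in>A. \<phi> j (y j)) y
     = fold (\<lambda>j. act_in_variable j (T j)) js (\<lambda>y. \<Prod>j\<in>A. ?\<phi> j (y j)) y"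
    by (simp del: fun_upd_apply)
  also have "\<dots> = (\<Prod>j\<in>A. if j \<in> set js then poly (T j (?\<phi> j)) (y j) else ?\<phi> j (y j))"
    using Cons.prems by (intro Cons.IH) auto
  also have "\<dots> = (\<Prod>j\<in>A. if j \<in> set (a # js) then poly (T j (\<phi> j)) (y j) else \<phi> j (y j))"
    using Cons.prems by (intro prod.cong) auto
  finally show ?case .
qed simp

lemma interp_diff_scale:
  assumes "inj t" shows "interp_diff t k (\<lambda>s. c * v s) = smult c (interp_diff t k v)"
proof -
  obtain \<beta> where "\<And>v. interp_diff t k v = (\<Sum>i\<le>k. smult (v (t i)) (\<beta> i))"
    by (rule interp_diff_nodes[OF assms, of k]) blast
  then show ?thesis by (intro poly_eqI) (simp add: coeff_sum sum_distrib_left mult.assoc)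
qed

lemma mpow_extend: "finite A \<Longrightarrow> supp \<mu> \<subseteq> A \<Longrightarrow> mpow y \<mu> = (\<Prod>j\<in>A. y j ^ \<mu> j)"
  unfolding mpow_def by (rule prod_supp_extend[where c = "\<lambda>j n. y j ^ n"]) auto

text \<open>The simultaneous evaluation at \<open>t 0\<close> outside the support of \<open>\<nu>\<close> is the action of the difference of
degree \<open>0\<close>, so every variable of the finite set \<open>A\<close> can be treated alike.\<close>

lemma tensor_diff_mpow:
  assumes "inj t" "\<nu> \<in> multi_indices" "\<mu> \<in> multi_indices" "finite A" "supp \<nu> \<subseteq> A" "supp \<mu> \<subseteq> A"
  shows "tensor_diff t \<nu> (\<lambda>z. mpow z \<mu>) y
    = (\<Prod>j\<in>A. poly (interp_diff t (\<nu> j) (\<lambda>s. s ^ \<mu> j)) (y j))"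
proof -
  let ?\<phi> = "\<lambda>j s. (if \<nu> j = 0 then t 0 else s) ^ \<mu> j"
  have fin: "finite (supp \<nu>)" using assms by (simp add: multi_indices_def)
  have "tensor_diff t \<nu> (\<lambda>z. mpow z \<mu>) y =
    fold (\<lambda>j. act_in_variable j (interp_diff t (\<nu> j))) (sorted_list_of_set (supp \<nu>))
      (\<lambda>y. \<Prod>j\<in>A. ?\<phi> j (y j)) y"
    unfolding tensor_diff_def by (simp add: mpow_extend[OF assms(4,6)])
  also have "\<dots> = (\<Prod>j\<in>A. if j \<in> set (sorted_list_of_set (supp \<nu>))
      then poly (interp_diff t (\<nu> j) (?\<phi> j)) (y j) else ?\<phi> j (y j))"
    using assms fin by (intro fold_act_in_variable_prod interp_diff_scale) auto
  also have "\<dots> = (\<Prod>j\<in>A. poly (interp_diff t (\<nu> j) (\<lambda>s. s ^ \<mu> j)) (y j))"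
    using fin by (intro prod.cong)
      (auto simp: interp_lagrange[OF assms(1)] lagrange_basis_def)
  finally show ?thesis .
qed

lemma pi_weight_ge_1: "0 \<le> \<theta> \<Longrightarrow> 1 \<le> pi_weight \<theta> \<mu>"
  unfolding pi_weight_def by (intro prod_ge_1) (auto intro: ge_one_powr_ge_zero)

lemma abs_mpow_le_1: "y \<in> U \<Longrightarrow> \<bar>mpow y \<mu>\<bar> \<le> 1"
  unfolding mpow_def abs_prod by (intro prod_le_1) (auto simp: U_def power_abs abs_le_iff intro!: power_le_one minus_le_iff[THEN iffD1])

text \<open>The difference of index \<open>\<nu>\<close> annihilates \<open>y\<^sup>\<mu>\<close> unless \<open>\<nu> \<le> \<mu>\<close>: in a variable with \<open>\<nu>\<^sub>j > \<mu>\<^sub>j\<close> both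
univariate interpolants are exact. For \<open>\<mu> \<in> \<Lambda>\<close> the remaining indices are all those below \<open>\<mu>\<close>,
since \<open>\<Lambda>\<close> is downward closed, and the sum over them telescopes in each variable. In general they are
a subset, and the product of the univariate bounds is \<open>\<pi>(\<mu>)\<close>.\<close>

lemma interp_monomial:
  assumes t: "\<And>k. t k \<in> {-1..1}" "inj t" and \<theta>: "\<theta> \<ge> 1"
    and L: "(\<forall>k. sup_op_norm (interp t k) \<le> (1 + real k) powr \<theta>) \<or>
         (\<forall>k. sup_op_norm (interp_diff t k) \<le> (1 + real k) powr \<theta>)"
    and \<Lambda>: "downward_closed \<Lambda>" "finite \<Lambda>" and \<mu>: "\<mu> \<in> multi_indices" and y: "y \<in> U"
  shows "\<mu> \<in> \<Lambda> \<Longrightarrow> (\<Sum>\<nu>\<in>\<Lambda>. tensor_diff t \<nu> (\<lambda>z. mpow z \<mu>) y) = mpow y \<mu>"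
    and "\<bar>mpow y \<mu> - (\<Sum>\<nu>\<in>\<Lambda>. tensor_diff t \<nu> (\<lambda>z. mpow z \<mu>) y)\<bar> \<le> 2 * pi_weight \<theta> \<mu>"
proof -
  let ?D = "\<lambda>\<nu>. \<Prod>j\<in>supp \<mu>. poly (interp_diff t (\<nu> j) (\<lambda>s. s ^ \<mu> j)) (y j)"
  have fin: "finite (supp \<mu>)" using \<mu> by (simp add: multi_indices_def)
  have \<Lambda>m: "\<Lambda> \<subseteq> multi_indices" using \<Lambda> by (simp add: downward_closed_def)
  have le: "tensor_diff t \<nu> (\<lambda>z. mpow z \<mu>) y = ?D \<nu>" if "\<nu> \<le> \<mu>" for \<nu>
    using that \<mu> fin by (intro tensor_diff_mpow t supp_mono) (auto intro: multi_indices_mono)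
  have nle: "tensor_diff t \<nu> (\<lambda>z. mpow z \<mu>) y = 0" if \<nu>: "\<nu> \<in> multi_indices" "\<not> \<nu> \<le> \<mu>" for \<nu>
  proof -
    from \<nu>(2) obtain j where j: "\<mu> j < \<nu> j" by (auto simp: le_fun_def not_le)
    have "tensor_diff t \<nu> (\<lambda>z. mpow z \<mu>) y
      = (\<Prod>j\<in>supp \<nu> \<union> supp \<mu>. poly (interp_diff t (\<nu> j) (\<lambda>s. s ^ \<mu> j)) (y j))"
      using \<nu> \<mu> by (intro tensor_diff_mpow t) (auto simp: multi_indices_def)
    also have "\<dots> = 0"
      using j \<nu> \<mu> by (intro prod_zero) (auto simp: multi_indices_def interp_diff_power_zero[OF t(2)] intro!: bexI[of _ j])
    finally show ?thesis .
  qed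
  have sum: "(\<Sum>\<nu>\<in>\<Lambda>. tensor_diff t \<nu> (\<lambda>z. mpow z \<mu>) y) = (\<Sum>\<nu>\<in>{\<nu>\<in>\<Lambda>. \<nu> \<le> \<mu>}. ?D \<nu>)"
  proof -
    have "(\<Sum>\<nu>\<in>\<Lambda>. tensor_diff t \<nu> (\<lambda>z. mpow z \<mu>) y) =
      (\<Sum>\<nu>\<in>{\<nu>\<in>\<Lambda>. \<nu> \<le> \<mu>}. tensor_diff t \<nu> (\<lambda>z. mpow z \<mu>) y)"
      by (rule sum.mono_neutral_right) (use \<Lambda> nle \<Lambda>m in auto)
    also have "\<dots> = (\<Sum>\<nu>\<in>{\<nu>\<in>\<Lambda>. \<nu> \<le> \<mu>}. ?D \<nu>)"
      by (intro sum.cong refl le) auto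
    finally show ?thesis .
  qed
  show "(\<Sum>\<nu>\<in>\<Lambda>. tensor_diff t \<nu> (\<lambda>z. mpow z \<mu>) y) = mpow y \<mu>" if "\<mu> \<in> \<Lambda>"
  proof -
    have "{\<nu>\<in>\<Lambda>. \<nu> \<le> \<mu>} = {\<nu>. \<nu> \<le> \<mu>}" using that \<Lambda> by (auto simp: downward_closed_def)
    then have "(\<Sum>\<nu>\<in>\<Lambda>. tensor_diff t \<nu> (\<lambda>z. mpow z \<mu>) y) = (\<Sum>\<nu> | \<nu> \<le> \<mu>. ?D \<nu>)"
      using sum by simp
    also have "\<dots> = (\<Prod>j\<in>supp \<mu>. \<Sum>n\<le>\<mu> j. poly (interp_diff t n (\<lambda>s. s ^ \<mu> j)) (y j))"
      by (rule sum_below_prod(1)) (use fin in auto)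
    also have "\<dots> = mpow y \<mu>" by (simp add: sum_interp_diff_power[OF t(2)] mpow_def)
    finally show ?thesis .
  qed
  obtain d where d: "\<And>k m s. s \<in> {-1..1} \<Longrightarrow> \<bar>poly (interp_diff t k (\<lambda>s. s ^ m)) s\<bar> \<le> d k"
    "\<And>n. (\<Sum>k\<le>n. d k) \<le> (1 + real n) powr (\<theta> + 1)"
    by (rule interp_diff_power_bound[OF t \<theta> L]) blast
  have d0: "0 \<le> d k" for k using d(1)[of 0 k 0] by (auto intro: order.trans[OF abs_ge_zero])
  have "\<bar>\<Sum>\<nu>\<in>{\<nu>\<in>\<Lambda>. \<nu> \<le> \<mu>}. ?D \<nu>\<bar> \<le> (\<Sum>\<nu>\<in>{\<nu>\<in>\<Lambda>. \<nu> \<le> \<mu>}. \<Prod>j\<in>supp \<mu>. d (\<nu> j))"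
    by (intro order.trans[OF sum_abs] sum_mono)
      (use y in \<open>auto simp: abs_prod U_def intro!: prod_mono d(1)\<close>)
  also have "\<dots> \<le> (\<Sum>\<nu> | \<nu> \<le> \<mu>. \<Prod>j\<in>supp \<mu>. d (\<nu> j))"
    using \<mu> d0 by (intro sum_mono2 finite_below) (auto intro!: prod_nonneg)
  also have "\<dots> = (\<Prod>j\<in>supp \<mu>. \<Sum>n\<le>\<mu> j. d n)"
    by (rule sum_below_prod(1)) (use fin in auto)
  also have "\<dots> \<le> pi_weight \<theta> \<mu>"
    unfolding pi_weight_def using d0 by (intro prod_mono conjI d(2) sum_nonneg)
  finally show "\<bar>mpow y \<mu> - (\<Sum>\<nu>\<in>\<Lambda>. tensor_diff t \<nu> (\<lambda>z. mpow z \<mu>) y)\<bar> \<le> 2 * pi_weight \<theta> \<mu>"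
    using abs_mpow_le_1[OF y, of \<mu>] pi_weight_ge_1[of \<theta> \<mu>] \<theta> unfolding sum by linarith
qed

text \<open>Interpolation followed by evaluation at \<open>y\<close> has this form. Such functionals commute with
infinite series and with taking gradients, and they see a function of infinitely many variables at
finitely many parameters only.\<close>

definition finite_point_functional :: "(((nat \<Rightarrow> real) \<Rightarrow> real) \<Rightarrow> real) \<Rightarrow> bool" where
  "finite_point_functional L \<longleftrightarrow> (\<exists>Z c. finite Z \<and> Z \<subseteq> U \<and> (\<forall>g. L g = (\<Sum>z\<in>Z. c z * g z)))"

lemma finite_point_functional_add:
  assumes "finite_point_functional L" "finite_point_functional M"
  shows "finite_point_functional (\<lambda>g. L g + a * M g)"
proof -
  obtain Z c W e where *: "finite Z" "Z \<subseteq> U" "\<And>g. L g = (\<Sum>z\<in>Z. c z * g z)"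
     "finite W" "W \<subseteq> U" "\<And>g. M g = (\<Sum>z\<in>W. e z * g z)"
    using assms unfolding finite_point_functional_def by metis
  have Z: "(\<Sum>z\<in>Z \<union> W. (if z \<in> Z then c z else 0) * g z) = L g" for g
    unfolding * by (rule sum.mono_neutral_cong_right) (use * in auto)
  have W: "(\<Sum>z\<in>Z \<union> W. (if z \<in> W then e z else 0) * g z) = M g" for g
    unfolding * by (rule sum.mono_neutral_cong_right) (use * in auto)
  have "L g + a * M g = (\<Sum>z\<in>Z \<union> W. ((if z \<in> Z then c z else 0) + a * (if z \<in> W then e z else 0)) * g z)" for g
    unfolding Z[symmetric] W[symmetric] sum_distrib_left sum.distrib[symmetric]
    by (intro sum.cong) (auto simp: algebra_simps)
  then show ?thesis unfolding finite_point_functional_def using *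
    by (intro exI[of _ "Z \<union> W"] exI conjI allI) auto
qed

lemma finite_point_functional_sum:
  assumes "finite I" "\<And>i. i \<in> I \<Longrightarrow> finite_point_functional (L i)"
  shows "finite_point_functional (\<lambda>g. \<Sum>i\<in>I. a i * L i g)"
  using assms
proof (induction I rule: finite_induct)
  case empty
  show ?case unfolding finite_point_functional_def by (intro exI[of _ "{}"]) auto
next
  case (insert i I)
  then show ?case
    using finite_point_functional_add[of "\<lambda>g. \<Sum>i\<in>I. a i * L i g" "L i" "a i"]
    by (simp add: add.commute)
qed

lemma tensor_diff_finite_point_functional:
  assumes t: "\<And>k. t k \<in> {-1..1}" "inj t" and y: "y \<in> U"
  shows "finite_point_functional (\<lambda>g. tensor_diff t \<nu> g y)"
proof -
  let ?a = "\<lambda>j. act_in_variable j (interp_diff t (\<nu> j))"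
  let ?h = "\<lambda>y j. if \<nu> j = 0 then t 0 else y j"
  have "finite_point_functional (\<lambda>g. fold ?a js (\<lambda>y. g (?h y)) y)" for js
    using y
  proof (induction js arbitrary: y rule: rev_induct)
    case Nil
    have "?h y \<in> U" using Nil t by (auto simp: U_def)
    then show ?case unfolding finite_point_functional_def
      by (intro exI[of _ "{?h y}"] exI[of _ "\<lambda>_. 1"]) auto
  next
    case (snoc j js)
    obtain \<beta> where \<beta>: "\<And>v. interp_diff t (\<nu> j) v = (\<Sum>i\<le>\<nu> j. smult (v (t i)) (\<beta> i))"
      by (rule interp_diff_nodes[OF t(2), of "\<nu> j"]) blast
    have "y(j := t i) \<in> U" for i using snoc.prems t by (auto simp: U_def)
    then have "finite_point_functional
        (\<lambda>g. \<Sum>i\<le>\<nu> j. poly (\<beta> i) (y j) * fold ?a js (\<lambda>y. g (?h y)) (y(j := t i)))"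
      by (intro finite_point_functional_sum snoc.IH) (auto simp del: fun_upd_apply)
    then show ?case by (simp add: act_in_variable_def[of j] \<beta> poly_sum mult.commute)
  qed
  then show ?thesis unfolding tensor_diff_def .
qed

lemma interp_sum_finite_point_functional:
  assumes "\<And>k. t k \<in> {-1..1}" "inj t" "y \<in> U" "finite \<Lambda>"
  shows "finite_point_functional (\<lambda>g. \<Sum>\<nu>\<in>\<Lambda>. tensor_diff t \<nu> g y)"
  using finite_point_functional_sum[OF assms(4) tensor_diff_finite_point_functional[OF assms(1-3)],
      where a = "\<lambda>_. 1"] by simp

section \<open>Power series solution of affine linear systems\<close>

definition lower :: "nat \<Rightarrow> (nat \<Rightarrow> nat) \<Rightarrow> nat \<Rightarrow> nat" where
  "lower j \<nu> = \<nu>(j := \<nu> j - 1)"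

definition raise :: "nat \<Rightarrow> (nat \<Rightarrow> nat) \<Rightarrow> nat \<Rightarrow> nat" where
  "raise j \<nu> = \<nu>(j := Suc (\<nu> j))"

lemma lower_raise [simp]: "lower j (raise j \<nu>) = \<nu>"
  by (simp add: lower_def raise_def fun_eq_iff)

lemma raise_lower: "\<nu> j \<noteq> 0 \<Longrightarrow> raise j (lower j \<nu>) = \<nu>"
  by (simp add: lower_def raise_def fun_eq_iff)

lemma raise_pos [simp]: "0 < raise j \<nu> j"
  by (simp add: raise_def)

lemma raise_neq_zero [simp]: "raise j \<nu> \<noteq> (\<lambda>_. 0)"
  by (metis raise_pos less_irrefl)

lemma lower_le: "lower j \<nu> \<le> \<nu>"
  by (simp add: lower_def le_fun_def)

lemma raise_multi_indices [simp]: "raise j \<nu> \<in> multi_indices \<longleftrightarrow> \<nu> \<in> multi_indices"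
proof -
  have "supp (raise j \<nu>) = insert j (supp \<nu>)" by (auto simp: raise_def)
  then show ?thesis unfolding multi_indices_def by simp
qed

lemma lower_multi_indices: "\<nu> \<in> multi_indices \<Longrightarrow> lower j \<nu> \<in> multi_indices"
  by (rule multi_indices_mono[OF _ lower_le])

lemma mpow_raise:
  assumes "\<nu> \<in> multi_indices" shows "mpow y (raise j \<nu>) = y j * mpow y \<nu>"
proof -
  let ?A = "insert j (supp \<nu>)"
  have fin: "finite (supp \<nu>)" using assms by (simp add: multi_indices_def)
  have "mpow y (raise j \<nu>) = (\<Prod>i\<in>?A. y i ^ raise j \<nu> i)"
    by (rule mpow_extend) (use fin in \<open>auto simp: raise_def\<close>)
  also have "\<dots> = y j ^ raise j \<nu> j * (\<Prod>i\<in>?A - {j}. y i ^ raise j \<nu> i)"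
    by (rule prod.remove) (use fin in auto)
  also have "\<dots> = y j ^ raise j \<nu> j * (\<Prod>i\<in>?A - {j}. y i ^ \<nu> i)"
    by (intro arg_cong2[where f = "(*)"] prod.cong) (auto simp: raise_def)
  also have "\<dots> = y j * (y j ^ \<nu> j * (\<Prod>i\<in>?A - {j}. y i ^ \<nu> i))"
    by (simp add: raise_def)
  also have "y j ^ \<nu> j * (\<Prod>i\<in>?A - {j}. y i ^ \<nu> i) = (\<Prod>i\<in>?A. y i ^ \<nu> i)"
    by (rule prod.remove[symmetric]) (use fin in auto)
  also have "\<dots> = mpow y \<nu>"
    by (rule mpow_extend[symmetric]) (use fin in auto)
  finally show ?thesis .
qed

lemma mpow_lower: "\<nu> \<in> multi_indices \<Longrightarrow> \<nu> j \<noteq> 0 \<Longrightarrow> mpow y \<nu> = y j * mpow y (lower j \<nu>)"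
  using mpow_raise[OF lower_multi_indices, of \<nu> y j j] by (simp add: raise_lower)

lemma has_sum_finite_sum:
  fixes f :: "'i \<Rightarrow> 'a \<Rightarrow> real"
  assumes "finite I" "\<And>i. i \<in> I \<Longrightarrow> (f i has_sum S i) A"
  shows "((\<lambda>x. \<Sum>i\<in>I. f i x) has_sum (\<Sum>i\<in>I. S i)) A"
  using assms by (induction I rule: finite_induct) (auto intro!: has_sum_add)

lemma summable_on_product:
  fixes a :: "'a \<Rightarrow> real" and b :: "'b \<Rightarrow> real"
  assumes "(\<lambda>i. norm (a i)) summable_on A" "(\<lambda>k. norm (b k)) summable_on B"
  shows "(\<lambda>(i, k). a i * b k) summable_on A \<times> B"
proof (rule abs_summable_summable, rule summable_on_SigmaI)
  show "((\<lambda>k. norm (case (i, k) of (i, k) \<Rightarrow> a i * b k)) has_sum norm (a i) * infsum (\<lambda>k. norm (b k)) B) B" for i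
    unfolding case_prod_conv norm_mult by (rule has_sum_cmult_right[OF has_sum_infsum[OF assms(2)]])
  show "(\<lambda>i. norm (a i) * infsum (\<lambda>k. norm (b k)) B) summable_on A"
    by (rule summable_on_cmult_left[OF assms(1)])
qed auto

text \<open>Vectors of \<open>\<real>\<^sup>N\<close> are functions on the natural numbers of which only the values below \<open>N\<close> matter,
because \<open>N\<close> will depend on the interpolation points.\<close>

abbreviation vnorm :: "nat \<Rightarrow> (nat \<Rightarrow> real) \<Rightarrow> real" where
  "vnorm N c \<equiv> L2_set c {..<N}"

lemma vnorm_sq: "(vnorm N c)\<^sup>2 = (\<Sum>i<N. (c i)\<^sup>2)"
  by (simp add: L2_set_def sum_nonneg)

text \<open>The system \<open>(I + \<Sum>\<^sub>j y\<^sub>j B\<^sub>j) x(y) = F\<close> of the Galerkin method in an orthonormal basis. The number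
\<open>P\<^sub>j(c)\<close> stands for \<open>\<integral> \<rho>\<^sub>j \<bar>\<psi>\<^sub>j\<bar> \<bar>\<nabla>v\<bar>\<^sup>2\<close>, where \<open>v\<close> has the coordinates \<open>c\<close>; the assumption on the
sums of these energies expresses uniform ellipticity, the last one is Young's inequality under the integral.\<close>

locale affine_system =
  fixes N :: nat and B :: "nat \<Rightarrow> nat \<Rightarrow> nat \<Rightarrow> real" and F :: "nat \<Rightarrow> real"
    and \<rho> :: "nat \<Rightarrow> real" and P :: "nat \<Rightarrow> (nat \<Rightarrow> real) \<Rightarrow> real" and \<sigma> :: real
  assumes \<rho>: "\<And>j. 1 < \<rho> j"
    and \<sigma>: "\<sigma> < 1"
    and P: "\<And>J c. finite J \<Longrightarrow> (\<Sum>j\<in>J. P j c) \<le> \<sigma> * (\<Sum>i<N. (c i)\<^sup>2)"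
    and BP: "\<And>j c d. 2 * \<rho> j * \<bar>\<Sum>l<N. \<Sum>i<N. B j l i * c i * d l\<bar> \<le> P j c + P j d"
begin

definition form :: "nat \<Rightarrow> (nat \<Rightarrow> real) \<Rightarrow> (nat \<Rightarrow> real) \<Rightarrow> real" where
  "form j c d = (\<Sum>l<N. \<Sum>i<N. B j l i * c i * d l)"

lemma form_scale: "form j (\<lambda>i. a * c i) (\<lambda>i. e * d i) = a * e * form j c d"
  by (simp add: form_def sum_distrib_left mult_ac)

lemma P_nonneg: "0 \<le> P j c"
proof -
  have "0 \<le> 2 * \<rho> j * \<bar>form j c c\<bar>" using \<rho>[of j] by simp
  also have "\<dots> \<le> P j c + P j c" unfolding form_def by (rule BP)
  finally show ?thesis by simp
qed

text \<open>The recursion for the Taylor coefficients runs over the total degree, so that \<open>n\<close> must be the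
total degree of \<open>\<nu>\<close>.\<close>

fun taylor_level :: "nat \<Rightarrow> (nat \<Rightarrow> nat) \<Rightarrow> nat \<Rightarrow> real" where
  "taylor_level 0 \<nu> l = F l"
| "taylor_level (Suc n) \<nu> l = - (\<Sum>j\<in>supp \<nu>. \<Sum>i<N. B j l i * taylor_level n (lower j \<nu>) i)"

definition taylor :: "(nat \<Rightarrow> nat) \<Rightarrow> nat \<Rightarrow> real" where
  "taylor \<nu> = taylor_level (\<Sum>j\<in>supp \<nu>. \<nu> j) \<nu>"

lemma sum_lower:
  assumes "\<nu> \<in> multi_indices" "\<nu> j \<noteq> 0"
  shows "(\<Sum>i\<in>supp \<nu>. \<nu> i) = Suc (\<Sum>i\<in>supp (lower j \<nu>). lower j \<nu> i)"
proof -
  have fin: "finite (supp \<nu>)" using assms by (simp add: multi_indices_def)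
  have "(\<Sum>i\<in>supp (lower j \<nu>). lower j \<nu> i) = (\<Sum>i\<in>supp \<nu>. lower j \<nu> i)"
    using supp_mono[OF lower_le] fin by (intro sum.mono_neutral_left) auto
  moreover have "(\<Sum>i\<in>supp \<nu>. f i) = f j + (\<Sum>i\<in>supp \<nu> - {j}. f i)" for f :: "nat \<Rightarrow> nat"
    using assms fin by (intro sum.remove) auto
  moreover have "(\<Sum>i\<in>supp \<nu> - {j}. lower j \<nu> i) = (\<Sum>i\<in>supp \<nu> - {j}. \<nu> i)"
    by (intro sum.cong) (auto simp: lower_def)
  ultimately show ?thesis using assms by (simp add: lower_def)
qed

lemma taylor_0: "taylor (\<lambda>_. 0) = F"
  by (simp add: taylor_def fun_eq_iff)

lemma taylor_rec:
  assumes "\<nu> \<in> multi_indices" "\<nu> \<noteq> (\<lambda>_. 0)"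
  shows "taylor \<nu> l = - (\<Sum>j\<in>supp \<nu>. \<Sum>i<N. B j l i * taylor (lower j \<nu>) i)"
proof -
  obtain j0 where j0: "\<nu> j0 \<noteq> 0" using assms(2) by auto
  define n where "n = (\<Sum>i\<in>supp (lower j0 \<nu>). lower j0 \<nu> i)"
  have n: "(\<Sum>i\<in>supp \<nu>. \<nu> i) = Suc n" using sum_lower[OF assms(1) j0] by (simp add: n_def)
  have "(\<Sum>i\<in>supp (lower j \<nu>). lower j \<nu> i) = n" if "j \<in> supp \<nu>" for j
    using sum_lower[OF assms(1), of j] that n by simp
  then have "taylor (lower j \<nu>) = taylor_level n (lower j \<nu>)" if "j \<in> supp \<nu>" for j
    using that unfolding taylor_def by simp
  then have "(\<Sum>j\<in>supp \<nu>. \<Sum>i<N. B j l i * taylor_level n (lower j \<nu>) i)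
      = (\<Sum>j\<in>supp \<nu>. \<Sum>i<N. B j l i * taylor (lower j \<nu>) i)"
    by (intro sum.cong refl) simp
  then show ?thesis unfolding taylor_def[of \<nu>] n by simp
qed

lemma taylor_energy:
  assumes "\<nu> \<in> multi_indices" "\<nu> \<noteq> (\<lambda>_. 0)"
  shows "(\<Sum>i<N. (taylor \<nu> i)\<^sup>2) = - (\<Sum>j\<in>supp \<nu>. form j (taylor (lower j \<nu>)) (taylor \<nu>))"
proof -
  have "(\<Sum>l<N. (taylor \<nu> l)\<^sup>2) =
     (\<Sum>l<N. - (\<Sum>j\<in>supp \<nu>. \<Sum>i<N. B j l i * taylor (lower j \<nu>) i) * taylor \<nu> l)"
    unfolding power2_eq_square by (subst taylor_rec[OF assms]) simp
  also have "\<dots> = - (\<Sum>l<N. \<Sum>j\<in>supp \<nu>. \<Sum>i<N. B j l i * taylor (lower j \<nu>) i * taylor \<nu> l)"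
    by (simp add: sum_distrib_right sum_negf)
  also have "\<dots> = - (\<Sum>j\<in>supp \<nu>. form j (taylor (lower j \<nu>)) (taylor \<nu>))"
    unfolding form_def by (subst sum.swap) simp
  finally show ?thesis .
qed

definition scaled :: "(nat \<Rightarrow> nat) \<Rightarrow> nat \<Rightarrow> real" where
  "scaled \<nu> i = mpow \<rho> \<nu> * taylor \<nu> i"

lemma scaled_energy:
  assumes "\<nu> \<in> multi_indices" "\<nu> \<noteq> (\<lambda>_. 0)"
  shows "2 * (\<Sum>i<N. (scaled \<nu> i)\<^sup>2) \<le> (\<Sum>j\<in>supp \<nu>. P j (scaled (lower j \<nu>)) + P j (scaled \<nu>))"
proof -
  have "(\<Sum>i<N. (scaled \<nu> i)\<^sup>2) = (mpow \<rho> \<nu>)\<^sup>2 * (\<Sum>i<N. (taylor \<nu> i)\<^sup>2)"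
    by (simp add: scaled_def power_mult_distrib sum_distrib_left)
  also have "\<dots> = - (\<Sum>j\<in>supp \<nu>. \<rho> j * form j (scaled (lower j \<nu>)) (scaled \<nu>))"
    unfolding taylor_energy[OF assms] scaled_def form_scale mult_minus_right sum_distrib_left
    using mpow_lower[OF assms(1), of _ \<rho>]
    by (intro arg_cong[where f = uminus] sum.cong refl) (simp add: power2_eq_square)
  finally have "2 * (\<Sum>i<N. (scaled \<nu> i)\<^sup>2) = (\<Sum>j\<in>supp \<nu>. - (2 * \<rho> j * form j (scaled (lower j \<nu>)) (scaled \<nu>)))"
    by (simp add: sum_negf sum_distrib_left mult.assoc)
  also have "\<dots> \<le> (\<Sum>j\<in>supp \<nu>. P j (scaled (lower j \<nu>)) + P j (scaled \<nu>))"
  proof (rule sum_mono)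
    fix j
    have "- (2 * \<rho> j * form j (scaled (lower j \<nu>)) (scaled \<nu>))
       \<le> 2 * \<rho> j * \<bar>form j (scaled (lower j \<nu>)) (scaled \<nu>)\<bar>"
      using \<rho>[of j] by (simp add: abs_if)
    also have "\<dots> \<le> P j (scaled (lower j \<nu>)) + P j (scaled \<nu>)"
      unfolding form_def by (rule BP)
    finally show "- (2 * \<rho> j * form j (scaled (lower j \<nu>)) (scaled \<nu>)) \<le> P j (scaled (lower j \<nu>)) + P j (scaled \<nu>)" .
  qed
  finally show ?thesis .
qed

text \<open>Sum \<open>scaled_energy\<close> over the nonzero indices of a finite downward closed set and let \<open>T\<close> be the sum
of the squares over the whole set. Ellipticity bounds the terms with \<open>P\<^sub>j\<close> at \<open>\<nu>\<close> by \<open>\<sigma> T\<close>. The same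
bound holds for the terms at \<open>\<nu> - e\<^sub>j\<close>, as the map sending \<open>(\<nu>, j)\<close> to \<open>(\<nu> - e\<^sub>j, j)\<close> is injective.
Thus \<open>2 (T - \<bar>F\<bar>\<^sup>2) \<le> 2 \<sigma> T\<close>.\<close>

lemma scaled_square_sum:
  assumes "finite G" "G \<subseteq> multi_indices"
  shows "(\<Sum>\<nu>\<in>G. \<Sum>i<N. (scaled \<nu> i)\<^sup>2) \<le> (\<Sum>i<N. (F i)\<^sup>2) / (1 - \<sigma>)"
proof -
  obtain m where m: "m \<in> multi_indices" "G \<subseteq> {\<mu>. \<mu> \<le> m}"
    by (rule finite_multi_indices_bound[OF assms])
  define \<Lambda> where "\<Lambda> = {\<mu>. \<mu> \<le> m}"
  have fin: "finite \<Lambda>" unfolding \<Lambda>_def by (rule finite_below[OF m(1)])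
  have mi: "\<nu> \<in> multi_indices" if "\<nu> \<in> \<Lambda>" for \<nu>
    using that m(1) by (auto simp: \<Lambda>_def intro: multi_indices_mono)
  have finJ: "finite (supp m)" using m by (simp add: multi_indices_def)
  have sub: "supp \<nu> \<subseteq> supp m" if "\<nu> \<in> \<Lambda>" for \<nu> using that by (auto simp: \<Lambda>_def dest: supp_mono)
  let ?s = "\<lambda>\<nu>. \<Sum>i<N. (scaled \<nu> i)\<^sup>2"
  let ?z = "\<lambda>_::nat. 0::nat"
  define T where "T = (\<Sum>\<nu>\<in>\<Lambda>. ?s \<nu>)"
  have z: "?z \<in> \<Lambda>" by (simp add: \<Lambda>_def le_fun_def)
  have s0: "?s ?z = (\<Sum>i<N. (F i)\<^sup>2)" by (simp add: scaled_def taylor_0 mpow_def)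
  have T: "T = ?s ?z + (\<Sum>\<nu>\<in>\<Lambda> - {?z}. ?s \<nu>)"
    unfolding T_def by (rule sum.remove[OF fin z])
  have "2 * (\<Sum>\<nu>\<in>\<Lambda> - {?z}. ?s \<nu>) \<le> (\<Sum>\<nu>\<in>\<Lambda> - {?z}. \<Sum>j\<in>supp \<nu>. P j (scaled (lower j \<nu>)) + P j (scaled \<nu>))"
    unfolding sum_distrib_left using mi by (intro sum_mono scaled_energy[unfolded sum_distrib_left]) auto
  then have energy: "2 * (\<Sum>\<nu>\<in>\<Lambda> - {?z}. ?s \<nu>)
      \<le> (\<Sum>\<nu>\<in>\<Lambda> - {?z}. \<Sum>j\<in>supp \<nu>. P j (scaled (lower j \<nu>)))
      + (\<Sum>\<nu>\<in>\<Lambda> - {?z}. \<Sum>j\<in>supp \<nu>. P j (scaled \<nu>))"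
    by (simp add: sum.distrib)
  have diagonal: "(\<Sum>\<nu>\<in>\<Lambda> - {?z}. \<Sum>j\<in>supp \<nu>. P j (scaled \<nu>)) \<le> \<sigma> * T"
  proof -
    have "(\<Sum>\<nu>\<in>\<Lambda> - {?z}. \<Sum>j\<in>supp \<nu>. P j (scaled \<nu>)) \<le> (\<Sum>\<nu>\<in>\<Lambda> - {?z}. \<Sum>j\<in>supp m. P j (scaled \<nu>))"
      by (rule sum_mono, rule sum_mono2[OF finJ sub]) (auto simp: P_nonneg)
    also have "\<dots> \<le> (\<Sum>\<nu>\<in>\<Lambda>. \<Sum>j\<in>supp m. P j (scaled \<nu>))"
      using fin by (intro sum_mono2) (auto simp: P_nonneg intro: sum_nonneg)
    also have "\<dots> \<le> (\<Sum>\<nu>\<in>\<Lambda>. \<sigma> * ?s \<nu>)" by (intro sum_mono P finJ)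
    finally show ?thesis by (simp add: T_def sum_distrib_left)
  qed
  have shifted: "(\<Sum>\<nu>\<in>\<Lambda> - {?z}. \<Sum>j\<in>supp \<nu>. P j (scaled (lower j \<nu>))) \<le> \<sigma> * T"
  proof -
    let ?Q = "SIGMA \<nu>:\<Lambda> - {?z}. supp \<nu>"
    let ?h = "\<lambda>(\<nu>, j). (lower j \<nu>, j)"
    have inj: "inj_on ?h ?Q"
      by (rule inj_on_inverseI[where g = "\<lambda>(\<mu>, j). (raise j \<mu>, j)"]) (auto simp: raise_lower)
    have im: "?h ` ?Q \<subseteq> \<Lambda> \<times> supp m"
      using sub order.trans[OF lower_le] by (auto simp: \<Lambda>_def)
    have "(\<Sum>\<nu>\<in>\<Lambda> - {?z}. \<Sum>j\<in>supp \<nu>. P j (scaled (lower j \<nu>))) = (\<Sum>(\<nu>,j)\<in>?Q. P j (scaled (lower j \<nu>)))"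
      using fin finite_subset[OF sub finJ] by (intro sum.Sigma) auto
    also have "\<dots> = (\<Sum>(\<mu>,j)\<in>?h ` ?Q. P j (scaled \<mu>))"
      by (subst sum.reindex[OF inj]) (simp add: o_def case_prod_unfold)
    also have "\<dots> \<le> (\<Sum>(\<mu>,j)\<in>\<Lambda> \<times> supp m. P j (scaled \<mu>))"
      using fin finJ im by (intro sum_mono2) (auto intro: P_nonneg)
    also have "\<dots> = (\<Sum>\<mu>\<in>\<Lambda>. \<Sum>j\<in>supp m. P j (scaled \<mu>))" by (rule sum.cartesian_product[symmetric])
    also have "\<dots> \<le> (\<Sum>\<nu>\<in>\<Lambda>. \<sigma> * ?s \<nu>)" by (intro sum_mono P finJ)
    finally show ?thesis by (simp add: T_def sum_distrib_left)
  qed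
  have "(1 - \<sigma>) * T \<le> (\<Sum>i<N. (F i)\<^sup>2)" 
    unfolding left_diff_distrib using T s0 energy diagonal shifted by linarith
  then have "T \<le> (\<Sum>i<N. (F i)\<^sup>2) / (1 - \<sigma>)" using \<sigma> by (simp add: pos_le_divide_eq mult.commute)
  moreover have "(\<Sum>\<nu>\<in>G. ?s \<nu>) \<le> T"
    unfolding T_def using m fin by (intro sum_mono2) (auto simp: \<Lambda>_def intro: sum_nonneg)
  ultimately show ?thesis by linarith
qed

lemma taylor_weighted_sum:
  assumes G: "finite G" "G \<subseteq> multi_indices" and w: "\<And>\<nu>. 0 \<le> w \<nu>"
  shows "(\<Sum>\<nu>\<in>G. w \<nu> * vnorm N (taylor \<nu>))
    \<le> sqrt ((\<Sum>i<N. (F i)\<^sup>2) / (1 - \<sigma>)) * sqrt (\<Sum>\<nu>\<in>G. (w \<nu> * mpow (\<lambda>j. inverse (\<rho> j)) \<nu>)\<^sup>2)"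
proof -
  have pos: "0 < mpow \<rho> \<nu>" for \<nu> unfolding mpow_def using \<rho> by (intro prod_pos) (auto intro: less_trans[OF zero_less_one])
  have inv: "mpow (\<lambda>j. inverse (\<rho> j)) \<nu> = inverse (mpow \<rho> \<nu>)" for \<nu>
    by (simp add: mpow_def prod_inversef[symmetric] power_inverse o_def)
  have "(\<Sum>\<nu>\<in>G. w \<nu> * vnorm N (taylor \<nu>)) = (\<Sum>\<nu>\<in>G. \<bar>vnorm N (scaled \<nu>)\<bar> * \<bar>w \<nu> * mpow (\<lambda>j. inverse (\<rho> j)) \<nu>\<bar>)"
  proof (rule sum.cong)
    fix \<nu>
    have "vnorm N (scaled \<nu>) = mpow \<rho> \<nu> * vnorm N (taylor \<nu>)"
      unfolding scaled_def using pos[of \<nu>] by (simp add: L2_set_right_distrib)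
    then show "w \<nu> * vnorm N (taylor \<nu>) = \<bar>vnorm N (scaled \<nu>)\<bar> * \<bar>w \<nu> * mpow (\<lambda>j. inverse (\<rho> j)) \<nu>\<bar>"
      using pos[of \<nu>] w[of \<nu>] by (simp add: inv abs_mult)
  qed simp
  also have "\<dots> \<le> L2_set (\<lambda>\<nu>. vnorm N (scaled \<nu>)) G * L2_set (\<lambda>\<nu>. w \<nu> * mpow (\<lambda>j. inverse (\<rho> j)) \<nu>) G"
    by (rule L2_set_mult_ineq)
  also have "\<dots> \<le> sqrt ((\<Sum>i<N. (F i)\<^sup>2) / (1 - \<sigma>)) * sqrt (\<Sum>\<nu>\<in>G. (w \<nu> * mpow (\<lambda>j. inverse (\<rho> j)) \<nu>)\<^sup>2)"
    unfolding L2_set_def[of _ G] vnorm_sq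
    using scaled_square_sum[OF G] by (intro mult_right_mono) (auto intro: sum_nonneg)
  finally show ?thesis .
qed

context
  assumes sq_summable: "\<exists>S. \<forall>G. finite G \<longrightarrow> G \<subseteq> multi_indices \<longrightarrow>
    (\<Sum>\<nu>\<in>G. (mpow (\<lambda>j. inverse (\<rho> j)) \<nu>)\<^sup>2) \<le> S"
begin

lemma taylor_abs_summable:
  assumes "i < N" "y \<in> U"
  shows "(\<lambda>\<nu>. norm (mpow y \<nu> * taylor \<nu> i)) summable_on multi_indices"
proof (rule nonneg_bdd_above_summable_on)
  obtain S where S: "\<And>G. finite G \<Longrightarrow> G \<subseteq> multi_indices \<Longrightarrow>
    (\<Sum>\<nu>\<in>G. (mpow (\<lambda>j. inverse (\<rho> j)) \<nu>)\<^sup>2) \<le> S" using sq_summable by blast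
  show "bdd_above (sum (\<lambda>\<nu>. norm (mpow y \<nu> * taylor \<nu> i)) ` {G. G \<subseteq> multi_indices \<and> finite G})"
  proof (rule bdd_aboveI2)
    fix G assume "G \<in> {G. G \<subseteq> multi_indices \<and> finite G}"
    then have G: "finite G" "G \<subseteq> multi_indices" by auto
    have "(\<Sum>\<nu>\<in>G. norm (mpow y \<nu> * taylor \<nu> i)) \<le> (\<Sum>\<nu>\<in>G. 1 * vnorm N (taylor \<nu>))"
    proof (rule sum_mono)
      fix \<nu>
      have "\<bar>taylor \<nu> i\<bar> \<le> vnorm N (taylor \<nu>)"
        using member_le_L2_set[of "{..<N}" i "\<lambda>i. \<bar>taylor \<nu> i\<bar>"] assms(1) by (simp add: L2_set_def)
      then show "norm (mpow y \<nu> * taylor \<nu> i) \<le> 1 * vnorm N (taylor \<nu>)"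
        unfolding real_norm_def abs_mult using abs_mpow_le_1[OF assms(2)] by (intro mult_mono) auto
    qed
    also have "\<dots> \<le> sqrt ((\<Sum>i<N. (F i)\<^sup>2) / (1 - \<sigma>)) * sqrt (\<Sum>\<nu>\<in>G. (1 * mpow (\<lambda>j. inverse (\<rho> j)) \<nu>)\<^sup>2)"
      by (rule taylor_weighted_sum[OF G]) simp
    also have "\<dots> \<le> sqrt ((\<Sum>i<N. (F i)\<^sup>2) / (1 - \<sigma>)) * sqrt S"
      using S[OF G] \<sigma> by (intro mult_left_mono) (auto intro!: sum_nonneg divide_nonneg_nonneg)
    finally show "(\<Sum>\<nu>\<in>G. norm (mpow y \<nu> * taylor \<nu> i)) \<le> sqrt ((\<Sum>i<N. (F i)\<^sup>2) / (1 - \<sigma>)) * sqrt S" .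
  qed
qed simp

lemma B_abs_summable:
  assumes "i < N" "l < N"
  shows "summable (\<lambda>j. \<bar>B j l i\<bar>)"
proof (rule summableI_nonneg_bounded)
  let ?e = "\<lambda>k n. if n = k then 1 else 0 :: real"
  have single: "sum f {..<N} = f k" if "k < N" "\<And>n. n \<noteq> k \<Longrightarrow> f n = 0" for f :: "nat \<Rightarrow> real" and k
    using that by (simp add: sum.remove[of _ k])
  have unit: "form j (?e i) (?e l) = B j l i" for j
    unfolding form_def by (subst single[OF assms(2)], simp, subst single[OF assms(1)]) auto
  have le: "\<bar>B j l i\<bar> \<le> P j (?e i) + P j (?e l)" for j
  proof -
    have "\<bar>B j l i\<bar> \<le> \<rho> j * \<bar>B j l i\<bar>"
      using \<rho>[of j] mult_right_mono[of 1 "\<rho> j" "\<bar>B j l i\<bar>"] by simp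
    also have "\<dots> \<le> 2 * \<rho> j * \<bar>form j (?e i) (?e l)\<bar>"
      unfolding unit using \<rho>[of j] by simp
    also have "\<dots> \<le> P j (?e i) + P j (?e l)" unfolding form_def by (rule BP)
    finally show ?thesis .
  qed
  fix n
  have "(\<Sum>j<n. \<bar>B j l i\<bar>) \<le> (\<Sum>j<n. P j (?e i)) + (\<Sum>j<n. P j (?e l))"
    unfolding sum.distrib[symmetric] by (intro sum_mono le)
  also have "\<dots> \<le> \<sigma> * (\<Sum>k<N. (?e i k)\<^sup>2) + \<sigma> * (\<Sum>k<N. (?e l k)\<^sup>2)"
    by (intro add_mono P) auto
  finally show "(\<Sum>j<n. \<bar>B j l i\<bar>) \<le> \<sigma> * (\<Sum>k<N. (?e i k)\<^sup>2) + \<sigma> * (\<Sum>k<N. (?e l k)\<^sup>2)" .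
qed simp

text \<open>The double series of \<open>y\<^sub>j y\<^sup>\<mu> B\<^sub>j t\<^sub>\<mu>\<close> converges absolutely. Summed over \<open>\<mu>\<close> first it gives the series
of the claim; grouped according to \<open>\<nu> = \<mu> + e\<^sub>j\<close> it gives \<open>- \<Sum> y\<^sup>\<nu> t\<^sub>\<nu>\<close> over \<open>\<nu> \<noteq> 0\<close>, by the recursion.\<close>

lemma taylor_sum_solves:
  assumes "l < N" "y \<in> U"
  defines "X \<equiv> \<lambda>i. infsum (\<lambda>\<nu>. mpow y \<nu> * taylor \<nu> i) multi_indices"
  shows "(\<lambda>j. y j * (\<Sum>i<N. B j l i * X i)) sums (F l - X l)"
proof -
  let ?g = "\<lambda>j \<mu>. y j * mpow y \<mu> * (\<Sum>i<N. B j l i * taylor \<mu> i)"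
  let ?z = "\<lambda>_::nat. 0::nat"
  have X: "((\<lambda>\<nu>. mpow y \<nu> * taylor \<nu> i) has_sum X i) multi_indices" if "i < N" for i
    unfolding X_def by (rule has_sum_infsum[OF abs_summable_summable[OF taylor_abs_summable[OF that assms(2)]]])
  have "(\<lambda>(j, \<mu>). (y j * B j l i) * (mpow y \<mu> * taylor \<mu> i)) summable_on UNIV \<times> multi_indices"
    if "i < N" for i
  proof -
    have "summable (\<lambda>j. norm (y j * B j l i))"
    proof (rule summable_comparison_test'[OF B_abs_summable[OF that assms(1)], of 0])
      fix j show "norm (norm (y j * B j l i)) \<le> \<bar>B j l i\<bar>"
        using assms(2) mult_right_mono[of "\<bar>y j\<bar>" 1 "\<bar>B j l i\<bar>"]
        by (auto simp: U_def abs_mult abs_le_iff minus_le_iff)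
    qed
    then have "(\<lambda>j. norm (y j * B j l i)) summable_on UNIV"
      by (intro norm_summable_imp_summable_on) simp
    then show ?thesis by (rule summable_on_product[OF _ taylor_abs_summable[OF that assms(2)]])
  qed
  then have "(\<lambda>p. \<Sum>i<N. case p of (j, \<mu>) \<Rightarrow> (y j * B j l i) * (mpow y \<mu> * taylor \<mu> i)) summable_on UNIV \<times> multi_indices"
    by (intro has_sum_imp_summable[OF has_sum_finite_sum[OF _ has_sum_infsum]]) auto
  then have g: "(\<lambda>(j, \<mu>). ?g j \<mu>) summable_on UNIV \<times> multi_indices"
    by (simp add: case_prod_unfold sum_distrib_left mult_ac)
  then obtain S where S: "((\<lambda>(j, \<mu>). ?g j \<mu>) has_sum S) (UNIV \<times> multi_indices)"
    using summable_on_def by blast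
  have row: "(?g j has_sum (y j * (\<Sum>i<N. B j l i * X i))) multi_indices" for j
  proof -
    have "((\<lambda>\<mu>. \<Sum>i<N. (y j * B j l i) * (mpow y \<mu> * taylor \<mu> i)) has_sum
        (\<Sum>i<N. (y j * B j l i) * X i)) multi_indices"
      by (intro has_sum_finite_sum has_sum_cmult_right X) auto
    then show ?thesis by (simp add: sum_distrib_left mult_ac)
  qed
  have "((\<lambda>j. y j * (\<Sum>i<N. B j l i * X i)) has_sum S) UNIV"
    by (rule has_sum_SigmaD[OF S]) (use row in simp)
  then have 1: "(\<lambda>j. y j * (\<Sum>i<N. B j l i * X i)) sums S"
    by (rule has_sum_imp_sums)
  have bij: "bij_betw (\<lambda>(j, \<mu>). (raise j \<mu>, j)) (UNIV \<times> multi_indices) (SIGMA \<nu>:multi_indices - {?z}. supp \<nu>)"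
  proof (rule bij_betw_byWitness[where f' = "\<lambda>(\<nu>, j). (j, lower j \<nu>)"])
    show "(\<lambda>(j, \<mu>). (raise j \<mu>, j)) ` (UNIV \<times> multi_indices) \<subseteq> (SIGMA \<nu>:multi_indices - {?z}. supp \<nu>)"
      by auto
  qed (auto simp: raise_lower lower_multi_indices)
  have "((\<lambda>(\<nu>, j). mpow y \<nu> * (\<Sum>i<N. B j l i * taylor (lower j \<nu>) i)) has_sum S) (SIGMA \<nu>:multi_indices - {?z}. supp \<nu>)"
  proof (subst has_sum_reindex_bij_betw[OF bij, symmetric])
    have "((\<lambda>p. (case (case p of (j, \<mu>) \<Rightarrow> (raise j \<mu>, j)) of (\<nu>, j) \<Rightarrow>
       mpow y \<nu> * (\<Sum>i<N. B j l i * taylor (lower j \<nu>) i))) has_sum S) (UNIV \<times> multi_indices)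
      \<longleftrightarrow> ((\<lambda>(j, \<mu>). ?g j \<mu>) has_sum S) (UNIV \<times> multi_indices)"
      by (intro has_sum_cong) (auto simp: mpow_raise)
    then show "((\<lambda>p. (case (case p of (j, \<mu>) \<Rightarrow> (raise j \<mu>, j)) of (\<nu>, j) \<Rightarrow>
       mpow y \<nu> * (\<Sum>i<N. B j l i * taylor (lower j \<nu>) i))) has_sum S) (UNIV \<times> multi_indices)"
      using S by blast
  qed
  then have "((\<lambda>\<nu>. - (mpow y \<nu> * taylor \<nu> l)) has_sum S) (multi_indices - {?z})"
  proof (rule has_sum_SigmaD)
    fix \<nu> assume \<nu>: "\<nu> \<in> multi_indices - {?z}"
    then have "finite (supp \<nu>)" by (simp add: multi_indices_def)
    then show "((\<lambda>j. case (\<nu>, j) of (\<nu>, j) \<Rightarrow> mpow y \<nu> * (\<Sum>i<N. B j l i * taylor (lower j \<nu>) i))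
        has_sum - (mpow y \<nu> * taylor \<nu> l)) (supp \<nu>)"
      using \<nu> taylor_rec[of \<nu> l] by (intro has_sum_finiteI) (auto simp: sum_distrib_left)
  qed
  then have "((\<lambda>\<nu>. mpow y \<nu> * taylor \<nu> l) has_sum - S) (multi_indices - {?z})"
    by (rule has_sum_uminus[THEN iffD1])
  then have "((\<lambda>\<nu>. mpow y \<nu> * taylor \<nu> l) has_sum (mpow y ?z * taylor ?z l + - S)) (insert ?z (multi_indices - {?z}))"
    by (intro has_sum_insert) auto
  moreover have "insert ?z (multi_indices - {?z}) = multi_indices" by (auto simp: multi_indices_def)
  ultimately have "X l = F l - S"
    using has_sum_unique[OF X[OF assms(1)]] by (simp add: mpow_def taylor_0)
  with 1 show ?thesis by simp
qed

text \<open>Coercivity: testing the homogeneous system with \<open>\<delta>\<close> yields \<open>\<bar>\<delta>\<bar>\<^sup>2 \<le> \<sigma> \<bar>\<delta>\<bar>\<^sup>2\<close>.\<close>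

lemma system_solution_zero:
  assumes y: "y \<in> U" and \<delta>: "\<And>l. l < N \<Longrightarrow> (\<lambda>j. y j * (\<Sum>i<N. B j l i * \<delta> i)) sums (- \<delta> l)"
  shows "i < N \<Longrightarrow> \<delta> i = 0"
proof -
  let ?s = "\<Sum>l<N. (\<delta> l)\<^sup>2"
  have *: "(\<lambda>j. \<Sum>l<N. (y j * (\<Sum>i<N. B j l i * \<delta> i)) * \<delta> l) sums (\<Sum>l<N. - \<delta> l * \<delta> l)"
    by (intro sums_sum sums_mult2 \<delta>) simp
  have sums: "(\<lambda>j. - (y j * form j \<delta> \<delta>)) sums ?s"
    using sums_minus[OF *] by (simp add: form_def sum_distrib_left sum_distrib_right mult_ac power2_eq_square sum_negf)
  have "?s \<le> \<sigma> * ?s"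
  proof (rule LIMSEQ_le_const2[OF sums[unfolded sums_def]], intro exI allI impI)
    fix n
    have "(\<Sum>j<n. - (y j * form j \<delta> \<delta>)) \<le> (\<Sum>j<n. P j \<delta>)"
    proof (rule sum_mono)
      fix j
      have "- (y j * form j \<delta> \<delta>) \<le> \<bar>y j\<bar> * \<bar>form j \<delta> \<delta>\<bar>" by (simp add: flip: abs_mult)
      also have "\<dots> \<le> \<rho> j * \<bar>form j \<delta> \<delta>\<bar>"
        using y \<rho>[of j] by (intro mult_right_mono) (auto simp: U_def abs_le_iff intro: order.trans[of _ 1])
      also have "\<dots> \<le> P j \<delta>" using BP[of j \<delta> \<delta>] by (simp add: form_def)
      finally show "- (y j * form j \<delta> \<delta>) \<le> P j \<delta>" .
    qed
    also have "\<dots> \<le> \<sigma> * ?s" by (intro P) simp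
    finally show "(\<Sum>j<n. - (y j * form j \<delta> \<delta>)) \<le> \<sigma> * ?s" .
  qed
  moreover have "0 \<le> ?s" by (intro sum_nonneg) auto
  ultimately have "?s = 0" using \<sigma> by (cases "?s = 0") (auto simp: mult_le_cancel_right1)
  then show "i < N \<Longrightarrow> \<delta> i = 0" by (simp add: sum_nonneg_eq_0_iff)
qed

lemma solution_expansion:
  assumes y: "y \<in> U" and x: "\<And>l. l < N \<Longrightarrow> (\<lambda>j. y j * (\<Sum>i<N. B j l i * x i)) sums (F l - x l)"
    and i: "i < N"
  shows "((\<lambda>\<nu>. mpow y \<nu> * taylor \<nu> i) has_sum x i) multi_indices"
proof -
  let ?X = "\<lambda>i. infsum (\<lambda>\<nu>. mpow y \<nu> * taylor \<nu> i) multi_indices"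
  have "x i - ?X i = 0"
  proof (rule system_solution_zero[OF y _ i])
    fix l assume l: "l < N"
    have "(\<lambda>j. y j * (\<Sum>i<N. B j l i * x i) - y j * (\<Sum>i<N. B j l i * ?X i)) sums ((F l - x l) - (F l - ?X l))"
      by (intro sums_diff x l taylor_sum_solves y)
    then show "(\<lambda>j. y j * (\<Sum>i<N. B j l i * (x i - ?X i))) sums (- (x l - ?X l))"
      by (simp add: right_diff_distrib sum_subtractf)
  qed
  then show ?thesis
    using has_sum_infsum[OF abs_summable_summable[OF taylor_abs_summable[OF i y]]] by simp
qed

text \<open>The error \<open>\<delta>\<close> has the expansion \<open>\<Sum>\<^sub>\<nu> e\<^sub>\<nu> t\<^sub>\<nu>\<close>, where \<open>e\<^sub>\<nu>\<close> is the error on the monomial of index \<open>\<nu>\<close>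
and vanishes on \<open>\<Lambda>\<close>. Pairing the expansion with \<open>\<delta>\<close> itself turns it into a scalar series, whose
finite partial sums are bounded by \<open>\<bar>\<delta>\<bar>\<close> times the claimed bound.\<close>

lemma interpolation_error:
  assumes x: "\<And>z l. z \<in> insert y Z \<Longrightarrow> l < N \<Longrightarrow> (\<lambda>j. z j * (\<Sum>i<N. B j l i * x z i)) sums (F l - x z l)"
    and Z: "finite Z" "Z \<subseteq> U" and y: "y \<in> U"
    and exact: "\<And>\<nu>. \<nu> \<in> \<Lambda> \<Longrightarrow> (\<Sum>z\<in>Z. c z * mpow z \<nu>) = mpow y \<nu>"
    and w: "\<And>\<nu>. \<nu> \<in> multi_indices \<Longrightarrow> \<bar>mpow y \<nu> - (\<Sum>z\<in>Z. c z * mpow z \<nu>)\<bar> \<le> w \<nu>" "\<And>\<nu>. 0 \<le> w \<nu>"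
    and R: "\<And>G. finite G \<Longrightarrow> G \<subseteq> multi_indices - \<Lambda> \<Longrightarrow>
      (\<Sum>\<nu>\<in>G. (w \<nu> * mpow (\<lambda>j. inverse (\<rho> j)) \<nu>)\<^sup>2) \<le> R\<^sup>2" "0 \<le> R"
  shows "vnorm N (\<lambda>i. x y i - (\<Sum>z\<in>Z. c z * x z i)) \<le> sqrt ((\<Sum>i<N. (F i)\<^sup>2) / (1 - \<sigma>)) * R"
proof -
  define \<delta> where "\<delta> i = x y i - (\<Sum>z\<in>Z. c z * x z i)" for i
  define e where "e \<nu> = mpow y \<nu> - (\<Sum>z\<in>Z. c z * mpow z \<nu>)" for \<nu>
  let ?K = "sqrt ((\<Sum>i<N. (F i)\<^sup>2) / (1 - \<sigma>)) * R"
  have K0: "0 \<le> ?K" using R(2) \<sigma> by (intro mult_nonneg_nonneg real_sqrt_ge_zero divide_nonneg_nonneg sum_nonneg) auto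
  have exp: "((\<lambda>\<nu>. mpow z \<nu> * taylor \<nu> i) has_sum x z i) multi_indices" if "z \<in> insert y Z" "i < N" for z i
    using that Z y by (intro solution_expansion x) auto
  have \<delta>: "((\<lambda>\<nu>. e \<nu> * taylor \<nu> i) has_sum \<delta> i) multi_indices" if "i < N" for i
  proof -
    have "((\<lambda>\<nu>. mpow y \<nu> * taylor \<nu> i + (\<Sum>z\<in>Z. - c z * (mpow z \<nu> * taylor \<nu> i)))
        has_sum (x y i + (\<Sum>z\<in>Z. - c z * x z i))) multi_indices"
      using that Z(1) by (intro has_sum_add has_sum_finite_sum has_sum_cmult_right exp) auto
    then show ?thesis by (simp add: e_def \<delta>_def left_diff_distrib sum_distrib_right sum_negf mult.assoc)
  qed
  have "((\<lambda>\<nu>. \<Sum>i<N. \<delta> i * (e \<nu> * taylor \<nu> i)) has_sum (\<Sum>i<N. \<delta> i * \<delta> i)) multi_indices"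
    by (intro has_sum_finite_sum has_sum_cmult_right \<delta>) auto
  then have sq: "((\<lambda>\<nu>. e \<nu> * (\<Sum>i<N. \<delta> i * taylor \<nu> i)) has_sum (vnorm N \<delta>)\<^sup>2) multi_indices"
    unfolding vnorm_sq by (simp add: power2_eq_square sum_distrib_left mult_ac)
  have "(vnorm N \<delta>)\<^sup>2 \<le> vnorm N \<delta> * ?K"
  proof (rule has_sum_le_finite_sums[OF sq])
    fix G assume G: "finite G" "G \<subseteq> multi_indices"
    have pointwise: "e \<nu> * (\<Sum>i<N. \<delta> i * taylor \<nu> i) \<le> vnorm N \<delta> * (w \<nu> * vnorm N (taylor \<nu>))"
      if "\<nu> \<in> multi_indices" for \<nu>
    proof -
      have "e \<nu> * (\<Sum>i<N. \<delta> i * taylor \<nu> i) \<le> \<bar>e \<nu>\<bar> * \<bar>\<Sum>i<N. \<delta> i * taylor \<nu> i\<bar>"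
        by (simp flip: abs_mult)
      also have "\<bar>\<Sum>i<N. \<delta> i * taylor \<nu> i\<bar> \<le> (\<Sum>i<N. \<bar>\<delta> i\<bar> * \<bar>taylor \<nu> i\<bar>)"
        by (rule order.trans[OF sum_abs]) (simp add: abs_mult)
      also have "\<dots> \<le> vnorm N \<delta> * vnorm N (taylor \<nu>)" by (rule L2_set_mult_ineq)
      finally have "e \<nu> * (\<Sum>i<N. \<delta> i * taylor \<nu> i) \<le> \<bar>e \<nu>\<bar> * (vnorm N \<delta> * vnorm N (taylor \<nu>))"
        by (simp add: mult_left_mono)
      also have "\<dots> \<le> w \<nu> * (vnorm N \<delta> * vnorm N (taylor \<nu>))"
        using w(1)[OF that] by (intro mult_right_mono) (auto simp: e_def)
      finally show ?thesis by (simp add: mult_ac)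
    qed
    have "(\<Sum>\<nu>\<in>G. e \<nu> * (\<Sum>i<N. \<delta> i * taylor \<nu> i)) = (\<Sum>\<nu>\<in>G - \<Lambda>. e \<nu> * (\<Sum>i<N. \<delta> i * taylor \<nu> i))"
      using G by (intro sum.mono_neutral_right) (auto simp: e_def exact)
    also have "\<dots> \<le> (\<Sum>\<nu>\<in>G - \<Lambda>. vnorm N \<delta> * (w \<nu> * vnorm N (taylor \<nu>)))"
      using G by (intro sum_mono pointwise) auto
    also have "\<dots> = vnorm N \<delta> * (\<Sum>\<nu>\<in>G - \<Lambda>. w \<nu> * vnorm N (taylor \<nu>))"
      by (simp add: sum_distrib_left)
    also have "(\<Sum>\<nu>\<in>G - \<Lambda>. w \<nu> * vnorm N (taylor \<nu>)) \<le> sqrt ((\<Sum>i<N. (F i)\<^sup>2) / (1 - \<sigma>)) *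
        sqrt (\<Sum>\<nu>\<in>G - \<Lambda>. (w \<nu> * mpow (\<lambda>j. inverse (\<rho> j)) \<nu>)\<^sup>2)"
      using G w by (intro taylor_weighted_sum) auto
    also have "\<dots> \<le> ?K"
      using R(1)[of "G - \<Lambda>"] R(2) G \<sigma>
      by (intro mult_left_mono) (auto intro!: real_le_lsqrt sum_nonneg divide_nonneg_nonneg)
    finally show "(\<Sum>\<nu>\<in>G. e \<nu> * (\<Sum>i<N. \<delta> i * taylor \<nu> i)) \<le> vnorm N \<delta> * ?K"
      by (simp add: mult_left_mono)
  qed
  then have "vnorm N \<delta> \<le> ?K"
    using K0 by (cases "vnorm N \<delta> = 0") (auto simp: power2_eq_square less_le)
  then show ?thesis by (simp add: \<delta>_def[abs_def])
qed

end

end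

section \<open>Uniqueness of weak gradients\<close>

lemma partial_eq:
  assumes "(f has_derivative f') (at x)" shows "partial i f x = f' (axis i 1)"
  unfolding partial_def using frechet_derivative_at[OF assms] by simp

lemma cont_diff_lower: "cont_diff (Suc m) f \<Longrightarrow> cont_diff m f"
proof (induction m arbitrary: f)
  case 0
  then show ?case
    by (auto intro!: continuous_at_imp_continuous_on differentiable_imp_continuous_within)
next
  case (Suc m)
  have "f differentiable (at x)" for x using Suc.prems by simp
  moreover have "cont_diff m (partial i f)" for i
  proof (rule Suc.IH)
    show "cont_diff (Suc m) (partial i f)" using Suc.prems by (simp only: cont_diff.simps) blast
  qed
  ultimately show ?case by simp
qed

lemma cont_diff_const: "cont_diff m (\<lambda>x. c)"
proof (induction m arbitrary: c)
  case (Suc m)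
  have "partial i (\<lambda>x. c) = (\<lambda>x. 0)" for i :: 'a
    by (rule ext) (simp add: partial_eq[OF has_derivative_const])
  then show ?case using Suc by simp
qed simp

lemma cont_diff_add: "cont_diff m f \<Longrightarrow> cont_diff m g \<Longrightarrow> cont_diff m (\<lambda>x. f x + g x)"
proof (induction m arbitrary: f g)
  case (Suc m)
  have d: "f differentiable (at x)" "g differentiable (at x)" for x using Suc.prems by auto
  have "partial i (\<lambda>x. f x + g x) = (\<lambda>x. partial i f x + partial i g x)" for i
  proof
    fix x
    show "partial i (\<lambda>x. f x + g x) x = partial i f x + partial i g x"
      using partial_eq[OF has_derivative_add[OF d[of x, unfolded frechet_derivative_works]]]
      by (simp add: partial_def)
  qed
  then show ?case using Suc d by (auto intro: differentiable_add)
qed (auto intro: continuous_on_add)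

lemma cont_diff_mult: "cont_diff m f \<Longrightarrow> cont_diff m g \<Longrightarrow> cont_diff m (\<lambda>x. f x * g x)"
proof (induction m arbitrary: f g)
  case (Suc m)
  have d: "f differentiable (at x)" "g differentiable (at x)" for x using Suc.prems by auto
  have p: "partial i (\<lambda>x. f x * g x) = (\<lambda>x. f x * partial i g x + partial i f x * g x)" for i
  proof
    fix x
    show "partial i (\<lambda>x. f x * g x) x = f x * partial i g x + partial i f x * g x"
      using partial_eq[OF has_derivative_mult[OF d[of x, unfolded frechet_derivative_works]]]
      by (simp add: partial_def)
  qed
  have "cont_diff m (partial i (\<lambda>x. f x * g x))" for i
    unfolding p using Suc.prems cont_diff_lower[OF Suc.prems(1)] cont_diff_lower[OF Suc.prems(2)]
    by (intro cont_diff_add Suc.IH) auto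
  then show ?case using d by (auto intro: differentiable_mult)
qed (auto intro: continuous_on_mult)

lemma cont_diff_prod:
  "finite I \<Longrightarrow> (\<And>i. i \<in> I \<Longrightarrow> cont_diff m (f i)) \<Longrightarrow> cont_diff m (\<lambda>x. \<Prod>i\<in>I. f i x)"
  by (induction I rule: finite_induct) (auto intro: cont_diff_const cont_diff_mult)

lemma cont_diff_coordinate:
  assumes "\<And>m s. (H m has_real_derivative H (Suc m) s) (at s)"
  shows "cont_diff k (\<lambda>x. H m (x $ i))"
proof (induction k arbitrary: m)
  case 0
  have "continuous_on UNIV (H m)"
    by (intro continuous_at_imp_continuous_on ballI DERIV_isCont[OF assms])
  then show ?case by (auto intro!: continuous_on_compose2[of UNIV "H m"] continuous_intros)
next
  case (Suc k)
  have d: "((\<lambda>x. H m (x $ i)) has_derivative (\<lambda>v. v $ i * H (Suc m) (x $ i))) (at x)" for x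
    using has_derivative_compose[OF bounded_linear_imp_has_derivative[OF bounded_linear_vec_nth]
        assms[of m "x $ i", unfolded has_field_derivative_def]]
    by (simp add: mult.commute)
  have "partial l (\<lambda>x. H m (x $ i)) = (\<lambda>x. (if l = i then 1 else 0) * H (Suc m) (x $ i))" for l
    by (rule ext) (simp add: partial_eq[OF d] axis_def)
  then show ?case using d Suc
    by (auto simp: differentiable_def intro!: cont_diff_mult cont_diff_const)
qed

text \<open>For polynomials \<open>p\<close> these functions form a class that is closed under differentiation, including at
\<open>0\<close>; this yields smooth functions that vanish on a half-line.\<close>

definition flat :: "real poly \<Rightarrow> real \<Rightarrow> real" where
  "flat p s = (if 0 < s then poly p (1 / s) * exp (- (1 / s)) else 0)"

text \<open>The polynomial factor of the derivative of \<open>p(X) exp (- X)\<close>, where \<open>X = 1/s\<close> and hence \<open>dX/ds = - X\<^sup>2\<close>.\<close>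

definition flat_deriv :: "real poly \<Rightarrow> real poly" where
  "flat_deriv p = [:0, 0, 1:] * (p - pderiv p)"

lemma poly_exp_decay: "((\<lambda>x. poly p x * exp (- x)) \<longlongrightarrow> (0::real)) at_top"
proof -
  have "((\<lambda>x. \<Sum>i\<le>degree p. coeff p i * (x ^ i / exp x)) \<longlongrightarrow> (\<Sum>i\<le>degree p. coeff p i * 0)) at_top"
    by (intro tendsto_intros tendsto_power_div_exp_0)
  then show ?thesis by (simp add: poly_altdef sum_distrib_right exp_minus divide_inverse mult.assoc)
qed

lemma flat_has_derivative: "(flat p has_real_derivative flat (flat_deriv p) s) (at s)"
proof (cases s "0 :: real" rule: linorder_cases)
  case less
  have "((\<lambda>_. 0) has_real_derivative 0) (at s)" by simp
  then have "(flat p has_real_derivative 0) (at s)"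
    by (rule has_field_derivative_transform_within_open[of _ _ _ "{..<0}"]) (use less in \<open>auto simp: flat_def\<close>)
  then show ?thesis using less by (simp add: flat_def)
next
  case greater
  have "((\<lambda>s. poly p (1 / s) * exp (- (1 / s))) has_real_derivative flat (flat_deriv p) s) (at s)"
    using greater
    by (auto intro!: derivative_eq_intros DERIV_chain2[OF poly_DERIV] simp: flat_def flat_deriv_def)
       (simp add: field_simps power2_eq_square)
  then show ?thesis
    by (rule has_field_derivative_transform_within_open[of _ _ _ "{0<..}"]) (use greater in \<open>auto simp: flat_def\<close>)
next
  case equal
  have "((\<lambda>h. flat p h / h) \<longlongrightarrow> 0) (at_left 0)"
    by (rule tendsto_eventually) (auto simp: flat_def eventually_at_filter)
  moreover have "((\<lambda>h. flat p h / h) \<longlongrightarrow> 0) (at_right 0)"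
  proof (rule Lim_transform_eventually)
    show "((\<lambda>h. poly ([:0, 1:] * p) (inverse h) * exp (- inverse h)) \<longlongrightarrow> 0) (at_right 0)"
      by (rule filterlim_compose[OF poly_exp_decay filterlim_inverse_at_top_right])
    show "\<forall>\<^sub>F h in at_right 0. poly ([:0, 1:] * p) (inverse h) * exp (- inverse h) = flat p h / h"
      by (auto simp: flat_def eventually_at_filter field_simps)
  qed
  ultimately have "((\<lambda>h. flat p h / h) \<longlongrightarrow> 0) (at 0)" by (simp add: filterlim_split_at)
  then show ?thesis using equal by (simp add: has_field_derivative_iff flat_def)
qed

definition cutoff :: "real \<Rightarrow> real" where "cutoff = flat 1"

lemma cutoff_bounds: "0 \<le> cutoff s" "cutoff s \<le> 1"
  by (auto simp: cutoff_def flat_def)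

lemma cutoff_nonpos: "s \<le> 0 \<Longrightarrow> cutoff s = 0"
  by (simp add: cutoff_def flat_def)

lemma cutoff_at_top: "(cutoff \<longlongrightarrow> 1) at_top"
proof (rule Lim_transform_eventually)
  have "((\<lambda>s::real. exp (- inverse s)) \<longlongrightarrow> exp (- 0)) at_top"
    by (intro tendsto_intros tendsto_inverse_0_at_top filterlim_ident)
  then show "((\<lambda>s::real. exp (- inverse s)) \<longlongrightarrow> 1) at_top" by simp
  show "\<forall>\<^sub>F s in at_top. exp (- inverse s) = cutoff s"
    using eventually_gt_at_top[of 0] by eventually_elim (simp add: cutoff_def flat_def inverse_eq_divide)
qed

lemma cont_diff_cutoff: "cont_diff m (\<lambda>x. cutoff (\<alpha> * x $ i + c))"
proof -
  define H where "H n s = \<alpha> ^ n * flat ((flat_deriv ^^ n) 1) (\<alpha> * s + c)" for n s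
  have "(H n has_real_derivative H (Suc n) s) (at s)" for n s
    unfolding H_def
    by (rule DERIV_cong[OF DERIV_cmult[OF DERIV_chain2[OF flat_has_derivative]]])
      (auto intro!: derivative_eq_intros)
  then have "cont_diff m (\<lambda>x. H 0 (x $ i))" by (rule cont_diff_coordinate)
  then show ?thesis by (simp add: H_def cutoff_def)
qed

text \<open>The shift by \<open>1\<close> puts the support at distance \<open>1/n\<close> from the faces, so that its closure remains in the
open box; as \<open>n\<close> grows the functions converge to the indicator function of the box.\<close>

definition box_bump :: "real ^ 'k \<Rightarrow> real ^ 'k \<Rightarrow> nat \<Rightarrow> real ^ 'k \<Rightarrow> real" where
  "box_bump a b n x = (\<Prod>i\<in>UNIV. cutoff (real n * (x $ i - a $ i) - 1) * cutoff (real n * (b $ i - x $ i) - 1))"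

lemma cont_diff_box_bump: "cont_diff m (box_bump a b n)"
proof -
  have eq: "box_bump a b n = (\<lambda>x. \<Prod>i\<in>UNIV. cutoff (real n * x $ i + (- real n * a $ i - 1)) *
      cutoff (- real n * x $ i + (real n * b $ i - 1)))"
    by (simp add: box_bump_def algebra_simps fun_eq_iff)
  show ?thesis unfolding eq by (intro cont_diff_prod cont_diff_mult cont_diff_cutoff) auto
qed

lemma box_bump_bounds: "0 \<le> box_bump a b n x" "box_bump a b n x \<le> 1"
  unfolding box_bump_def
  by (auto intro!: prod_nonneg prod_le_1 mult_nonneg_nonneg mult_le_one cutoff_bounds)

lemma box_bump_support:
  assumes "box_bump a b n x \<noteq> 0"
  shows "a $ i + 1 / real n \<le> x $ i" "x $ i \<le> b $ i - 1 / real n" "0 < n"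
proof -
  have nz: "cutoff (real n * (x $ i - a $ i) - 1) \<noteq> 0" "cutoff (real n * (b $ i - x $ i) - 1) \<noteq> 0"
    using assms by (auto simp: box_bump_def)
  then have pos: "0 < real n * (x $ i - a $ i) - 1" "0 < real n * (b $ i - x $ i) - 1"
    using cutoff_nonpos not_le by blast+
  then show n: "0 < n" by (cases n) auto
  show "a $ i + 1 / real n \<le> x $ i" "x $ i \<le> b $ i - 1 / real n"
    using pos n by (auto simp: field_simps)
qed

lemma box_bump_test_function:
  fixes D :: "(real ^ 'k) set"
  assumes "box a b \<subseteq> D"
  shows "box_bump a b n \<in> test_functions D"
proof -
  let ?S = "{x. box_bump a b n x \<noteq> 0}"
  let ?K = "cbox (a + (\<chi> i. 1 / real n)) (b - (\<chi> i. 1 / real n))"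
  have sub: "?S \<subseteq> ?K" using box_bump_support by (auto simp: mem_box_cart)
  have cl: "closure ?S \<subseteq> ?K" by (rule closure_minimal[OF sub closed_cbox])
  have "closure ?S \<subseteq> D"
  proof (cases "n = 0")
    case True
    then have "?S = {}" using box_bump_support(3) by fastforce
    then show ?thesis by simp
  next
    case False
    then have n: "0 < 1 / real n" by simp
    have "?K \<subseteq> box a b"
    proof
      fix x assume "x \<in> ?K"
      then have "a $ i + 1 / real n \<le> x $ i \<and> x $ i \<le> b $ i - 1 / real n" for i
        by (simp add: mem_box_cart)
      then have "a $ i < x $ i \<and> x $ i < b $ i" for i using n by (smt (verit))
      then show "x \<in> box a b" by (simp add: mem_box_cart)
    qed
    then show ?thesis using cl assms by blast
  qed
  moreover have "compact (closure ?S)"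
    by (rule compact_closure[THEN iffD2]) (rule bounded_subset[OF bounded_cbox sub])
  ultimately show ?thesis by (simp add: test_functions_def cont_diff_box_bump)
qed

lemma box_bump_tendsto: "(\<lambda>n. box_bump a b n x) \<longlonglongrightarrow> indicator (box a b) x"
proof (cases "x \<in> box a b")
  case True
  have lim: "(\<lambda>n. cutoff (real n * c - 1)) \<longlonglongrightarrow> 1" if "c > 0" for c
  proof (rule filterlim_compose[OF cutoff_at_top])
    have "filterlim (\<lambda>n. real n * c) at_top sequentially"
      using that filterlim_tendsto_pos_mult_at_top[OF tendsto_const that filterlim_real_sequentially]
      by (simp add: mult.commute)
    then show "filterlim (\<lambda>n. real n * c - 1) at_top sequentially"
      using filterlim_tendsto_add_at_top[OF tendsto_const[of "-1"]] by fastforce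
  qed
  have "(\<lambda>n. box_bump a b n x) \<longlonglongrightarrow> (\<Prod>i\<in>(UNIV::'a set). 1 * 1)"
    unfolding box_bump_def using True by (intro tendsto_prod tendsto_mult lim) (auto simp: mem_box_cart)
  then show ?thesis using True by simp
next
  case False
  have "box_bump a b n x = 0" for n
  proof (rule ccontr)
    assume nz: "box_bump a b n x \<noteq> 0"
    have n: "0 < real n" using box_bump_support(3)[OF nz] by simp
    have "a $ i < x $ i \<and> x $ i < b $ i" for i
      using box_bump_support(1,2)[OF nz, of i] n zero_less_divide_1_iff[of "real n"] by linarith
    then show False using False by (auto simp: mem_box_cart)
  qed
  then show ?thesis using False by simp
qed

lemma continuous_test_function: "\<phi> \<in> test_functions D \<Longrightarrow> continuous_on UNIV \<phi>"
  unfolding test_functions_def using cont_diff.simps(1) by blast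

lemma integral_box_zero:
  fixes h :: "real ^ 'k \<Rightarrow> real"
  assumes D: "open D" and h: "integrable (lebesgue_on D) h"
    and 0: "\<And>\<phi>. \<phi> \<in> test_functions D \<Longrightarrow> (LINT x|lebesgue_on D. h x * \<phi> x) = 0"
    and sub: "box a b \<subseteq> D"
  shows "(LINT x|lebesgue_on D. indicator (box a b) x * h x) = 0"
proof -
  have Dm: "D \<in> sets lebesgue" using D by (simp add: borel_open)
  have meas: "box_bump a b n \<in> borel_measurable (lebesgue_on D)" for n
    by (rule continuous_imp_measurable_on_sets_lebesgue[OF continuous_on_subset Dm,
          OF continuous_test_function[OF box_bump_test_function[OF sub]] subset_UNIV])
  have "(\<lambda>n. LINT x|lebesgue_on D. h x * box_bump a b n x) \<longlonglongrightarrow> (LINT x|lebesgue_on D. h x * indicator (box a b) x)"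
  proof (rule integral_dominated_convergence[where w = "\<lambda>x. \<bar>h x\<bar>"])
    show "(\<lambda>x. h x * indicator (box a b) x) \<in> borel_measurable (lebesgue_on D)"
      by (intro borel_measurable_times borel_measurable_indicator borel_measurable_integrable[OF h])
         (use sub in \<open>auto simp: sets_restrict_space intro!: image_eqI[of _ _ "box a b"]\<close>)
    show "(\<lambda>x. h x * box_bump a b n x) \<in> borel_measurable (lebesgue_on D)" for n
      using h by (intro borel_measurable_times meas) auto
    show "AE x in lebesgue_on D. (\<lambda>n. h x * box_bump a b n x) \<longlonglongrightarrow> h x * indicator (box a b) x"
      by (intro AE_I2 tendsto_mult tendsto_const box_bump_tendsto)
    show "AE x in lebesgue_on D. norm (h x * box_bump a b n x) \<le> \<bar>h x\<bar>" for n
      using box_bump_bounds[of a b n] by (intro AE_I2) (auto simp: abs_mult intro: mult_left_le)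
  qed (use h in auto)
  moreover have "(LINT x|lebesgue_on D. h x * box_bump a b n x) = 0" for n
    by (rule 0[OF box_bump_test_function[OF sub]])
  ultimately have "(LINT x|lebesgue_on D. h x * indicator (box a b) x) = 0"
    by (simp add: LIMSEQ_const_iff)
  then show ?thesis by (simp add: mult.commute)
qed

text \<open>Boxes form a generator of the Borel sets that is closed under intersections, and the sets over which
\<open>f\<close> has integral \<open>0\<close> form a Dynkin system.\<close>

lemma AE_zero_of_box_integrals:
  fixes f :: "'a::euclidean_space \<Rightarrow> real"
  assumes f: "integrable lborel f" and box: "\<And>a b. (LINT x|lborel. indicator (box a b) x * f x) = 0"
   and total: "(LINT x|lborel. f x) = 0"
  shows "AE x in lborel. f x = 0"
proof (rule density_unique_real[OF f integrable_zero])
  fix A :: "'a set" assume "A \<in> sets lborel"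
  then have A: "A \<in> sigma_sets UNIV (range (\<lambda>(a, b). box a b :: 'a set))"
    by (simp add: borel_eq_box)
  have set_int: "set_integrable lborel B f" if "B \<in> sets lborel" for B
    using f that unfolding set_integrable_def by (intro integrable_mult_indicator)
  have sets: "B \<in> sets lborel" if "B \<in> sigma_sets UNIV (range (\<lambda>(a, b). box a b :: 'a set))" for B
    using that by (simp add: borel_eq_box)
  have "set_lebesgue_integral lborel A f = 0"
  proof (rule sigma_sets_induct_disjoint[OF _ _ A])
    show "Int_stable (range (\<lambda>(a, b). box a b :: 'a set))"
      by (auto simp: Int_stable_def box_Int_box)
    show "set_lebesgue_integral lborel B f = 0" if "B \<in> range (\<lambda>(a, b). box a b)" for B
      using that box by (auto simp: set_lebesgue_integral_def)
    show "set_lebesgue_integral lborel (UNIV - B) f = 0"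
      if "B \<in> sigma_sets UNIV (range (\<lambda>(a, b). box a b))" "set_lebesgue_integral lborel B f = 0" for B
    proof -
      have "set_lebesgue_integral lborel (B \<union> (UNIV - B)) f =
        set_lebesgue_integral lborel B f + set_lebesgue_integral lborel (UNIV - B) f"
        using sets[OF that(1)] by (intro set_integral_Un set_int) auto
      then show ?thesis using that(2) total by (simp add: set_lebesgue_integral_def)
    qed
    show "set_lebesgue_integral lborel (\<Union>i::nat. B i) f = 0"
      if "disjoint_family B" "range B \<subseteq> sigma_sets UNIV (range (\<lambda>(a, b). box a b))"
        "\<And>i. set_lebesgue_integral lborel (B i) f = 0" for B
    proof -
      have "B i \<in> sets lborel" for i using that(2) sets by blast
      then have "set_lebesgue_integral lborel (\<Union>i::nat. B i) f = (\<Sum>i. set_lebesgue_integral lborel (B i) f)"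
        using that(1) by (intro lebesgue_integral_countable_add set_int) (auto simp: disjoint_family_on_def)
      then show ?thesis using that(3) by simp
    qed
  qed (auto simp: set_lebesgue_integral_def)
  then show "set_lebesgue_integral lborel A f = set_lebesgue_integral lborel A (\<lambda>x. 0)"
    by (simp add: set_lebesgue_integral_def)
qed

text \<open>The fundamental lemma of the calculus of variations. The domain is covered by countably many boxes
contained in it, and the intersection of any box with one of them is again a box in the domain.\<close>

lemma test_functions_separate:
  fixes h :: "real ^ 'k \<Rightarrow> real"
  assumes D: "open D" and h: "integrable (lebesgue_on D) h"
    and 0: "\<And>\<phi>. \<phi> \<in> test_functions D \<Longrightarrow> (LINT x|lebesgue_on D. h x * \<phi> x) = 0"
  shows "AE x in lebesgue_on D. h x = 0"
proof -
  have Dm: "D \<in> sets lebesgue" using D by (simp add: borel_open)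
  define H where "H x = indicator D x * h x" for x
  have H: "integrable lebesgue H"
    using h Dm unfolding H_def by (simp add: integrable_restrict_space)
  obtain H' where H': "H' \<in> borel_measurable lborel" "AE x in lborel. H x = H' x"
    using completion_ex_borel_measurable_real[of H lborel] borel_measurable_integrable[OF H] by blast
  have AE: "AE x in lebesgue. H x = H' x" by (rule AE_completion[OF H'(2)])
  have H'm: "H' \<in> borel_measurable lebesgue" using H'(1) by (rule measurable_completion)
  have "integrable lebesgue H'"
    using integrable_cong_AE[OF borel_measurable_integrable[OF H] H'm AE] H by simp
  then have H'i: "integrable lborel H'" using H'(1) by (simp add: integrable_completion)
  have boxint: "(LINT x|lborel. indicator (box a b) x * H' x) = 0" if "box a b \<subseteq> D" for a b
  proof -
    have "(LINT x|lborel. indicator (box a b) x * H' x) = (LINT x|lebesgue. indicator (box a b) x * H' x)"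
      using H'(1) by (intro integral_completion[symmetric]) auto
    also have "\<dots> = (LINT x|lebesgue. indicator D x *\<^sub>R (indicator (box a b) x * h x))"
    proof (rule integral_cong_AE)
      have eq: "indicator D x *\<^sub>R (indicator (box a b) x * h x) = indicator (box a b) x * H x" for x
        by (simp add: H_def)
      show "(\<lambda>x. indicator (box a b) x * H' x) \<in> borel_measurable lebesgue"
        using H'm by (intro borel_measurable_times borel_measurable_indicator) auto
      show "(\<lambda>x. indicator D x *\<^sub>R (indicator (box a b) x * h x)) \<in> borel_measurable lebesgue"
        unfolding eq using borel_measurable_integrable[OF H]
        by (intro borel_measurable_times borel_measurable_indicator) auto
      show "AE x in lebesgue. indicator (box a b) x * H' x = indicator D x *\<^sub>R (indicator (box a b) x * h x)"
        unfolding eq using AE by eventually_elim simp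
    qed
    also have "\<dots> = (LINT x|lebesgue_on D. indicator (box a b) x * h x)"
      using Dm by (simp add: integral_restrict_space)
    also have "\<dots> = 0" by (rule integral_box_zero[OF D h 0 that])
    finally show ?thesis .
  qed
  obtain \<D> where \<D>: "countable \<D>" "\<D> \<subseteq> Pow D" "\<And>X. X \<in> \<D> \<Longrightarrow> \<exists>a b. X = box a b" "\<Union>\<D> = D"
    using open_countable_Union_open_box[OF D] by blast
  have "AE x in lborel. x \<in> X \<longrightarrow> H' x = 0" if X: "X \<in> \<D>" for X
  proof -
    obtain c d where cd: "X = box c d" using \<D>(3)[OF X] by blast
    have "AE x in lborel. indicator X x * H' x = 0"
    proof (rule AE_zero_of_box_integrals)
      have Xm: "X \<in> sets lborel" unfolding cd by simp
      show "integrable lborel (\<lambda>x. indicator X x * H' x)"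
        using integrable_mult_indicator[OF Xm H'i] by simp
      show "(LINT x|lborel. indicator X x * H' x) = 0"
        unfolding cd using \<D>(2) X cd by (intro boxint) auto
      fix a b
      obtain a' b' where int: "box a b \<inter> box c d = box a' b'" by (rule that[OF box_Int_box])
      have eq: "indicator (box a b) x * (indicator X x * H' x) = indicator (box a' b') x * H' x" for x
        unfolding int[symmetric] cd indicator_inter_arith by (rule mult.assoc[symmetric])
      have sub: "box a' b' \<subseteq> D"
        unfolding int[symmetric] using \<D>(2) X cd by blast
      show "(LINT x|lborel. indicator (box a b) x * (indicator X x * H' x)) = 0"
        unfolding eq by (rule boxint[OF sub])
    qed
    then show ?thesis by eventually_elim (auto simp: indicator_eq_0_iff)
  qed
  then have "AE x in lborel. \<forall>X\<in>\<D>. x \<in> X \<longrightarrow> H' x = 0"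
    unfolding AE_ball_countable[OF \<D>(1)] by (intro ballI)
  then have "AE x in lebesgue. \<forall>X\<in>\<D>. x \<in> X \<longrightarrow> H' x = 0" by (rule AE_completion)
  with AE have "AE x in lebesgue. x \<in> D \<longrightarrow> h x = 0"
  proof eventually_elim
    fix x assume *: "H x = H' x" "\<forall>X\<in>\<D>. x \<in> X \<longrightarrow> H' x = 0"
    show "x \<in> D \<longrightarrow> h x = 0"
    proof
      assume "x \<in> D"
      then have "H' x = 0" using *(2) \<D>(4) by blast
      then show "h x = 0" using *(1) \<open>x \<in> D\<close> by (simp add: H_def)
    qed
  qed
  then show ?thesis using Dm by (subst AE_restrict_space_iff) auto
qed

section \<open>Square-integrable fields and orthonormalisation\<close>

lemma L2_mult_integrable:
  assumes "f \<in> L2 D" "g \<in> L2 D"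
  shows "integrable (lebesgue_on D) (\<lambda>x. f x * g x)"
proof (rule Bochner_Integration.integrable_bound)
  show "integrable (lebesgue_on D) (\<lambda>x. (f x)\<^sup>2 + (g x)\<^sup>2)"
    using assms by (auto simp: L2_def)
  show "AE x in lebesgue_on D. norm (f x * g x) \<le> norm ((f x)\<^sup>2 + (g x)\<^sup>2)"
  proof (rule AE_I2)
    fix x
    have "2 * \<bar>f x * g x\<bar> \<le> (f x)\<^sup>2 + (g x)\<^sup>2"
      using sum_squares_bound[of "\<bar>f x\<bar>" "\<bar>g x\<bar>"] by (simp add: abs_mult)
    moreover have "0 \<le> (f x)\<^sup>2 + (g x)\<^sup>2" by simp
    ultimately show "norm (f x * g x) \<le> norm ((f x)\<^sup>2 + (g x)\<^sup>2)"
      unfolding real_norm_def by linarith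
  qed
  show "(\<lambda>x. f x * g x) \<in> borel_measurable (lebesgue_on D)"
    using assms by (auto simp: L2_def)
qed

lemma L2_add_scaled:
  assumes "f \<in> L2 D" "g \<in> L2 D"
  shows "(\<lambda>x. f x + c * g x) \<in> L2 D"
proof -
  have "integrable (lebesgue_on D) (\<lambda>x. (f x)\<^sup>2 + 2 * c * (f x * g x) + c\<^sup>2 * (g x)\<^sup>2)"
    using assms L2_mult_integrable[OF assms] by (auto simp: L2_def)
  moreover have "(\<lambda>x. (f x)\<^sup>2 + 2 * c * (f x * g x) + c\<^sup>2 * (g x)\<^sup>2) = (\<lambda>x. (f x + c * g x)\<^sup>2)"
    by (simp add: power2_eq_square algebra_simps)
  ultimately show ?thesis using assms by (auto simp: L2_def)
qed

lemma L2_bounded_continuous: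
  assumes D: "D \<in> lmeasurable" and g: "continuous_on UNIV g" and C: "\<And>x. \<bar>g x\<bar> \<le> C"
  shows "g \<in> L2 D"
proof -
  interpret finite_measure "lebesgue_on D" by (rule finite_measure_lebesgue_on[OF D])
  have m: "g \<in> borel_measurable (lebesgue_on D)"
    using D continuous_on_subset[OF g subset_UNIV]
    by (intro continuous_imp_measurable_on_sets_lebesgue) auto
  have "integrable (lebesgue_on D) (\<lambda>x. (g x)\<^sup>2)"
  proof (rule integrable_const_bound[where B = "C\<^sup>2"])
    show "AE x in lebesgue_on D. norm ((g x)\<^sup>2) \<le> C\<^sup>2"
      using C by (intro AE_I2) (simp add: abs_le_square_iff[symmetric] order.trans[OF C abs_ge_self])
  qed (use m in auto)
  then show ?thesis using m by (simp add: L2_def)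
qed

lemma continuous_compact_support_bounded:
  fixes g :: "'a::topological_space \<Rightarrow> real"
  assumes "continuous_on UNIV g" "compact K" "\<And>x. x \<notin> K \<Longrightarrow> g x = 0"
  obtains C where "\<forall>x. \<bar>g x\<bar> \<le> C"
proof -
  have "bounded (g ` K)"
    using assms by (intro compact_imp_bounded compact_continuous_image) (auto intro: continuous_on_subset)
  then obtain C where C: "\<And>x. x \<in> K \<Longrightarrow> \<bar>g x\<bar> \<le> C" by (auto simp: bounded_iff)
  have "\<bar>g x\<bar> \<le> max C 0" for x
    using C[of x] assms(3)[of x] by (cases "x \<in> K") auto
  then show ?thesis using that by blast
qed

lemma test_function_L2:
  assumes D: "D \<in> lmeasurable" and \<phi>: "\<phi> \<in> test_functions D"
  shows "\<phi> \<in> L2 D" "partial i \<phi> \<in> L2 D"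
proof -
  define K where "K = closure {x. \<phi> x \<noteq> 0}"
  have K: "compact K" using \<phi> unfolding K_def by (simp add: test_functions_def)
  have out: "\<phi> x = 0" if "x \<notin> K" for x 
    using that closure_subset[of "{x. \<phi> x \<noteq> 0}"] unfolding K_def by blast
  have "cont_diff (Suc 0) \<phi>" using \<phi> unfolding test_functions_def by blast
  then have c: "continuous_on UNIV (partial i \<phi>)" by simp
  have out': "partial i \<phi> x = 0" if "x \<notin> K" for x
  proof -
    have "(\<phi> has_derivative (\<lambda>_. 0)) (at x)"
      by (rule has_derivative_transform_within_open[OF has_derivative_const, of "- K"])
        (use that out compact_imp_closed[OF K] in auto)
    then show ?thesis by (simp add: partial_eq)
  qed
  obtain C where "\<forall>x. \<bar>\<phi> x\<bar> \<le> C"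
    by (rule continuous_compact_support_bounded[OF continuous_test_function[OF \<phi>] K out]) blast
  then show "\<phi> \<in> L2 D" 
    by (intro L2_bounded_continuous[OF D continuous_test_function[OF \<phi>]]) blast
  obtain C' where "\<forall>x. \<bar>partial i \<phi> x\<bar> \<le> C'"
    by (rule continuous_compact_support_bounded[OF c K out']) blast
  then show "partial i \<phi> \<in> L2 D" 
    by (intro L2_bounded_continuous[OF D c]) blast
qed

definition L2_fields :: "(real ^ 'k) set \<Rightarrow> (real ^ 'k \<Rightarrow> real ^ 'k) set" where
  "L2_fields D = {g. \<forall>i. (\<lambda>x. g x $ i) \<in> L2 D}"

lemma L2_fields_measurable: "g \<in> L2_fields D \<Longrightarrow> g \<in> borel_measurable (lebesgue_on D)"
  by (subst borel_measurable_euclidean_space)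
    (auto simp: L2_fields_def L2_def Basis_vec_def inner_axis)

lemma L2_fields_add_scaled:
  "g \<in> L2_fields D \<Longrightarrow> h \<in> L2_fields D \<Longrightarrow> (\<lambda>x. g x + c *\<^sub>R h x) \<in> L2_fields D"
  by (simp add: L2_fields_def L2_add_scaled)

lemma L2_fields_zero: "(\<lambda>x. 0) \<in> L2_fields D"
  by (simp add: L2_fields_def L2_def)

lemma L2_fields_sum:
  assumes "finite I" "\<And>i. i \<in> I \<Longrightarrow> g i \<in> L2_fields D"
  shows "(\<lambda>x. \<Sum>i\<in>I. c i *\<^sub>R g i x) \<in> L2_fields D"
  using assms
proof (induction I rule: finite_induct)
  case (insert i I)
  then have "(\<lambda>x. (\<Sum>i\<in>I. c i *\<^sub>R g i x) + c i *\<^sub>R g i x) \<in> L2_fields D"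
    by (intro L2_fields_add_scaled) auto
  then show ?case using insert by (simp add: add.commute)
qed (simp add: L2_fields_zero)

lemma grad_weak_gradient:
  assumes "v \<in> H1 D"
  shows "grad D v \<in> L2_fields D" "has_weak_gradient D v (grad D v)"
proof -
  have "\<exists>g. (\<forall>i. (\<lambda>x. g x $ i) \<in> L2 D) \<and> has_weak_gradient D v g"
    using assms by (simp add: H1_def)
  from someI_ex[OF this] show "grad D v \<in> L2_fields D" "has_weak_gradient D v (grad D v)"
    by (simp_all add: grad_def L2_fields_def)
qed

lemma has_weak_gradient_add_scaled:
  assumes D: "D \<in> lmeasurable" and v: "v \<in> L2 D" "w \<in> L2 D" "g \<in> L2_fields D" "h \<in> L2_fields D"
    and g: "has_weak_gradient D v g" "has_weak_gradient D w h"
  shows "has_weak_gradient D (\<lambda>x. v x + c * w x) (\<lambda>x. g x + c *\<^sub>R h x)"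
  unfolding has_weak_gradient_def
proof (intro ballI allI)
  fix \<phi> i assume \<phi>: "\<phi> \<in> test_functions D"
  let ?M = "lebesgue_on D"
  note \<phi>L = test_function_L2[OF D \<phi>]
  have gi: "(\<lambda>x. g x $ i) \<in> L2 D" "(\<lambda>x. h x $ i) \<in> L2 D" using v by (auto simp: L2_fields_def)
  have "(LINT x|?M. (v x + c * w x) * partial i \<phi> x)
     = (LINT x|?M. v x * partial i \<phi> x + c * (w x * partial i \<phi> x))"
    by (simp add: algebra_simps)
  also have "\<dots> = (LINT x|?M. v x * partial i \<phi> x) + c * (LINT x|?M. w x * partial i \<phi> x)"
    using L2_mult_integrable[OF v(1) \<phi>L(2)] L2_mult_integrable[OF v(2) \<phi>L(2)] by simp
  also have "\<dots> = - (LINT x|?M. g x $ i * \<phi> x) + c * - (LINT x|?M. h x $ i * \<phi> x)"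
    using g \<phi> by (simp add: has_weak_gradient_def)
  also have "\<dots> = - (LINT x|?M. g x $ i * \<phi> x + c * (h x $ i * \<phi> x))"
    using L2_mult_integrable[OF gi(1) \<phi>L(1)] L2_mult_integrable[OF gi(2) \<phi>L(1)] by simp
  also have "(\<lambda>x. g x $ i * \<phi> x + c * (h x $ i * \<phi> x)) = (\<lambda>x. (g x + c *\<^sub>R h x) $ i * \<phi> x)"
    by (simp add: algebra_simps)
  finally show "(LINT x|?M. (v x + c * w x) * partial i \<phi> x) = - (LINT x|?M. (g x + c *\<^sub>R h x) $ i * \<phi> x)" .
qed

lemma L2_has_weak_gradient_sum:
  assumes D: "D \<in> lmeasurable" and I: "finite I"
    and v: "v \<in> L2 D" "g \<in> L2_fields D" "has_weak_gradient D v g"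
    and w: "\<And>i. i \<in> I \<Longrightarrow> w i \<in> L2 D \<and> h i \<in> L2_fields D \<and> has_weak_gradient D (w i) (h i)"
  shows "(\<lambda>x. v x + (\<Sum>i\<in>I. c i * w i x)) \<in> L2 D \<and> (\<lambda>x. g x + (\<Sum>i\<in>I. c i *\<^sub>R h i x)) \<in> L2_fields D \<and>
    has_weak_gradient D (\<lambda>x. v x + (\<Sum>i\<in>I. c i * w i x)) (\<lambda>x. g x + (\<Sum>i\<in>I. c i *\<^sub>R h i x))"
  using I w
proof (induction I rule: finite_induct)
  case empty
  then show ?case using v by simp
next
  case (insert i I)
  let ?v = "\<lambda>x. v x + (\<Sum>i\<in>I. c i * w i x)" and ?g = "\<lambda>x. g x + (\<Sum>i\<in>I. c i *\<^sub>R h i x)"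
  have IH: "?v \<in> L2 D" "?g \<in> L2_fields D" "has_weak_gradient D ?v ?g" using insert by auto
  have i: "w i \<in> L2 D" "h i \<in> L2_fields D" "has_weak_gradient D (w i) (h i)" using insert by auto
  have "(\<lambda>x. ?v x + c i * w i x) = (\<lambda>x. v x + (\<Sum>i\<in>insert i I. c i * w i x))"
    "(\<lambda>x. ?g x + c i *\<^sub>R h i x) = (\<lambda>x. g x + (\<Sum>i\<in>insert i I. c i *\<^sub>R h i x))"
    using insert(1,2) by (simp_all add: add_ac)
  then show ?case
    using L2_add_scaled[OF IH(1) i(1), of "c i"] L2_fields_add_scaled[OF IH(2) i(2), of "c i"]
      has_weak_gradient_add_scaled[OF D IH(1) i(1) IH(2) i(2) IH(3) i(3), of "c i"] by simp
qed

lemma weak_gradient_unique: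
  assumes D: "open D" "bounded D" and g: "g \<in> L2_fields D" "h \<in> L2_fields D"
    and w: "has_weak_gradient D v g" "has_weak_gradient D v h"
  shows "AE x in lebesgue_on D. g x = h x"
proof -
  have Dm: "D \<in> lmeasurable" using D by (intro lmeasurable_open)
  have one: "(\<lambda>x. 1) \<in> L2 D" by (rule L2_bounded_continuous[OF Dm, of _ 1]) auto
  have "AE x in lebesgue_on D. g x $ i - h x $ i = 0" for i
  proof (rule test_functions_separate[OF D(1)])
    have gi: "(\<lambda>x. g x $ i) \<in> L2 D" "(\<lambda>x. h x $ i) \<in> L2 D" using g by (auto simp: L2_fields_def)
    show "integrable (lebesgue_on D) (\<lambda>x. g x $ i - h x $ i)"
      using L2_mult_integrable[OF gi(1) one] L2_mult_integrable[OF gi(2) one] by simp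
    fix \<phi> assume \<phi>: "\<phi> \<in> test_functions D"
    have "(LINT x|lebesgue_on D. g x $ i * \<phi> x) = (LINT x|lebesgue_on D. h x $ i * \<phi> x)"
      using w \<phi> unfolding has_weak_gradient_def by fastforce
    moreover have "(LINT x|lebesgue_on D. (g x $ i - h x $ i) * \<phi> x) =
        (LINT x|lebesgue_on D. g x $ i * \<phi> x) - (LINT x|lebesgue_on D. h x $ i * \<phi> x)"
      using L2_mult_integrable[OF gi(1)] L2_mult_integrable[OF gi(2)] test_function_L2(1)[OF Dm \<phi>]
      by (simp add: left_diff_distrib)
    ultimately show "(LINT x|lebesgue_on D. (g x $ i - h x $ i) * \<phi> x) = 0" by simp
  qed
  then have "AE x in lebesgue_on D. \<forall>i\<in>UNIV. g x $ i - h x $ i = 0"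
    by (intro AE_finite_allI) auto
  then show ?thesis by eventually_elim (simp add: vec_eq_iff)
qed

lemma V_norm_weak_gradient:
  assumes D: "open D" "bounded D" and g: "g \<in> L2_fields D" "has_weak_gradient D v g"
    and h: "h \<in> L2_fields D" "AE x in lebesgue_on D. g x = h x"
  shows "V_norm D v = sqrt (LINT x|lebesgue_on D. h x \<bullet> h x)"
proof -
  have "\<exists>g. (\<forall>i. (\<lambda>x. g x $ i) \<in> L2 D) \<and> has_weak_gradient D v g"
    using g by (auto simp: L2_fields_def)
  from someI_ex[OF this] have gr: "grad D v \<in> L2_fields D" "has_weak_gradient D v (grad D v)"
    by (simp_all add: grad_def L2_fields_def)
  have m: "f \<in> borel_measurable (lebesgue_on D)" if "f \<in> L2_fields D" for f
    using that by (rule L2_fields_measurable)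
  have "AE x in lebesgue_on D. (norm (grad D v x))\<^sup>2 = h x \<bullet> h x"
    using weak_gradient_unique[OF D gr(1) g(1) gr(2) g(2)] h(2)
    by eventually_elim (simp add: power2_norm_eq_inner)
  then have "(LINT x|lebesgue_on D. (norm (grad D v x))\<^sup>2) = (LINT x|lebesgue_on D. h x \<bullet> h x)"
    using m[OF gr(1)] m[OF h(1)] by (intro integral_cong_AE) auto
  then show ?thesis by (simp add: V_norm_def)
qed

text \<open>The form is only semidefinite, and \<open>S\<close> is closed under linear combinations of functions. A vector whose
component orthogonal to the previous basis has energy \<open>0\<close> does not enlarge the basis. The vectors are therefore
recovered up to remainders of energy \<open>0\<close>, the coefficients of \<open>v\<close> being \<open>- c\<close>.\<close>

lemma gram_schmidt:
  fixes A :: "('x \<Rightarrow> 'v::real_vector) \<Rightarrow> ('x \<Rightarrow> 'v) \<Rightarrow> real"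
  assumes S: "\<And>f g c. f \<in> S \<Longrightarrow> g \<in> S \<Longrightarrow> (\<lambda>x. f x + c *\<^sub>R g x) \<in> S"
    and lin: "\<And>f g h c. f \<in> S \<Longrightarrow> g \<in> S \<Longrightarrow> h \<in> S \<Longrightarrow> A (\<lambda>x. f x + c *\<^sub>R g x) h = A f h + c * A g h"
    and sym: "\<And>f g. f \<in> S \<Longrightarrow> g \<in> S \<Longrightarrow> A f g = A g f"
    and nonneg: "\<And>f. f \<in> S \<Longrightarrow> 0 \<le> A f f"
    and V: "finite V" "V \<subseteq> S"
  shows "\<exists>N::nat. \<exists>W. (\<forall>i<N. W i \<in> S) \<and> (\<forall>i<N. \<forall>l<N. A (W i) (W l) = (if i = l then 1 else 0)) \<and>
    (\<forall>v\<in>V. \<exists>c. (\<lambda>x. v x + (\<Sum>i<N. c i *\<^sub>R W i x)) \<in> S \<and>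
      A (\<lambda>x. v x + (\<Sum>i<N. c i *\<^sub>R W i x)) (\<lambda>x. v x + (\<Sum>i<N. c i *\<^sub>R W i x)) = 0)"
  using V
proof (induction V rule: finite_induct)
  case empty
  show ?case by (rule exI[of _ "0::nat"]) simp
next
  case (insert v V)
  then have "V \<subseteq> S" by simp
  from insert.IH[OF this] obtain N :: nat and W where
    *: "\<forall>i<N. W i \<in> S" "\<forall>i<N. \<forall>l<N. A (W i) (W l) = (if i = l then 1 else 0)"
    "\<forall>v\<in>V. \<exists>c. (\<lambda>x. v x + (\<Sum>i<N. c i *\<^sub>R W i x)) \<in> S \<and>
      A (\<lambda>x. v x + (\<Sum>i<N. c i *\<^sub>R W i x)) (\<lambda>x. v x + (\<Sum>i<N. c i *\<^sub>R W i x)) = 0"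
    by (elim exE conjE)
  from *(1,2) have W: "\<And>i. i < N \<Longrightarrow> W i \<in> S"
      "\<And>i l. i < N \<Longrightarrow> l < N \<Longrightarrow> A (W i) (W l) = (if i = l then 1 else 0)" by blast+
  note V = bspec[OF *(3)]
  have v: "v \<in> S" using insert by simp
  have comb: "(\<lambda>x. v x + (\<Sum>i<n. c i *\<^sub>R W i x)) \<in> S" 
    "h \<in> S \<Longrightarrow> A (\<lambda>x. v x + (\<Sum>i<n. c i *\<^sub>R W i x)) h = A v h + (\<Sum>i<n. c i * A (W i) h)"
    if "n \<le> N" for n c h
    using that
  proof (induction n)
    case (Suc n)
    have eq: "(\<lambda>x. v x + (\<Sum>i<Suc n. c i *\<^sub>R W i x)) = (\<lambda>x. (v x + (\<Sum>i<n. c i *\<^sub>R W i x)) + c n *\<^sub>R W n x)"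
      by (simp add: add.assoc)
    { case 1 show ?case unfolding eq using 1 Suc.IH(1) W(1)[of n] by (intro S) auto }
    { case 2 show ?case unfolding eq using 2 Suc.IH W(1)[of n] by (subst lin) auto }
  qed (use v in auto)
  define c where "c i = - A v (W i)" for i
  define d where "d = (\<lambda>x. v x + (\<Sum>i<N. c i *\<^sub>R W i x))"
  have d: "d \<in> S" unfolding d_def by (rule comb) simp
  have orth: "A d (W l) = 0" if "l < N" for l
  proof -
    have "A d (W l) = A v (W l) + (\<Sum>i<N. c i * A (W i) (W l))"
      unfolding d_def by (rule comb(2)) (use W that in auto)
    also have "(\<Sum>i<N. c i * A (W i) (W l)) = (\<Sum>i<N. if i = l then c i else 0)"
      using W(2) that by (intro sum.cong) auto
    also have "\<dots> = c l" using that by simp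
    finally show ?thesis by (simp add: c_def)
  qed
  show ?case
  proof (cases "A d d = 0")
    case True
    have "\<exists>c. (\<lambda>x. w x + (\<Sum>i<N. c i *\<^sub>R W i x)) \<in> S \<and>
      A (\<lambda>x. w x + (\<Sum>i<N. c i *\<^sub>R W i x)) (\<lambda>x. w x + (\<Sum>i<N. c i *\<^sub>R W i x)) = 0" if "w \<in> insert v V" for w
    proof (cases "w = v")
      case True
      then show ?thesis using d \<open>A d d = 0\<close> unfolding d_def by blast
    qed (use that V in blast)
    then show ?thesis using W by blast
  next
    case False
    then have pos: "0 < A d d" using nonneg[OF d] by simp
    define s where "s = 1 / sqrt (A d d)"
    define e where "e = (\<lambda>x. d x + (s - 1) *\<^sub>R d x)"
    have e: "e \<in> S" unfolding e_def by (rule S[OF d d])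
    have Ae: "A e h = s * A d h" if "h \<in> S" for h
      unfolding e_def using lin[OF d d that, of "s - 1"] by (simp add: algebra_simps)
    have ee: "A e e = 1"
      using Ae[OF e] sym[OF d e] Ae[OF d] pos by (simp add: s_def)
    define W' where "W' i = (if i < N then W i else e)" for i
    have W'1: "W' i \<in> S" if "i < Suc N" for i using W(1) e by (simp add: W'_def)
    have W'2: "A (W' i) (W' l) = (if i = l then 1 else 0)" if "i < Suc N" "l < Suc N" for i l
    proof -
      have "A e (W l) = 0" "A (W l) e = 0" if "l < N" for l
        using Ae[OF W(1)[OF that]] orth[OF that] sym[OF W(1)[OF that] e] by auto
      then show ?thesis using that W(2) ee by (auto simp: W'_def less_Suc_eq)
    qed
    have V': "\<exists>c. (\<lambda>x. w x + (\<Sum>i<Suc N. c i *\<^sub>R W' i x)) \<in> S \<and>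
      A (\<lambda>x. w x + (\<Sum>i<Suc N. c i *\<^sub>R W' i x)) (\<lambda>x. w x + (\<Sum>i<Suc N. c i *\<^sub>R W' i x)) = 0" if "w \<in> insert v V" for w
    proof (cases "w = v")
      case True
      have "(\<lambda>x. w x + (\<Sum>i<Suc N. (if i < N then c i else - (1 / s)) *\<^sub>R W' i x)) = (\<lambda>x. d x + (- (1 / s)) *\<^sub>R e x)"
        by (simp add: d_def W'_def True add_diff_eq)
      also have "\<dots> = (\<lambda>x. d x + (-1) *\<^sub>R d x)"
      proof -
        have "e x = s *\<^sub>R d x" for x by (simp add: e_def algebra_simps)
        moreover have "s \<noteq> 0" using pos by (simp add: s_def)
        ultimately show ?thesis by simp
      qed
      finally have eq: "(\<lambda>x. w x + (\<Sum>i<Suc N. (if i < N then c i else - (1 / s)) *\<^sub>R W' i x)) = (\<lambda>x. d x + (-1) *\<^sub>R d x)" .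
      have "(\<lambda>x. d x + (-1) *\<^sub>R d x) \<in> S" by (rule S[OF d d])
      moreover from this have "A (\<lambda>x. d x + (-1) *\<^sub>R d x) (\<lambda>x. d x + (-1) *\<^sub>R d x) = 0"
        by (subst lin[OF d d]) auto
      ultimately show ?thesis unfolding eq[symmetric]
        by (intro exI[of _ "\<lambda>i. if i < N then c i else - (1 / s)"] conjI)
    next
      case False
      then obtain a where a: "(\<lambda>x. w x + (\<Sum>i<N. a i *\<^sub>R W i x)) \<in> S"
        "A (\<lambda>x. w x + (\<Sum>i<N. a i *\<^sub>R W i x)) (\<lambda>x. w x + (\<Sum>i<N. a i *\<^sub>R W i x)) = 0"
        using V[of w] \<open>w \<in> insert v V\<close> by blast
      have eq: "(\<lambda>x. w x + (\<Sum>i<Suc N. (if i < N then a i else 0) *\<^sub>R W' i x)) = (\<lambda>x. w x + (\<Sum>i<N. a i *\<^sub>R W i x))"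
        by (simp add: W'_def)
      show ?thesis using a unfolding eq[symmetric]
        by (intro exI[of _ "\<lambda>i. if i < N then a i else 0"] conjI)
    qed
    show ?thesis using W'1 W'2 V' by blast
  qed
qed

section \<open>The parametric problem on finitely many solutions\<close>

text \<open>The weak formulation will be tested with solutions at other parameters; this suffices because the
interpolation error is a linear combination of solutions.\<close>

locale elliptic_problem =
  fixes D :: "(real ^ 'k) set"
    and f abar :: "real ^ 'k \<Rightarrow> real"
    and \<psi> :: "nat \<Rightarrow> real ^ 'k \<Rightarrow> real"
    and u :: "(nat \<Rightarrow> real) \<Rightarrow> real ^ 'k \<Rightarrow> real"
    and \<rho> :: "nat \<Rightarrow> real" and r :: real
  assumes D: "open D" "bounded D"
    and abar: "abar \<in> Linf D" and \<psi>: "\<And>j. \<psi> j \<in> Linf D"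
    and u: "\<And>y. y \<in> U \<Longrightarrow> weak_solution D (affine_coeff abar \<psi> y) f (u y)"
    and r: "r > 0"
    and dom: "AE x in lebesgue_on D. summable (\<lambda>j. \<rho> j * \<bar>\<psi> j x\<bar>) \<and>
           (\<Sum>j. \<rho> j * \<bar>\<psi> j x\<bar>) \<le> abar x - r"
    and \<rho>: "\<And>j. \<rho> j > 1"
begin

abbreviation "M \<equiv> lebesgue_on D"

lemma lmeasurable_D: "D \<in> lmeasurable" using D by (intro lmeasurable_open)

definition weighted_inner :: "(real ^ 'k \<Rightarrow> real) \<Rightarrow> (real ^ 'k \<Rightarrow> real ^ 'k) \<Rightarrow> (real ^ 'k \<Rightarrow> real ^ 'k) \<Rightarrow> real" where
  "weighted_inner w g h = (LINT x|M. w x * (g x \<bullet> h x))"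

lemma inner_integrable:
  assumes "g \<in> L2_fields D" "h \<in> L2_fields D"
  shows "integrable M (\<lambda>x. g x \<bullet> h x)"
proof -
  have "integrable M (\<lambda>x. \<Sum>i\<in>UNIV. g x $ i * h x $ i)"
    using assms by (intro Bochner_Integration.integrable_sum L2_mult_integrable) (auto simp: L2_fields_def)
  then show ?thesis by (simp add: inner_vec_def)
qed

lemma weighted_inner_integrable:
  assumes w: "w \<in> Linf D" and g: "g \<in> L2_fields D" "h \<in> L2_fields D"
  shows "integrable M (\<lambda>x. w x * (g x \<bullet> h x))"
proof -
  obtain C where C: "AE x in M. \<bar>w x\<bar> \<le> C" and wm: "w \<in> borel_measurable M"
    using w by (auto simp: Linf_def)
  show ?thesis
  proof (rule Bochner_Integration.integrable_bound)
    show "integrable M (\<lambda>x. C * (g x \<bullet> h x))" using inner_integrable[OF g] by simp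
    show "(\<lambda>x. w x * (g x \<bullet> h x)) \<in> borel_measurable M"
      using wm inner_integrable[OF g] by (intro borel_measurable_times) auto
    show "AE x in M. norm (w x * (g x \<bullet> h x)) \<le> norm (C * (g x \<bullet> h x))"
      using C by eventually_elim (auto simp: abs_mult intro!: mult_right_mono)
  qed
qed

lemma weighted_inner_add_scaled:
  assumes "w \<in> Linf D" "g \<in> L2_fields D" "g' \<in> L2_fields D" "h \<in> L2_fields D"
  shows "weighted_inner w (\<lambda>x. g x + c *\<^sub>R g' x) h = weighted_inner w g h + c * weighted_inner w g' h"
proof -
  have "weighted_inner w (\<lambda>x. g x + c *\<^sub>R g' x) h = (LINT x|M. w x * (g x \<bullet> h x) + c * (w x * (g' x \<bullet> h x)))"
    by (simp add: weighted_inner_def inner_add_left algebra_simps)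
  then show ?thesis using weighted_inner_integrable[OF assms(1)] assms by (simp add: weighted_inner_def)
qed

lemma weighted_inner_commute: "weighted_inner w g h = weighted_inner w h g"
  by (simp add: weighted_inner_def inner_commute)

lemma weighted_inner_sum:
  assumes w: "w \<in> Linf D" and W: "\<And>i. i < N \<Longrightarrow> W i \<in> L2_fields D" and h: "h \<in> L2_fields D"
  shows "weighted_inner w (\<lambda>x. \<Sum>i<N. c i *\<^sub>R W i x) h = (\<Sum>i<(N::nat). c i * weighted_inner w (W i) h)"
  using W
proof (induction N)
  case (Suc N)
  have "(\<lambda>x. \<Sum>i<N. c i *\<^sub>R W i x) \<in> L2_fields D" using Suc.prems by (intro L2_fields_sum) auto
  then have "weighted_inner w (\<lambda>x. (\<Sum>i<N. c i *\<^sub>R W i x) + c N *\<^sub>R W N x) h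
     = weighted_inner w (\<lambda>x. \<Sum>i<N. c i *\<^sub>R W i x) h + c N * weighted_inner w (W N) h"
    using w h Suc.prems by (intro weighted_inner_add_scaled) auto
  then show ?case using Suc by simp
qed (simp add: weighted_inner_def)

lemma weighted_inner_cong_AE:
  assumes "w \<in> Linf D" "g \<in> L2_fields D" "g' \<in> L2_fields D" "h \<in> L2_fields D" "h' \<in> L2_fields D"
    and "AE x in M. g x = g' x" "AE x in M. h x = h' x"
  shows "weighted_inner w g h = weighted_inner w g' h'"
  unfolding weighted_inner_def
proof (rule integral_cong_AE)
  show "AE x in M. w x * (g x \<bullet> h x) = w x * (g' x \<bullet> h' x)"
    using assms(6,7) by eventually_elim simp
qed (rule borel_measurable_integrable[OF weighted_inner_integrable], fact+)+

lemma coefficient_bounds: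
  "AE x in M. r \<le> abar x \<and> summable (\<lambda>j. \<rho> j * \<bar>\<psi> j x\<bar>) \<and> (\<Sum>j. \<rho> j * \<bar>\<psi> j x\<bar>) \<le> abar x - r \<and>
    (\<forall>J. finite J \<longrightarrow> (\<Sum>j\<in>J. \<rho> j * \<bar>\<psi> j x\<bar>) \<le> abar x - r)"
  using dom
proof eventually_elim
  case (elim x)
  have nn: "0 \<le> \<rho> j * \<bar>\<psi> j x\<bar>" for j using \<rho>[of j] by simp
  have "(\<Sum>j\<in>J. \<rho> j * \<bar>\<psi> j x\<bar>) \<le> abar x - r" if "finite J" for J
  proof -
    have "(\<Sum>j\<in>J. \<rho> j * \<bar>\<psi> j x\<bar>) \<le> (\<Sum>j. \<rho> j * \<bar>\<psi> j x\<bar>)"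
      using elim nn that by (intro sum_le_suminf) auto
    then show ?thesis using elim by linarith
  qed
  moreover from this[of "{}"] have "r \<le> abar x" by simp
  ultimately show ?case using elim by blast
qed

lemma abar_ge: "AE x in M. r \<le> abar x"
  using coefficient_bounds by eventually_elim blast

lemma abar_nonneg: "g \<in> L2_fields D \<Longrightarrow> 0 \<le> weighted_inner abar g g"
  unfolding weighted_inner_def
proof (rule integral_nonneg_AE)
  show "AE x in M. 0 \<le> abar x * (g x \<bullet> g x)"
    using abar_ge by eventually_elim (use r in auto)
qed

lemma abar_coercive:
  assumes g: "g \<in> L2_fields D"
  shows "r * (LINT x|M. g x \<bullet> g x) \<le> weighted_inner abar g g"
proof -
  have "(LINT x|M. r * (g x \<bullet> g x)) \<le> weighted_inner abar g g"
    unfolding weighted_inner_def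
  proof (rule integral_mono_AE)
    show "AE x in M. r * (g x \<bullet> g x) \<le> abar x * (g x \<bullet> g x)"
      using abar_ge by eventually_elim (auto intro: mult_right_mono)
  qed (use inner_integrable[OF g g] weighted_inner_integrable[OF abar g g] in auto)
  then show ?thesis by simp
qed

lemma abar_definite:
  assumes g: "g \<in> L2_fields D" and 0: "weighted_inner abar g g = 0"
  shows "AE x in M. g x = 0"
proof -
  have "AE x in M. 0 \<le> abar x * (g x \<bullet> g x)"
    using abar_ge by eventually_elim (use r in auto)
  then have "AE x in M. abar x * (g x \<bullet> g x) = 0"
    using 0 integral_nonneg_eq_0_iff_AE[OF weighted_inner_integrable[OF abar g g]] by (simp add: weighted_inner_def)
  then show ?thesis using abar_ge by eventually_elim (use r in auto)
qed

text \<open>If \<open>K > 0\<close> is an essential upper bound of \<open>abar\<close>, the factor \<open>1 - r / K\<close> has the required property.\<close>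

lemma contraction_factor:
  obtains \<sigma> where "\<sigma> < 1" "AE x in M. abar x - r \<le> \<sigma> * abar x"
proof -
  obtain C where C: "AE x in M. \<bar>abar x\<bar> \<le> C" using abar by (auto simp: Linf_def)
  define K where "K = max C r"
  have K: "0 < K" using r by (simp add: K_def)
  have "AE x in M. abar x - r \<le> (1 - r / K) * abar x"
    using C
  proof eventually_elim
    case (elim x)
    then have "abar x \<le> K" by (simp add: K_def)
    then have "r * abar x \<le> r * K" using r by (intro mult_left_mono) auto
    then have "r / K * abar x \<le> r" using K by (simp add: field_simps)
    then show ?case by (simp add: left_diff_distrib)
  qed
  moreover have "1 - r / K < 1" using r K by simp
  ultimately show ?thesis by (rule that[rotated])
qed

definition weight_energy :: "nat \<Rightarrow> (real ^ 'k \<Rightarrow> real ^ 'k) \<Rightarrow> real" where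
  "weight_energy j g = \<rho> j * weighted_inner (\<lambda>x. \<bar>\<psi> j x\<bar>) g g"

lemma abs_Linf: "w \<in> Linf D \<Longrightarrow> (\<lambda>x. \<bar>w x\<bar>) \<in> Linf D"
  by (auto simp: Linf_def)

lemma weight_energy_sum:
  assumes \<sigma>: "AE x in M. abar x - r \<le> \<sigma> * abar x" and J: "finite J" and g: "g \<in> L2_fields D"
  shows "(\<Sum>j\<in>J. weight_energy j g) \<le> \<sigma> * weighted_inner abar g g"
proof -
  note int = weighted_inner_integrable[OF abs_Linf[OF \<psi>] g g]
  have "(\<Sum>j\<in>J. weight_energy j g) = (LINT x|M. (\<Sum>j\<in>J. \<rho> j * (\<bar>\<psi> j x\<bar> * (g x \<bullet> g x))))"
    using int by (simp add: weight_energy_def weighted_inner_def)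
  also have "\<dots> \<le> (LINT x|M. \<sigma> * (abar x * (g x \<bullet> g x)))"
  proof (rule integral_mono_AE)
    show "integrable M (\<lambda>x. \<Sum>j\<in>J. \<rho> j * (\<bar>\<psi> j x\<bar> * (g x \<bullet> g x)))" using int by simp
    show "integrable M (\<lambda>x. \<sigma> * (abar x * (g x \<bullet> g x)))" using weighted_inner_integrable[OF abar g g] by simp
    show "AE x in M. (\<Sum>j\<in>J. \<rho> j * (\<bar>\<psi> j x\<bar> * (g x \<bullet> g x))) \<le> \<sigma> * (abar x * (g x \<bullet> g x))"
      using coefficient_bounds \<sigma>
    proof eventually_elim
      case (elim x)
      have "(\<Sum>j\<in>J. \<rho> j * (\<bar>\<psi> j x\<bar> * (g x \<bullet> g x))) = (\<Sum>j\<in>J. \<rho> j * \<bar>\<psi> j x\<bar>) * (g x \<bullet> g x)"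
        by (simp add: sum_distrib_right mult.assoc)
      also have "\<dots> \<le> (\<sigma> * abar x) * (g x \<bullet> g x)"
        using elim J by (intro mult_right_mono) (auto intro: order.trans)
      finally show ?case by (simp add: mult.assoc)
    qed
  qed
  finally show ?thesis by (simp add: weighted_inner_def)
qed

lemma weight_energy_bound:
  assumes g: "g \<in> L2_fields D" "h \<in> L2_fields D"
  shows "2 * \<rho> j * \<bar>weighted_inner (\<psi> j) g h\<bar> \<le> weight_energy j g + weight_energy j h"
proof -
  note int = weighted_inner_integrable[OF abs_Linf[OF \<psi>, of j]]
  have "2 * \<bar>weighted_inner (\<psi> j) g h\<bar> \<le> 2 * (LINT x|M. \<bar>\<psi> j x * (g x \<bullet> h x)\<bar>)"
    unfolding weighted_inner_def by (intro mult_left_mono integral_abs_bound) auto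
  also have "\<dots> = (LINT x|M. 2 * \<bar>\<psi> j x * (g x \<bullet> h x)\<bar>)" by simp
  also have "\<dots> \<le> (LINT x|M. \<bar>\<psi> j x\<bar> * (g x \<bullet> g x) + \<bar>\<psi> j x\<bar> * (h x \<bullet> h x))"
  proof (rule integral_mono)
    show "integrable M (\<lambda>x. 2 * \<bar>\<psi> j x * (g x \<bullet> h x)\<bar>)"
      using weighted_inner_integrable[OF \<psi> g] by simp
    show "integrable M (\<lambda>x. \<bar>\<psi> j x\<bar> * (g x \<bullet> g x) + \<bar>\<psi> j x\<bar> * (h x \<bullet> h x))"
      using int g by simp
    fix x
    have "2 * \<bar>g x \<bullet> h x\<bar> \<le> 2 * norm (g x) * norm (h x)"
      using Cauchy_Schwarz_ineq2[of "g x" "h x"] by simp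
    also have "\<dots> \<le> (norm (g x))\<^sup>2 + (norm (h x))\<^sup>2" by (rule sum_squares_bound)
    finally have "2 * \<bar>g x \<bullet> h x\<bar> \<le> g x \<bullet> g x + h x \<bullet> h x" by (simp add: power2_norm_eq_inner)
    then have "\<bar>\<psi> j x\<bar> * (2 * \<bar>g x \<bullet> h x\<bar>) \<le> \<bar>\<psi> j x\<bar> * (g x \<bullet> g x + h x \<bullet> h x)"
      by (intro mult_left_mono) auto
    then show "2 * \<bar>\<psi> j x * (g x \<bullet> h x)\<bar> \<le> \<bar>\<psi> j x\<bar> * (g x \<bullet> g x) + \<bar>\<psi> j x\<bar> * (h x \<bullet> h x)"
      by (simp add: abs_mult algebra_simps)
  qed
  also have "\<dots> = weighted_inner (\<lambda>x. \<bar>\<psi> j x\<bar>) g g + weighted_inner (\<lambda>x. \<bar>\<psi> j x\<bar>) h h"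
    using int g by (simp add: weighted_inner_def)
  finally have "\<rho> j * (2 * \<bar>weighted_inner (\<psi> j) g h\<bar>) \<le> \<rho> j * (weighted_inner (\<lambda>x. \<bar>\<psi> j x\<bar>) g g + weighted_inner (\<lambda>x. \<bar>\<psi> j x\<bar>) h h)"
    using \<rho>[of j] by (intro mult_left_mono) auto
  then show ?thesis by (simp add: weight_energy_def algebra_simps)
qed

text \<open>The series \<open>\<Sum>\<^sub>j \<bar>\<psi>\<^sub>j\<bar>\<close> need not converge in the supremum norm. Its partial sums are dominated pointwise by
\<open>abar\<close>, which suffices for the integrals against fixed fields.\<close>

lemma affine_weighted_inner_sums:
  assumes y: "y \<in> U" and g: "g \<in> L2_fields D" "h \<in> L2_fields D"
  shows "(\<lambda>j. y j * weighted_inner (\<psi> j) g h) sums (weighted_inner (affine_coeff abar \<psi> y) g h - weighted_inner abar g h)"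
proof -
  let ?f = "\<lambda>j x. y j * (\<psi> j x * (g x \<bullet> h x))"
  note int = weighted_inner_integrable[OF \<psi> g]
  have dominated: "\<bar>y j * \<psi> j x\<bar> \<le> \<rho> j * \<bar>\<psi> j x\<bar>" for j x
    using y \<rho>[of j] unfolding abs_mult by (intro mult_right_mono) (auto simp: U_def abs_le_iff intro: order.trans[of _ 1])
  have 1: "AE x in M. summable (\<lambda>j. norm (?f j x))"
    using coefficient_bounds
  proof eventually_elim
    case (elim x)
    have "summable (\<lambda>j. \<rho> j * \<bar>\<psi> j x\<bar> * \<bar>g x \<bullet> h x\<bar>)" by (intro summable_mult2) (use elim in blast)
    then show ?case
    proof (rule summable_comparison_test'[where N = 0])
      show "norm (norm (?f j x)) \<le> \<rho> j * \<bar>\<psi> j x\<bar> * \<bar>g x \<bullet> h x\<bar>" for j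
        using mult_right_mono[OF dominated[of j x], of "\<bar>g x \<bullet> h x\<bar>"] by (simp add: abs_mult mult.assoc)
    qed
  qed
  have 2: "summable (\<lambda>j. LINT x|M. norm (?f j x))"
  proof (rule summableI_nonneg_bounded)
    fix n
    have "(\<Sum>j<n. (LINT x|M. norm (?f j x))) = (LINT x|M. (\<Sum>j<n. norm (?f j x)))"
      using int by (intro Bochner_Integration.integral_sum[symmetric]) auto
    also have "\<dots> \<le> (LINT x|M. \<bar>abar x * (g x \<bullet> h x)\<bar>)"
    proof (rule integral_mono_AE)
      show "AE x in M. (\<Sum>j<n. norm (?f j x)) \<le> \<bar>abar x * (g x \<bullet> h x)\<bar>"
        using coefficient_bounds
      proof eventually_elim
        case (elim x)
        have "(\<Sum>j<n. norm (?f j x)) \<le> (\<Sum>j<n. \<rho> j * \<bar>\<psi> j x\<bar> * \<bar>g x \<bullet> h x\<bar>)"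
        proof (rule sum_mono)
          show "norm (?f j x) \<le> \<rho> j * \<bar>\<psi> j x\<bar> * \<bar>g x \<bullet> h x\<bar>" for j
            using mult_right_mono[OF dominated[of j x], of "\<bar>g x \<bullet> h x\<bar>"] by (simp add: abs_mult mult.assoc)
        qed
        also have "\<dots> = (\<Sum>j<n. \<rho> j * \<bar>\<psi> j x\<bar>) * \<bar>g x \<bullet> h x\<bar>" by (simp add: sum_distrib_right)
        also have "\<dots> \<le> \<bar>abar x\<bar> * \<bar>g x \<bullet> h x\<bar>"
        proof (rule mult_right_mono)
          have "(\<Sum>j<n. \<rho> j * \<bar>\<psi> j x\<bar>) \<le> abar x - r" using elim by blast
          then show "(\<Sum>j<n. \<rho> j * \<bar>\<psi> j x\<bar>) \<le> \<bar>abar x\<bar>" using r by linarith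
        qed simp
        finally show ?case by (simp add: abs_mult)
      qed
    qed (use int weighted_inner_integrable[OF abar g] in auto)
    finally show "(\<Sum>j<n. (LINT x|M. norm (?f j x))) \<le> (LINT x|M. \<bar>abar x * (g x \<bullet> h x)\<bar>)" .
  qed simp
  have fint: "integrable M (?f j)" for j using int by simp
  have sums: "(\<lambda>j. integral\<^sup>L M (?f j)) sums (LINT x|M. (\<Sum>j. ?f j x))"
    by (rule sums_integral[OF fint 1 2])
  have sint: "integrable M (\<lambda>x. \<Sum>j. ?f j x)"
    by (rule integrable_suminf[OF fint 1 2])
  have "weighted_inner (affine_coeff abar \<psi> y) g h = (LINT x|M. abar x * (g x \<bullet> h x) + (\<Sum>j. ?f j x))"
    unfolding weighted_inner_def
  proof (rule integral_cong_AE)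
    show eq: "AE x in M. affine_coeff abar \<psi> y x * (g x \<bullet> h x) = abar x * (g x \<bullet> h x) + (\<Sum>j. ?f j x)"
      using coefficient_bounds
    proof eventually_elim
      case (elim x)
      then have "summable (\<lambda>j. \<rho> j * \<bar>\<psi> j x\<bar>)" by blast
      then have "summable (\<lambda>j. y j * \<psi> j x)"
        by (rule summable_comparison_test'[where N = 0]) (use dominated in simp)
      from suminf_mult2[OF this, of "g x \<bullet> h x"]
      show ?case by (simp add: affine_coeff_def distrib_right mult.assoc)
    qed
    have "\<psi> j \<in> borel_measurable M" "abar \<in> borel_measurable M" for j
      using \<psi>[of j] abar by (simp_all add: Linf_def)
    then have "affine_coeff abar \<psi> y \<in> borel_measurable M"
      unfolding affine_coeff_def[abs_def]
      by (intro borel_measurable_add borel_measurable_suminf borel_measurable_times) auto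
    then show "(\<lambda>x. affine_coeff abar \<psi> y x * (g x \<bullet> h x)) \<in> borel_measurable M"
      using inner_integrable[OF g] by (intro borel_measurable_times) auto
  qed (use sint weighted_inner_integrable[OF abar g] in auto)
  also have "\<dots> = weighted_inner abar g h + (LINT x|M. (\<Sum>j. ?f j x))"
    using sint weighted_inner_integrable[OF abar g] by (simp add: weighted_inner_def)
  finally have "(LINT x|M. (\<Sum>j. ?f j x)) = weighted_inner (affine_coeff abar \<psi> y) g h - weighted_inner abar g h" by simp
  moreover have "integral\<^sup>L M (?f j) = y j * weighted_inner (\<psi> j) g h" for j by (simp add: weighted_inner_def)
  ultimately show ?thesis using sums by (simp only:)
qed

definition grad_u :: "(nat \<Rightarrow> real) \<Rightarrow> real ^ 'k \<Rightarrow> real ^ 'k" where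
  "grad_u y = grad D (u y)"

abbreviation "origin \<equiv> \<lambda>_::nat. 0::real"

lemma origin_U: "origin \<in> U" by (simp add: U_def)

lemma u_H1: "y \<in> U \<Longrightarrow> u y \<in> H1 D"
  using u[of y] by (simp add: weak_solution_def H10_def)

lemma grad_u_L2: "y \<in> U \<Longrightarrow> grad_u y \<in> L2_fields D"
  unfolding grad_u_def by (rule grad_weak_gradient(1)[OF u_H1])

lemma grad_u_equation:
  assumes "y \<in> U" "z \<in> U"
  shows "weighted_inner (affine_coeff abar \<psi> y) (grad_u y) (grad_u z) = weighted_inner abar (grad_u origin) (grad_u z)"
proof -
  have z: "u z \<in> H10 D" using u[OF assms(2)] by (simp add: weak_solution_def)
  have "weighted_inner (affine_coeff abar \<psi> y) (grad_u y) (grad_u z) = (LINT x|M. f x * u z x)"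
    using u[OF assms(1)] z by (simp add: weak_solution_def weighted_inner_def grad_u_def)
  also have "\<dots> = weighted_inner (affine_coeff abar \<psi> origin) (grad_u origin) (grad_u z)"
    using u[OF origin_U] z by (simp add: weak_solution_def weighted_inner_def grad_u_def)
  also have "affine_coeff abar \<psi> origin = abar" by (simp add: affine_coeff_def fun_eq_iff)
  finally show ?thesis .
qed

text \<open>The fields against which the weak equations of all parameters hold. The load is represented by the
energy product with the solution at the origin, so that membership depends on gradients only and is
inherited by linear combinations.\<close>

definition residual_free :: "(real ^ 'k \<Rightarrow> real ^ 'k) set" where
  "residual_free = {h \<in> L2_fields D. \<forall>y\<in>U. (\<lambda>j. y j * weighted_inner (\<psi> j) (grad_u y) h) sums
     (weighted_inner abar (grad_u origin) h - weighted_inner abar (grad_u y) h)}"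

lemma grad_u_residual_free: "z \<in> U \<Longrightarrow> grad_u z \<in> residual_free"
  unfolding residual_free_def
proof (intro CollectI conjI ballI)
  assume z: "z \<in> U"
  show "grad_u z \<in> L2_fields D" by (rule grad_u_L2[OF z])
  fix y assume y: "y \<in> U"
  show "(\<lambda>j. y j * weighted_inner (\<psi> j) (grad_u y) (grad_u z)) sums
     (weighted_inner abar (grad_u origin) (grad_u z) - weighted_inner abar (grad_u y) (grad_u z))"
    using affine_weighted_inner_sums[OF y grad_u_L2[OF y] grad_u_L2[OF z]] by (simp only: grad_u_equation[OF y z])
qed

lemma residual_free_add_scaled:
  assumes "g \<in> residual_free" "h \<in> residual_free"
  shows "(\<lambda>x. g x + c *\<^sub>R h x) \<in> residual_free"
proof -
  have L: "g \<in> L2_fields D" "h \<in> L2_fields D" using assms by (auto simp: residual_free_def)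
  have eq: "weighted_inner w k (\<lambda>x. g x + c *\<^sub>R h x) = weighted_inner w k g + c * weighted_inner w k h"
    if "w \<in> Linf D" "k \<in> L2_fields D" for w k
    using weighted_inner_add_scaled[OF that(1) L that(2)] by (simp add: weighted_inner_commute)
  have "(\<lambda>j. y j * weighted_inner (\<psi> j) (grad_u y) (\<lambda>x. g x + c *\<^sub>R h x)) sums
     (weighted_inner abar (grad_u origin) (\<lambda>x. g x + c *\<^sub>R h x) - weighted_inner abar (grad_u y) (\<lambda>x. g x + c *\<^sub>R h x))" if y: "y \<in> U" for y
  proof -
    have s: "(\<lambda>j. y j * weighted_inner (\<psi> j) (grad_u y) g) sums (weighted_inner abar (grad_u origin) g - weighted_inner abar (grad_u y) g)"
        "(\<lambda>j. y j * weighted_inner (\<psi> j) (grad_u y) h) sums (weighted_inner abar (grad_u origin) h - weighted_inner abar (grad_u y) h)"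
      using assms y by (auto simp: residual_free_def)
    show ?thesis
      using sums_add[OF s(1) sums_mult[OF s(2), of c]]
      by (simp add: eq \<psi> abar grad_u_L2 y origin_U algebra_simps)
  qed
  then show ?thesis using L2_fields_add_scaled[OF L] by (simp add: residual_free_def)
qed

text \<open>The basis consists of combinations of the gradients themselves. Hence its elements may be used as test
fields, and the coordinates of the solutions at the parameters in \<open>Z\<close> satisfy the finite system exactly.\<close>

lemma galerkin_basis:
  assumes "finite Z" "Z \<subseteq> U"
  obtains N :: nat and W x where "\<And>i. i < N \<Longrightarrow> W i \<in> residual_free"
    "\<And>i l. i < N \<Longrightarrow> l < N \<Longrightarrow> weighted_inner abar (W i) (W l) = (if i = l then 1 else 0)"
    "\<And>z. z \<in> Z \<Longrightarrow> AE t in M. grad_u z t = (\<Sum>i<N. x z i *\<^sub>R W i t)"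
proof -
  have L: "residual_free \<subseteq> L2_fields D" by (auto simp: residual_free_def)
  have "\<exists>N::nat. \<exists>W. (\<forall>i<N. W i \<in> residual_free) \<and>
    (\<forall>i<N. \<forall>l<N. weighted_inner abar (W i) (W l) = (if i = l then 1 else 0)) \<and>
    (\<forall>v\<in>grad_u ` Z. \<exists>c. (\<lambda>t. v t + (\<Sum>i<N. c i *\<^sub>R W i t)) \<in> residual_free \<and>
      weighted_inner abar (\<lambda>t. v t + (\<Sum>i<N. c i *\<^sub>R W i t)) (\<lambda>t. v t + (\<Sum>i<N. c i *\<^sub>R W i t)) = 0)"
  proof (rule gram_schmidt)
    show "finite (grad_u ` Z)" "grad_u ` Z \<subseteq> residual_free" using assms grad_u_residual_free by auto
    show "weighted_inner abar (\<lambda>x. f x + c *\<^sub>R g x) h = weighted_inner abar f h + c * weighted_inner abar g h"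
      if "f \<in> residual_free" "g \<in> residual_free" "h \<in> residual_free" for f g h c
      using that L by (intro weighted_inner_add_scaled abar) auto
    show "0 \<le> weighted_inner abar f f" if "f \<in> residual_free" for f
      using that L abar_nonneg by blast
  qed (auto intro: residual_free_add_scaled simp: weighted_inner_commute)
  then obtain N :: nat and W where W: "\<forall>i<N. W i \<in> residual_free"
    "\<forall>i<N. \<forall>l<N. weighted_inner abar (W i) (W l) = (if i = l then 1 else 0)"
    and V: "\<forall>v\<in>grad_u ` Z. \<exists>c. (\<lambda>t. v t + (\<Sum>i<N. c i *\<^sub>R W i t)) \<in> residual_free \<and>
      weighted_inner abar (\<lambda>t. v t + (\<Sum>i<N. c i *\<^sub>R W i t)) (\<lambda>t. v t + (\<Sum>i<N. c i *\<^sub>R W i t)) = 0"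
    by (elim exE conjE)
  have "\<exists>x. AE t in M. grad_u z t = (\<Sum>i<N. x i *\<^sub>R W i t)" if z: "z \<in> Z" for z
  proof -
    obtain c where c: "(\<lambda>t. grad_u z t + (\<Sum>i<N. c i *\<^sub>R W i t)) \<in> residual_free"
      "weighted_inner abar (\<lambda>t. grad_u z t + (\<Sum>i<N. c i *\<^sub>R W i t)) (\<lambda>t. grad_u z t + (\<Sum>i<N. c i *\<^sub>R W i t)) = 0"
      using V z by blast
    have "AE t in M. grad_u z t + (\<Sum>i<N. c i *\<^sub>R W i t) = 0"
      using c L by (intro abar_definite) auto
    then have "AE t in M. grad_u z t = (\<Sum>i<N. - c i *\<^sub>R W i t)"
      by eventually_elim (simp add: sum_negf eq_neg_iff_add_eq_0)
    then show ?thesis by (rule exI[of _ "\<lambda>i. - c i"])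
  qed
  then have "\<forall>z\<in>Z. \<exists>x. AE t in M. grad_u z t = (\<Sum>i<N. x i *\<^sub>R W i t)" by blast
  from bchoice[OF this] obtain x where
    x: "\<forall>z\<in>Z. AE t in M. grad_u z t = (\<Sum>i<N. x z i *\<^sub>R W i t)" by (elim exE)
  show ?thesis
    by (rule that[of N W x], use W(1) in blast, use W(2) in blast, rule bspec[OF x])
qed

text \<open>The vector \<open>\<delta>\<close> of coordinates of the error is controlled by \<open>interpolation_error\<close>; its length is the
energy norm of the error, which bounds the norm of \<open>V\<close> up to \<open>sqrt (1 / r)\<close>. The right-hand side contains neither
the dimension of the Galerkin space nor \<open>y\<close>.\<close>

lemma interpolation_estimate:
  assumes t: "\<And>k. t k \<in> {-1..1}" "inj t" and \<theta>: "\<theta> \<ge> 1"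
    and L: "(\<forall>k. sup_op_norm (interp t k) \<le> (1 + real k) powr \<theta>) \<or>
         (\<forall>k. sup_op_norm (interp_diff t k) \<le> (1 + real k) powr \<theta>)"
    and \<Lambda>: "downward_closed \<Lambda>" "finite \<Lambda>" and y: "y \<in> U"
    and \<sigma>: "\<sigma> < 1" "AE x in M. abar x - r \<le> \<sigma> * abar x"
    and sq: "\<exists>S. \<forall>G. finite G \<longrightarrow> G \<subseteq> multi_indices \<longrightarrow>
      (\<Sum>\<nu>\<in>G. (mpow (\<lambda>j. inverse (\<rho> j)) \<nu>)\<^sup>2) \<le> S"
    and R: "\<And>G. finite G \<Longrightarrow> G \<subseteq> multi_indices - \<Lambda> \<Longrightarrow>
      (\<Sum>\<nu>\<in>G. (2 * pi_weight \<theta> \<nu> * mpow (\<lambda>j. inverse (\<rho> j)) \<nu>)\<^sup>2) \<le> R\<^sup>2" "0 \<le> R"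
  shows "V_norm D (\<lambda>x. u y x - interp_op t \<Lambda> u y x)
    \<le> sqrt (1 / r) * (sqrt (weighted_inner abar (grad_u origin) (grad_u origin) / (1 - \<sigma>)) * R)"
proof -
  have "finite_point_functional (\<lambda>g. \<Sum>\<nu>\<in>\<Lambda>. tensor_diff t \<nu> g y)"
    by (rule interp_sum_finite_point_functional[OF t y \<Lambda>(2)])
  then obtain Z c where Z: "finite Z" "Z \<subseteq> U"
    and c: "\<And>g. (\<Sum>\<nu>\<in>\<Lambda>. tensor_diff t \<nu> g y) = (\<Sum>z\<in>Z. c z * g z)"
    unfolding finite_point_functional_def by blast
  let ?Z = "insert origin (insert y Z)"
  have Z': "finite ?Z" "?Z \<subseteq> U" using Z y origin_U by auto
  obtain N :: nat and W x where W: "\<And>i. i < N \<Longrightarrow> W i \<in> residual_free"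
    and orth: "\<And>i l. i < N \<Longrightarrow> l < N \<Longrightarrow> weighted_inner abar (W i) (W l) = (if i = l then 1 else 0)"
    and x: "\<And>z. z \<in> ?Z \<Longrightarrow> AE s in M. grad_u z s = (\<Sum>i<N. x z i *\<^sub>R W i s)"
    by (rule galerkin_basis[OF Z']) blast
  define T where "T c = (\<lambda>s. \<Sum>i<N. c i *\<^sub>R W i s)" for c
  have WL: "W i \<in> L2_fields D" if "i < N" for i using W[OF that] by (simp add: residual_free_def)
  have TL: "T c \<in> L2_fields D" for c unfolding T_def using WL by (intro L2_fields_sum) auto
  have T1: "weighted_inner w (T c) h = (\<Sum>i<N. c i * weighted_inner w (W i) h)"
    if "w \<in> Linf D" "h \<in> L2_fields D" for w c h
    unfolding T_def by (rule weighted_inner_sum[OF that(1) WL that(2)])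
  have T2: "weighted_inner w (T c) (T d) = (\<Sum>l<N. \<Sum>i<N. weighted_inner w (W i) (W l) * c i * d l)" if "w \<in> Linf D" for w c d
  proof -
    have "weighted_inner w (T c) (T d) = weighted_inner w (T d) (T c)" by (rule weighted_inner_commute)
    also have "\<dots> = (\<Sum>l<N. d l * weighted_inner w (W l) (T c))" by (rule T1[OF that TL])
    also have "\<dots> = (\<Sum>l<N. d l * (\<Sum>i<N. c i * weighted_inner w (W i) (W l)))"
      using T1[OF that WL] by (intro sum.cong refl) (simp add: weighted_inner_commute[of w _ "T c"])
    finally show ?thesis by (simp add: sum_distrib_left mult_ac)
  qed
  have Tabar: "weighted_inner abar (T c) (W l) = c l" if "l < N" for c l
  proof -
    have "weighted_inner abar (T c) (W l) = (\<Sum>i<N. if i = l then c i else 0)"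
      unfolding T1[OF abar WL[OF that]] using orth that by (intro sum.cong) auto
    then show ?thesis using that by simp
  qed
  have Tnorm: "weighted_inner abar (T c) (T c) = (\<Sum>i<N. (c i)\<^sup>2)" for c
  proof -
    have "weighted_inner abar (T c) (T c) = (\<Sum>i<N. c i * weighted_inner abar (W i) (T c))" by (rule T1[OF abar TL])
    also have "\<dots> = (\<Sum>i<N. (c i)\<^sup>2)"
      using Tabar by (intro sum.cong) (auto simp: weighted_inner_commute[of abar _ "T c"] power2_eq_square)
    finally show ?thesis .
  qed
  define B where "B j l i = weighted_inner (\<psi> j) (W i) (W l)" for j l i
  define F where "F l = weighted_inner abar (grad_u origin) (W l)" for l
  have gT: "weighted_inner w (grad_u z) h = weighted_inner w (T (x z)) h" if "w \<in> Linf D" "z \<in> ?Z" "h \<in> L2_fields D" for w z h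
    using that x[OF that(2)] Z'(2) by (intro weighted_inner_cong_AE grad_u_L2 TL) (auto simp: T_def)
  interpret affine_system N B F \<rho> "\<lambda>j c. weight_energy j (T c)" \<sigma>
  proof
    show "(\<Sum>j\<in>J. weight_energy j (T c)) \<le> \<sigma> * (\<Sum>i<N. (c i)\<^sup>2)" if "finite J" for J c
      using weight_energy_sum[OF \<sigma>(2) that TL] by (simp add: Tnorm)
    show "2 * \<rho> j * \<bar>\<Sum>l<N. \<Sum>i<N. B j l i * c i * d l\<bar> \<le> weight_energy j (T c) + weight_energy j (T d)" for j c d
      using weight_energy_bound[OF TL TL, of j c d] by (simp add: T2[OF \<psi>] B_def)
  qed (use \<rho> \<sigma> in auto)
  have system: "(\<lambda>j. z j * (\<Sum>i<N. B j l i * x z i)) sums (F l - x z l)" if z: "z \<in> ?Z" and l: "l < N" for z l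
  proof -
    have "z \<in> U" using z Z'(2) by blast
    then have "(\<lambda>j. z j * weighted_inner (\<psi> j) (grad_u z) (W l)) sums (F l - weighted_inner abar (grad_u z) (W l))"
      using W[OF l] by (simp add: residual_free_def F_def)
    moreover have "weighted_inner (\<psi> j) (grad_u z) (W l) = (\<Sum>i<N. B j l i * x z i)" for j
      unfolding gT[OF \<psi> z WL[OF l]] T1[OF \<psi> WL[OF l]] B_def by (simp add: mult.commute)
    moreover have "weighted_inner abar (grad_u z) (W l) = x z l"
      unfolding gT[OF abar z WL[OF l]] by (rule Tabar[OF l])
    ultimately show ?thesis by simp
  qed
  have F: "(\<Sum>i<N. (F i)\<^sup>2) = weighted_inner abar (grad_u origin) (grad_u origin)"
  proof -
    have o: "origin \<in> ?Z" by simp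
    have "(\<Sum>i<N. (F i)\<^sup>2) = (\<Sum>i<N. (x origin i)\<^sup>2)"
      using Tabar gT[OF abar o WL] by (intro sum.cong) (auto simp: F_def)
    also have "\<dots> = weighted_inner abar (T (x origin)) (T (x origin))" by (rule Tnorm[symmetric])
    also have "\<dots> = weighted_inner abar (grad_u origin) (grad_u origin)"
      using x[OF o] by (intro weighted_inner_cong_AE abar TL grad_u_L2 origin_U) (auto simp: T_def)
    finally show ?thesis .
  qed
  define \<delta> where "\<delta> i = x y i - (\<Sum>z\<in>Z. c z * x z i)" for i
  have "vnorm N \<delta> \<le> sqrt ((\<Sum>i<N. (F i)\<^sup>2) / (1 - \<sigma>)) * R"
    unfolding \<delta>_def
  proof (rule interpolation_error[OF sq _ Z y])
    show "(\<lambda>j. z j * (\<Sum>i<N. B j l i * x z i)) sums (F l - x z l)" if "z \<in> insert y Z" "l < N" for z l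
      using that by (intro system) auto
    show "(\<Sum>z\<in>Z. c z * mpow z \<nu>) = mpow y \<nu>" if "\<nu> \<in> \<Lambda>" for \<nu>
    proof -
      have "\<nu> \<in> multi_indices" using that \<Lambda>(1) by (auto simp: downward_closed_def)
      from interp_monomial(1)[OF t \<theta> L \<Lambda> this y that] show ?thesis by (simp add: c)
    qed
    show "\<bar>mpow y \<nu> - (\<Sum>z\<in>Z. c z * mpow z \<nu>)\<bar> \<le> 2 * pi_weight \<theta> \<nu>" if "\<nu> \<in> multi_indices" for \<nu>
      using interp_monomial(2)[OF t \<theta> L \<Lambda> that y] by (simp add: c)
    show "0 \<le> 2 * pi_weight \<theta> \<nu>" for \<nu> using pi_weight_ge_1[of \<theta> \<nu>] \<theta> by simp
  qed (use R in auto)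
  moreover have "V_norm D (\<lambda>s. u y s - interp_op t \<Lambda> u y s) \<le> sqrt (1 / r) * vnorm N \<delta>"
  proof -
    have eq: "(\<lambda>s. u y s - interp_op t \<Lambda> u y s) = (\<lambda>s. u y s + (\<Sum>z\<in>Z. - c z * u z s))"
      by (simp add: interp_op_def c sum_negf)
    let ?g = "\<lambda>s. grad_u y s + (\<Sum>z\<in>Z. - c z *\<^sub>R grad_u z s)"
    have props: "u z \<in> L2 D" "grad_u z \<in> L2_fields D" "has_weak_gradient D (u z) (grad_u z)" if "z \<in> U" for z
      using u_H1[OF that] grad_weak_gradient[OF u_H1[OF that]] by (simp_all add: grad_u_def H1_def)
    have wg: "?g \<in> L2_fields D" "has_weak_gradient D (\<lambda>s. u y s + (\<Sum>z\<in>Z. - c z * u z s)) ?g"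
      using L2_has_weak_gradient_sum[OF lmeasurable_D Z(1) props[OF y], of u grad_u "\<lambda>z. - c z"] props Z(2) by auto
    have "AE s in M. \<forall>z\<in>?Z. grad_u z s = T (x z) s"
      using x by (intro AE_finite_allI Z'(1)) (auto simp: T_def)
    then have "AE s in M. ?g s = T \<delta> s"
    proof eventually_elim
      case (elim s)
      have "(\<Sum>z\<in>Z. - c z *\<^sub>R grad_u z s) = - (\<Sum>i<N. (\<Sum>z\<in>Z. c z * x z i) *\<^sub>R W i s)"
        using elim by (simp add: T_def scaleR_sum_right scaleR_sum_left sum_negf sum.swap[of _ "{..<N}" Z])
      then show ?case using elim by (simp add: T_def \<delta>_def scaleR_diff_left sum_subtractf)
    qed
    then have "V_norm D (\<lambda>s. u y s - interp_op t \<Lambda> u y s) = sqrt (LINT s|M. T \<delta> s \<bullet> T \<delta> s)"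
      unfolding eq by (rule V_norm_weak_gradient[OF D wg TL])
    also have "\<dots> \<le> sqrt (1 / r * (vnorm N \<delta>)\<^sup>2)"
      using abar_coercive[OF TL, of \<delta>] r unfolding Tnorm vnorm_sq by (simp add: field_simps)
    also have "\<dots> = sqrt (1 / r) * vnorm N \<delta>" by (subst real_sqrt_mult) simp
    finally show ?thesis .
  qed
  ultimately show ?thesis
    using r unfolding F by (meson mult_left_mono order.trans real_sqrt_ge_zero less_imp_le divide_nonneg_pos zero_le_one)
qed

end

section \<open>The convergence rate\<close>

lemma mpow_square_summable:
  fixes b :: "nat \<Rightarrow> real"
  assumes b: "\<And>j. 0 < b j" "\<And>j. b j < 1" "summable (\<lambda>j. b j powr q)" and q: "q < 2"
  shows "\<exists>S. \<forall>G. finite G \<longrightarrow> G \<subseteq> multi_indices \<longrightarrow> (\<Sum>\<nu>\<in>G. (mpow b \<nu>)\<^sup>2) \<le> S"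
proof -
  define x where "x j = (b j)\<^sup>2" for j
  have x: "0 \<le> x j" "x j < 1" for j
    using b(1)[of j] b(2)[of j] by (auto simp: x_def power_less_one_iff)
  have sx: "summable x"
  proof (rule summable_comparison_test'[OF b(3), of 0])
    fix j
    have "x j = b j powr 2" using b(1)[of j] by (simp add: x_def powr_numeral)
    also have "\<dots> \<le> b j powr q" using b(1)[of j] b(2)[of j] q by (intro powr_mono') auto
    finally show "norm (x j) \<le> b j powr q" using x(1)[of j] by simp
  qed
  obtain X where X: "X < 1" "\<And>j. x j \<le> X"
    by (rule tendsto_0_uniform_less_1[OF summable_LIMSEQ_zero[OF sx] x(2)]) blast
  have "(mpow b \<nu>)\<^sup>2 = (\<Prod>j\<in>supp \<nu>. 1 * x j ^ \<nu> j)" for \<nu>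
    by (simp add: mpow_def x_def prod_power_distrib power_mult[symmetric] mult.commute)
  then show ?thesis
    using sum_prod_powers_bounded[OF x(1) X(2,1) sx, of 1] by (intro exI allI impI) simp
qed

theorem theorem3p3:
  fixes D :: "(real ^ 'k) set"
    and f abar :: "real ^ 'k \<Rightarrow> real"
    and \<psi> :: "nat \<Rightarrow> real ^ 'k \<Rightarrow> real"
    and u :: "(nat \<Rightarrow> real) \<Rightarrow> real ^ 'k \<Rightarrow> real"
    and t \<rho> :: "nat \<Rightarrow> real"
    and \<theta> r q :: real
    and \<kappa> :: "(nat \<Rightarrow> nat) \<Rightarrow> real"
  assumes "CARD('k) \<in> {1, 2, 3}"
    and "bounded D" and "lipschitz_domain D"
    and "f \<in> L2 D" and "abar \<in> Linf D" and "\<And>j. \<psi> j \<in> Linf D"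
    and "\<And>y. y \<in> U \<Longrightarrow> weak_solution D (affine_coeff abar \<psi> y) f (u y)"
    and "\<And>k. t k \<in> {-1..1}" and "inj t"
    and "\<theta> \<ge> 1"
    and "(\<forall>k. sup_op_norm (interp t k) \<le> (1 + real k) powr \<theta>) \<or>
         (\<forall>k. sup_op_norm (interp_diff t k) \<le> (1 + real k) powr \<theta>)"
    and "r > 0"
    and "AE x in lebesgue_on D. summable (\<lambda>j. \<rho> j * \<bar>\<psi> j x\<bar>) \<and>
           (\<Sum>j. \<rho> j * \<bar>\<psi> j x\<bar>) \<le> abar x - r"
    and "0 < q" and "q < 2"
    and "\<And>j. \<rho> j > 1"
    and "summable (\<lambda>j. inverse (\<rho> j) powr q)"
    and "\<kappa> = (\<lambda>\<nu>. pi_weight \<theta> \<nu> * mpow (\<lambda>j. inverse (\<rho> j)) \<nu>) \<or>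
         \<kappa> = (\<lambda>\<nu>. pi_weight \<theta> \<nu> * (beta_weight \<nu>)\<^sup>2 * mpow (\<lambda>j. inverse (\<rho> j)) \<nu>)"
  shows "\<exists>C::real. \<forall>n\<ge>1. \<forall>\<Lambda>. downward_closed \<Lambda> \<and> n_largest (monotone_majorant \<kappa>) n \<Lambda> \<longrightarrow>
           Linf_U_V_norm D (\<lambda>y x. u y x - interp_op t \<Lambda> u y x)
             \<le> ereal (C * real n powr (- (1 / q - 1 / 2)))"
proof -
  let ?b = "\<lambda>j. inverse (\<rho> j)"
  have b: "0 < ?b j" "?b j < 1" for j
    using \<open>\<And>j. \<rho> j > 1\<close>[of j] by (auto intro: less_trans[OF zero_less_one] simp: inverse_less_1_iff)
  note qs = \<open>summable (\<lambda>j. inverse (\<rho> j) powr q)\<close>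
  interpret elliptic_problem D f abar \<psi> u \<rho> r
    using assms by unfold_locales (auto simp: lipschitz_domain_def)
  have mpow0: "0 \<le> mpow ?b \<nu>" for \<nu>
    unfolding mpow_def using b(1) by (intro prod_nonneg zero_le_power less_imp_le) auto
  have beta: "(beta_weight \<nu>)\<^sup>2 = (\<Prod>j\<in>supp \<nu>. 1 + 2 * real (\<nu> j))" for \<nu>
    by (simp add: beta_weight_def prod_power_distrib)
  have beta1: "1 \<le> (beta_weight \<nu>)\<^sup>2" for \<nu>
    unfolding beta by (intro prod_ge_1) auto
  have pi0: "0 \<le> pi_weight \<theta> \<nu>" for \<nu> using pi_weight_ge_1[of \<theta> \<nu>] \<open>\<theta> \<ge> 1\<close> by simp
  have lower: "pi_weight \<theta> \<nu> * mpow ?b \<nu> \<le> \<kappa> \<nu>" for \<nu>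
    using assms(18) beta1[of \<nu>] pi0[of \<nu>] mpow0[of \<nu>]
      mult_right_mono[OF mult_left_mono[OF beta1[of \<nu>] pi0[of \<nu>]] mpow0[of \<nu>]] by auto
  have full: "pi_weight \<theta> \<nu> * (beta_weight \<nu>)\<^sup>2 * mpow ?b \<nu>
      = (\<Prod>j\<in>supp \<nu>. (1 + real (\<nu> j)) powr (\<theta> + 1) * (1 + 2 * real (\<nu> j)) * ?b j ^ \<nu> j)" for \<nu>
    unfolding beta pi_weight_def mpow_def prod.distrib ..
  have upper: "\<kappa> \<nu> \<le> (\<Prod>j\<in>supp \<nu>. (1 + real (\<nu> j)) powr (\<theta> + 1) * (1 + 2 * real (\<nu> j)) * ?b j ^ \<nu> j)" for \<nu>
    unfolding full[symmetric] using assms(18)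
      mult_right_mono[OF mult_left_mono[OF beta1[of \<nu>] pi0[of \<nu>]] mpow0[of \<nu>]] by auto
  have \<kappa>0: "0 \<le> \<kappa> \<nu>" for \<nu>
    using lower[of \<nu>] mult_nonneg_nonneg[OF pi0[of \<nu>] mpow0[of \<nu>]] by linarith
  let ?K = "monotone_majorant \<kappa>"
  obtain S where S: "0 \<le> S"
      "\<And>F. finite F \<Longrightarrow> F \<subseteq> multi_indices \<Longrightarrow> (\<Sum>\<nu>\<in>F. ?K \<nu> powr q) \<le> S"
    and K: "\<And>\<nu>. \<nu> \<in> multi_indices \<Longrightarrow> \<kappa> \<nu> \<le> ?K \<nu>"
    by (rule monotone_majorant_summable[OF b qs \<open>0 < q\<close> \<kappa>0 upper]) blast
  obtain \<sigma> where \<sigma>: "\<sigma> < 1" "AE x in lebesgue_on D. abar x - r \<le> \<sigma> * abar x"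
    by (rule contraction_factor)
  let ?s = "1 / q - 1 / 2"
  let ?E = "sqrt (1 / r) * sqrt (weighted_inner abar (grad_u (\<lambda>_. 0)) (grad_u (\<lambda>_. 0)) / (1 - \<sigma>))"
  show ?thesis
  proof (intro exI[of _ "?E * (2 * S powr (1 / q))"] allI impI)
    fix n :: nat and \<Lambda>
    assume n: "1 \<le> n" and \<Lambda>: "downward_closed \<Lambda> \<and> n_largest ?K n \<Lambda>"
    define R where "R = 2 * (S powr (1 / q) * real n powr (- ?s))"
    have R: "(\<Sum>\<nu>\<in>G. (2 * pi_weight \<theta> \<nu> * mpow ?b \<nu>)\<^sup>2) \<le> R\<^sup>2"
      if G: "finite G" "G \<subseteq> multi_indices - \<Lambda>" for G
    proof -
      have "(\<Sum>\<nu>\<in>G. (2 * pi_weight \<theta> \<nu> * mpow ?b \<nu>)\<^sup>2) \<le> (\<Sum>\<nu>\<in>G. 4 * (?K \<nu>)\<^sup>2)"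
      proof (rule sum_mono)
        fix \<nu> assume "\<nu> \<in> G"
        then have "pi_weight \<theta> \<nu> * mpow ?b \<nu> \<le> ?K \<nu>"
          using G(2) by (intro order.trans[OF lower K]) auto
        then have "(pi_weight \<theta> \<nu> * mpow ?b \<nu>)\<^sup>2 \<le> (?K \<nu>)\<^sup>2"
          using pi0 mpow0 by (intro power_mono) auto
        then show "(2 * pi_weight \<theta> \<nu> * mpow ?b \<nu>)\<^sup>2 \<le> 4 * (?K \<nu>)\<^sup>2"
          by (simp add: power_mult_distrib)
      qed
      also have "\<dots> = 4 * (\<Sum>\<nu>\<in>G. (?K \<nu>)\<^sup>2)" by (simp add: sum_distrib_left)
      also have "\<dots> \<le> 4 * (S powr (1 / q) * real n powr (- ?s))\<^sup>2"
        using \<Lambda> n S \<kappa>0 K \<open>0 < q\<close> \<open>q < 2\<close> G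
        by (intro mult_left_mono n_largest_tail) (auto intro: order.trans)
      also have "\<dots> = R\<^sup>2" by (simp add: R_def power_mult_distrib)
      finally show ?thesis .
    qed
    have "V_norm D (\<lambda>x. u y x - interp_op t \<Lambda> u y x) \<le> ?E * (2 * S powr (1 / q)) * real n powr (- ?s)"
      if y: "y \<in> U" for y
    proof -
      have "V_norm D (\<lambda>x. u y x - interp_op t \<Lambda> u y x)
          \<le> sqrt (1 / r) * (sqrt (weighted_inner abar (grad_u (\<lambda>_. 0)) (grad_u (\<lambda>_. 0)) / (1 - \<sigma>)) * R)"
        using \<Lambda> assms(8-11) y \<sigma> mpow_square_summable[OF b qs \<open>q < 2\<close>] R
        by (intro interpolation_estimate[where \<theta> = \<theta>]) (auto simp: n_largest_def R_def)
      then show ?thesis by (simp add: R_def mult_ac)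
    qed
    then show "Linf_U_V_norm D (\<lambda>y x. u y x - interp_op t \<Lambda> u y x)
        \<le> ereal (?E * (2 * S powr (1 / q)) * real n powr (- ?s))"
      unfolding Linf_U_V_norm_def by (intro SUP_least) simp
  qed
qed

end
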